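(* Let $X$ be a finite multiset of nonzero vectors spanning $\mathbb{R}^n$, let $I\in\mathbb{I}(X)$, let $\prec$ be a total order on $X$ in which the elements of $I$ come last, i.e. $x\prec y$ for all $x\in X\setminus I$ and $y\in I$, and let $\mathcal{H}(X,\lambda)$ be a simple hyperplane arrangement. Then: 1. $\mathcal{D}_-(X,I)=\Pi(V_-(X,\lambda,I))$; in particular $\dim\mathcal{D}_-(X,I)=\#\mathbb{B}_-(X,I)$. 2. $\mathcal{J}_-(X,I)\oplus\mathcal{P}_-(X,I)=\Pi$. 3. The map $p\mapsto\langle p,\cdot\rangle$ is an isomorphism from $\mathcal{P}_-(X,I)$ onto the dual space $\mathcal{D}_-(X,I)^*$.
   Context: **Polynomials.** $\Pi=\mathbb{C}[t_1,\dots,t_n]$, and $\Pi_k^0$ is its subspace of homogeneous polynomials of degree $k$ (including $0$). For $p\in\Pi$, $p(D)$ is the constant-coefficient differential operator obtained by substituting $\partial/\partial t_i$ for $t_i$. For $p,q\in\Pi$, $\langle p,q\rangle:=(p(D)q)(0)$. For a homogeneous ideal $J\subset\Pi$, $\ker J:=\{q\in\Pi:\ p(D)q=0\text{ for all }p\in J\}$. For $x\in\mathbb{R}^n$, $p_x(t):=x\cdot t$ (standard inner product). For a finite multiset $Y$ of vectors, $p_Y:=\prod_{y\in Y}p_y$, with $p_\emptyset=1$. **The multiset $X$.** $X$ is a finite multiset of nonzero vectors spanning $\mathbb{R}^n$ (the columns of an $n\times N$ matrix of rank $n$). Repeated vectors are distinct elements of $X$, subsets of $X$ are submultisets, and cardinalities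 count multiplicities. $\mathbb{B}(X)$ is the collection of subsets of $X$ that are bases of $\mathbb{R}^n$. $\mathbb{I}(X)$ is the collection of all linearly independent subsets of $X$ (including $\emptyset$). For a subspace $S$, $X\setminus S$ is the multiset of elements of $X$ not in $S$. For $b\in X$, $X\setminus b$ is $X$ with the element $b$ removed (once). **The space $\mathcal{P}_-(X,I)$.** For any finite multiset $A$ of nonzero vectors in $\mathbb{R}^n$, $\mathcal{P}(A):=\mathrm{span}\{p_Y:\ Y\subset A,\ \mathrm{rank}(A\setminus Y)=n\}$ (so $\mathcal{P}(A)=0$ if $\mathrm{rank}\,A<n$). For $I\in\mathbb{I}(X)$, $\mathcal{P}_-(X,I):=\bigcap_{b\in I}\mathcal{P}(X\setminus b)$, with the convention $\mathcal{P}_-(X,\emptyset)=\mathcal{P}(X)$. **$I$-internal bases.** Let $B\in\mathbb{B}(X)$. An element $b\in B$ is $I$-internally active in $B$ if $b\in I$ and $b$ is the $\prec$-maximal element of $X\setminus\mathrm{span}(B\setminus b)$. $B$ is $I$-internal if no $b\in B$ is $I$-internally active in $B$. $\mathbb{B}_-(X,I)$ is the set of all $I$-internal bases. **The ideal $\mathcal{J}_-(X,I)$.** $Y\subset X$ is $I$-long if $Y\cap B\neq\emptyset$ for every $B\in\mathbb{B}_-(X,I)$. Put $\mathcal{J}_-(X,I):=\mathrm{Ideal}\{p_Y:\ Y\subset X\text{ is }I\text{-long}\}$ and $\mathcal{D}_-(X,I):=\ker\mathcal{J}_-(X,I)$. **Hyperplane arrangement.** For $\lambda=(\lambda_x)_{x\in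 X}\in\mathbb{R}^{X}$, $\mathcal{H}(X,\lambda)$ is the arrangement of the hyperplanes $H_{x,\lambda_x}=\{t\in\mathbb{R}^n:\ p_x(t)=\lambda_x\}$, $x\in X$. It is simple if the intersection of every subcollection of $m$ of these hyperplanes (indexed by elements of $X$) is either empty or of codimension $m$. In that case the map sending $B\in\mathbb{B}(X)$ to the single point $v_B$ of $\bigcap_{b\in B}H_{b,\lambda_b}$ is a bijection onto the vertex set of the arrangement. Put $V_-(X,\lambda,I):=\{v_B:\ B\in\mathbb{B}_-(X,I)\}$. **The least map.** For a finite set $V\subset\mathbb{R}^n$, let $\mathrm{Exp}(V)$ be the span of the functions $t\mapsto e^{v\cdot t}$, $v\in V$. For $0\ne f\in\mathrm{Exp}(V)$ with homogeneous power expansion $f=\sum_{j\ge j_f}f_j$, $f_j\in\Pi_j^0$, $f_{j_f}\neq 0$, put $f_\downarrow:=f_{j_f}$. Then $\Pi(V):=\mathrm{span}\{f_\downarrow:\ f\in\mathrm{Exp}(V)\setminus 0\}$. *)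

theory Defs
  imports "HOL-Analysis.Analysis" "HOL-Library.Poly_Mapping"
begin

section \<open>Polynomials\<close>

text \<open>
  The ring of complex polynomials in the variables indexed by the finite type \<open>'n\<close>: finitely
  supported maps from exponent vectors to coefficients, with the convolution product of
  \<^theory>\<open>HOL-Library.Poly_Mapping\<close>.
\<close>

type_synonym 'n cpoly = "('n \<Rightarrow>\<^sub>0 nat) \<Rightarrow>\<^sub>0 complex"

abbreviation "lookup \<equiv> Poly_Mapping.lookup"
abbreviation "single \<equiv> Poly_Mapping.single"
abbreviation "keys \<equiv> Poly_Mapping.keys"

definition cscale :: "complex \<Rightarrow> 'n cpoly \<Rightarrow> 'n cpoly" where
  "cscale c p = Poly_Mapping.map ((*) c) p"

lemma lookup_cscale: "lookup (cscale c p) \<alpha> = c * lookup p \<alpha>"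
  by (simp add: cscale_def Poly_Mapping.map.rep_eq when_def)

global_interpretation cpoly: vector_space cscale
  defines cspan = cpoly.span and cdim = cpoly.dim
  by unfold_locales
    (auto intro!: poly_mapping_eqI simp: lookup_cscale lookup_add algebra_simps)

text \<open>An ideal of a commutative ring is a submodule of the ring regarded as a module over itself.\<close>

global_interpretation ring_module: module "(*) :: 'a::comm_ring_1 \<Rightarrow> 'a \<Rightarrow> 'a"
  defines ideal_generated = ring_module.span
  by unfold_locales (auto simp: algebra_simps)

definition poly_eval :: "('n::finite) cpoly \<Rightarrow> real^'n \<Rightarrow> complex" where
  "poly_eval p t = (\<Sum>\<alpha>\<in>keys p. lookup p \<alpha> * (\<Prod>i\<in>UNIV. of_real (t $ i) ^ lookup \<alpha> i))"

definition homogeneous :: "nat \<Rightarrow> ('n::finite) cpoly \<Rightarrow> bool" where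
  "homogeneous k p \<longleftrightarrow> (\<forall>\<alpha>\<in>keys p. (\<Sum>i\<in>UNIV. lookup \<alpha> i) = k)"

text \<open>
  The partial derivative in the variable \<open>i\<close> turns exponent \<open>\<alpha>\<close> into \<open>\<alpha> - single i 1\<close>, with factor
  \<open>lookup \<alpha> i\<close>. Subtraction of exponents is truncated, which only matters when that factor is 0.
\<close>

definition partial_deriv :: "'n \<Rightarrow> 'n cpoly \<Rightarrow> 'n cpoly" where
  "partial_deriv i q =
     (\<Sum>\<alpha>\<in>keys q. single (\<alpha> - single i 1) (of_nat (lookup \<alpha> i) * lookup q \<alpha>))"

lemma lookup_partial_deriv:
  "lookup (partial_deriv i q) \<beta> =
     of_nat (lookup \<beta> i + 1) * lookup q (\<beta> + single i 1)"
proof -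
  let ?e = "single i (1::nat)"
  have shift: "\<alpha> = \<beta> + ?e" if "\<alpha> - ?e = \<beta>" "lookup \<alpha> i \<noteq> 0" for \<alpha>
  proof (rule poly_mapping_eqI)
    fix k
    have "lookup \<beta> k = lookup \<alpha> k - lookup ?e k"
      using that(1) by (auto simp: lookup_minus)
    then show "lookup \<alpha> k = lookup (\<beta> + ?e) k"
      using that(2) by (auto simp: lookup_add lookup_single when_def)
  qed
  have "lookup (partial_deriv i q) \<beta> =
      (\<Sum>\<alpha>\<in>keys q. if \<alpha> - ?e = \<beta> then of_nat (lookup \<alpha> i) * lookup q \<alpha> else 0)"
    unfolding partial_deriv_def lookup_sum by (simp add: lookup_single when_def)
  also have "\<dots> = (\<Sum>\<alpha>\<in>keys q. if \<alpha> = \<beta> + ?e then of_nat (lookup \<alpha> i) * lookup q \<alpha> else 0)"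
    by (rule sum.cong) (use shift in auto)
  also have "\<dots> = of_nat (lookup \<beta> i + 1) * lookup q (\<beta> + ?e)"
    by (simp add: lookup_add lookup_single in_keys_iff)
  finally show ?thesis .
qed

lemma partial_deriv_commute:
  "partial_deriv i (partial_deriv j q) = partial_deriv j (partial_deriv i q)"
proof (cases "i = j")
  case False
  show ?thesis
  proof (rule poly_mapping_eqI)
    fix \<beta>
    have "\<beta> + single i 1 + single j 1 = \<beta> + single j 1 + single i (1::nat)"
      by (metis add.assoc add.commute)
    then show "lookup (partial_deriv i (partial_deriv j q)) \<beta>
        = lookup (partial_deriv j (partial_deriv i q)) \<beta>"
      using False by (simp only: lookup_partial_deriv) (simp add: lookup_add lookup_single when_def)
  qed
qed simp

lemma partial_deriv_funpow_commute:
  "(partial_deriv i ^^ a) ((partial_deriv j ^^ b) q) =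
   (partial_deriv j ^^ b) ((partial_deriv i ^^ a) q)"
proof -
  have 1: "partial_deriv i ((partial_deriv j ^^ b) q) = (partial_deriv j ^^ b) (partial_deriv i q)"
    for q by (induction b) (simp_all add: partial_deriv_commute[of i j])
  show ?thesis by (induction a) (simp_all add: 1)
qed

text \<open>The composition of the partial derivatives, each iterated \<open>lookup \<alpha> i\<close> times, over all \<open>i\<close>.\<close>

definition monomial_diff :: "('n::finite \<Rightarrow>\<^sub>0 nat) \<Rightarrow> 'n cpoly \<Rightarrow> 'n cpoly" where
  "monomial_diff \<alpha> q = Finite_Set.fold (\<lambda>i. partial_deriv i ^^ lookup \<alpha> i) q UNIV"

text \<open>The fold above does not depend on the order of the variables.\<close>

lemma comp_fun_commute_partial_deriv:
  "comp_fun_commute (\<lambda>i. partial_deriv i ^^ lookup \<alpha> i)"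
  by unfold_locales (simp add: fun_eq_iff partial_deriv_funpow_commute)

definition diff_op :: "('n::finite) cpoly \<Rightarrow> 'n cpoly \<Rightarrow> 'n cpoly" where
  "diff_op p q = (\<Sum>\<alpha>\<in>keys p. cscale (lookup p \<alpha>) (monomial_diff \<alpha> q))"

definition pairing :: "('n::finite) cpoly \<Rightarrow> 'n cpoly \<Rightarrow> complex" where
  "pairing p q = poly_eval (diff_op p q) 0"

definition ker_ideal :: "('n::finite) cpoly set \<Rightarrow> 'n cpoly set" where
  "ker_ideal J = {q. \<forall>p\<in>J. diff_op p q = 0}"

text \<open>
  The algebraic dual of a linear subspace \<open>D\<close>. A functional on \<open>D\<close> is represented by a function
  taking the value \<open>undefined\<close> off \<open>D\<close>, so that distinct elements are distinct functionals.
\<close>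

definition dual_space :: "'n cpoly set \<Rightarrow> ('n cpoly \<Rightarrow> complex) set" where
  "dual_space D =
     {\<phi> \<in> extensional D.
        (\<forall>u\<in>D. \<forall>v\<in>D. \<phi> (u + v) = \<phi> u + \<phi> v) \<and> (\<forall>c. \<forall>u\<in>D. \<phi> (cscale c u) = c * \<phi> u)}"

definition linear_form :: "real^'n \<Rightarrow> 'n cpoly" where
  "linear_form x = (\<Sum>i\<in>UNIV. single (single i 1) (of_real (x $ i)))"


section \<open>Multisets of vectors\<close>

text \<open>
  A multiset of vectors is a family \<open>X\<close> of vectors indexed by a set \<open>E\<close>; the elements of the
  multiset are the members of \<open>E\<close>, so equal vectors with different indices are distinct elements.
  Submultisets are subsets of \<open>E\<close>.
\<close>

definition indep_subsets :: "('e \<Rightarrow> real^'n) \<Rightarrow> 'e set \<Rightarrow> 'e set set" where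
  "indep_subsets X E = {B. B \<subseteq> E \<and> inj_on X B \<and> independent (X ` B)}"

definition bases :: "('e \<Rightarrow> real^'n) \<Rightarrow> 'e set \<Rightarrow> 'e set set" where
  "bases X E = {B \<in> indep_subsets X E. span (X ` B) = UNIV}"

definition form_prod :: "('e \<Rightarrow> real^'n) \<Rightarrow> 'e set \<Rightarrow> 'n cpoly" where
  "form_prod X Y = (\<Prod>y\<in>Y. linear_form (X y))"

definition P_central :: "('e \<Rightarrow> real^'n) \<Rightarrow> 'e set \<Rightarrow> 'n cpoly set" where
  "P_central X A = cspan {form_prod X Y |Y. Y \<subseteq> A \<and> dim (X ` (A - Y)) = CARD('n)}"

definition P_minus :: "('e \<Rightarrow> real^'n) \<Rightarrow> 'e set \<Rightarrow> 'e set \<Rightarrow> 'n cpoly set" where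
  "P_minus X E I = (if I = {} then P_central X E else (\<Inter>b\<in>I. P_central X (E - {b})))"

text \<open>Here \<open>(x, y) \<in> r\<close> stands for \<open>x \<prec> y\<close>.\<close>

definition internally_active ::
  "('e \<Rightarrow> real^'n) \<Rightarrow> 'e set \<Rightarrow> 'e rel \<Rightarrow> 'e set \<Rightarrow> 'e set \<Rightarrow> 'e \<Rightarrow> bool" where
  "internally_active X E r I B b \<longleftrightarrow>
     (let C = {y \<in> E. X y \<notin> span (X ` (B - {b}))}
      in b \<in> I \<and> b \<in> C \<and> (\<forall>y\<in>C. y \<noteq> b \<longrightarrow> (y, b) \<in> r))"

definition internal_bases ::
  "('e \<Rightarrow> real^'n) \<Rightarrow> 'e set \<Rightarrow> 'e rel \<Rightarrow> 'e set \<Rightarrow> 'e set set" where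
  "internal_bases X E r I = {B \<in> bases X E. \<not> (\<exists>b\<in>B. internally_active X E r I B b)}"

definition long_subsets ::
  "('e \<Rightarrow> real^'n) \<Rightarrow> 'e set \<Rightarrow> 'e rel \<Rightarrow> 'e set \<Rightarrow> 'e set set" where
  "long_subsets X E r I = {Y. Y \<subseteq> E \<and> (\<forall>B\<in>internal_bases X E r I. Y \<inter> B \<noteq> {})}"

definition J_minus ::
  "('e \<Rightarrow> real^'n) \<Rightarrow> 'e set \<Rightarrow> 'e rel \<Rightarrow> 'e set \<Rightarrow> 'n cpoly set" where
  "J_minus X E r I = ideal_generated (form_prod X ` long_subsets X E r I)"

definition D_minus ::
  "('e \<Rightarrow> real^'n) \<Rightarrow> 'e set \<Rightarrow> 'e rel \<Rightarrow> 'e set \<Rightarrow> 'n cpoly set" where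
  "D_minus X E r I = ker_ideal (J_minus X E r I)"


section \<open>Hyperplane arrangements\<close>

definition hyperplane :: "('e \<Rightarrow> real^'n) \<Rightarrow> ('e \<Rightarrow> real) \<Rightarrow> 'e \<Rightarrow> (real^'n) set" where
  "hyperplane X lam e = {t. X e \<bullet> t = lam e}"

definition simple_arrangement :: "('e \<Rightarrow> real^'n) \<Rightarrow> 'e set \<Rightarrow> ('e \<Rightarrow> real) \<Rightarrow> bool" where
  "simple_arrangement X E lam \<longleftrightarrow>
     (\<forall>Y\<subseteq>E. (\<Inter>e\<in>Y. hyperplane X lam e) = {} \<or>
             aff_dim (\<Inter>e\<in>Y. hyperplane X lam e) = int CARD('n) - int (card Y))"

text \<open>For a basis \<open>B\<close> the intersection below is a singleton.\<close>

definition vertex :: "('e \<Rightarrow> real^'n) \<Rightarrow> ('e \<Rightarrow> real) \<Rightarrow> 'e set \<Rightarrow> real^'n" where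
  "vertex X lam B = the_elem (\<Inter>b\<in>B. hyperplane X lam b)"

definition V_minus ::
  "('e \<Rightarrow> real^'n) \<Rightarrow> 'e set \<Rightarrow> 'e rel \<Rightarrow> ('e \<Rightarrow> real) \<Rightarrow> 'e set \<Rightarrow> (real^'n) set" where
  "V_minus X E r lam I = vertex X lam ` internal_bases X E r I"


section \<open>The least map\<close>

text \<open>The complex span of the exponentials; used for finite \<open>V\<close> only.\<close>

definition Exp_space :: "(real^'n) set \<Rightarrow> (real^'n \<Rightarrow> complex) set" where
  "Exp_space V = {f. \<exists>c. f = (\<lambda>t. \<Sum>v\<in>V. c v * exp (of_real (v \<bullet> t)))}"

text \<open>
  \<open>is_least f g\<close>: \<open>g\<close> is the first nonzero term \<open>f\<^sub>\<down>\<close> of the homogeneous power expansion of \<open>f\<close>.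
  The expansion of \<open>f\<close>, if it exists, is unique, hence so is \<open>g\<close>.
\<close>

definition homogeneous_expansion :: "(real^'n \<Rightarrow> complex) \<Rightarrow> (nat \<Rightarrow> 'n cpoly) \<Rightarrow> bool" where
  "homogeneous_expansion f F \<longleftrightarrow>
     (\<forall>j. homogeneous j (F j)) \<and> (\<forall>t. (\<lambda>j. poly_eval (F j) t) sums f t)"

definition is_least :: "(real^'n \<Rightarrow> complex) \<Rightarrow> 'n cpoly \<Rightarrow> bool" where
  "is_least f g \<longleftrightarrow>
     (\<exists>F j. homogeneous_expansion f F \<and> F j \<noteq> 0 \<and> (\<forall>k<j. F k = 0) \<and> g = F j)"

definition least_space :: "(real^'n) set \<Rightarrow> 'n cpoly set" where
  "least_space V = cspan {g. \<exists>f\<in>Exp_space V. f \<noteq> (\<lambda>t. 0) \<and> is_least f g}"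

end

theory Submission
  imports Defs
begin

text \<open>
  Let \<open>N\<close> be the number of \<open>I\<close>-internal bases, and write \<open>J\<close>, \<open>P\<close>, \<open>D\<close> for the ideal, the
  semi-internal space and the kernel. The theorem follows from four facts:

  \<^item> \<open>codim J \<le> N\<close>,
  \<^item> \<open>P \<inter> J = 0\<close>,
  \<^item> \<open>dim P \<ge> N\<close>,
  \<^item> the least space of the \<open>N\<close> vertices has dimension \<open>N\<close> and lies in \<open>D\<close>.

  The first three give \<open>J \<oplus> P = \<Pi>\<close> and \<open>dim P = N\<close>. An element of \<open>D\<close> pairs
  to zero with all of \<open>J\<close>, so \<open>dim D \<le> codim J \<le> N\<close> and \<open>D\<close> is the least space. An
  element of \<open>D\<close> orthogonal to \<open>P\<close> is orthogonal to \<open>J + P = \<Pi>\<close> and hence zero, so the pairing between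
  \<open>P\<close> and \<open>D\<close>, two spaces of dimension \<open>N\<close>, is perfect.

  \<^emph>\<open>The least space.\<close> The operator \<open>p\<^sub>y(D) - \<lambda>\<^sub>y\<close> multiplies \<open>exp (v \<bullet> t)\<close> by \<open>y \<bullet> v - \<lambda>\<^sub>y\<close>. If \<open>Y\<close> is
  long, each vertex lies on a hyperplane belonging to \<open>Y\<close>, so the product of these operators
  over \<open>Y\<close> kills \<open>Exp(V)\<close>; its leading term \<open>p\<^sub>Y(D)\<close> then kills the least terms. The argument
  works for any family of bases in place of the internal ones (\<open>hitting_ideal_codim_ge\<close>).

  \<^emph>\<open>Deletion and contraction.\<close> Let \<open>x\<close> be the least element of \<open>X\<close>. Contraction is carried out inside
  \<open>\<Pi>\<close>, by keeping a set \<open>K\<close> of contracted elements and adding the forms \<open>p\<^sub>k\<close>, \<open>k \<in> K\<close>, to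
  all ideals. An exchange argument (\<open>exchange_into\<close>) shows that multiplication by \<open>p\<^sub>x\<close> and
  reduction modulo \<open>p\<^sub>x\<close> give \<open>codim J(X) \<le> codim J(X - x) + codim J(X / x)\<close>, and the internal bases are
  counted by the same recursion, whence \<open>codim J \<le> N\<close> (\<open>codim_hitting_ideal\<close>).
  As the least space forces \<open>codim J \<ge> N\<close>, the inequality is an equality at each stage of the recursion, and so
  \<open>p\<^sub>x q \<in> J(X)\<close> implies \<open>q \<in> J(X - x)\<close>.
  Now \<open>P\<close> lies in the \<^emph>\<open>power kernel\<close>: the polynomials killed by \<open>D\<^sub>\<eta>\<close> to the power \<open>m(\<eta>)\<close>, the number
  of elements not orthogonal to \<open>\<eta>\<close>, lowered by one if an element of \<open>I\<close> is among them.
  By the Leibniz rule this kernel passes to deletion and contraction, and induction shows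
  that it meets \<open>J\<close> only in zero (\<open>power_kernel_inter_hitting_ideal\<close>).

  \<^emph>\<open>The lower bound for P.\<close> For \<open>I = \<emptyset>\<close> the products of \<open>p\<^sub>x - \<lambda>\<^sub>x\<close> over the complement of a
  basis are dual to evaluation at the vertices. With the upper bound just obtained, \<open>P(A)\<close> is the power
  kernel of \<open>A\<close>, and therefore \<open>P\<close> is the power kernel of \<open>(X, I)\<close>. Adding to \<open>I\<close> a new
  smallest element \<open>b\<close> imposes on \<open>P\<close> the further equations \<open>D\<^sub>\<eta>\<^bsup>m(\<eta>)-1\<^esup> p = 0\<close> for the
  normals \<open>\<eta>\<close> of hyperplanes that contain \<open>I\<close> but not \<open>b\<close>. For one such \<open>\<eta>\<close> the left side lies in
  the semi-internal space of \<open>b\<close> together with the elements orthogonal to \<open>\<eta>\<close>, whose dimension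
  is at most the number of bases in which \<open>b\<close> becomes active through this hyperplane. Summing over the hyperplanes, at
  most as many dimensions are lost as bases (\<open>P_minus_dim_step\<close>).
\<close>

section \<open>Polynomials and their derivatives\<close>

text \<open>
  For a ring acting on itself this rule is associativity read from right to left, which makes
  the simplifier loop against \<open>mult.assoc\<close>.
\<close>

declare ring_module.scale_scale [simp del]

abbreviation var :: "'n \<Rightarrow> 'n cpoly" where
  "var i \<equiv> single (single i 1) 1"

lemma poly_mapping_sum_singles: "p = (\<Sum>\<alpha>\<in>keys p. single \<alpha> (lookup p \<alpha>))"
  by (rule poly_mapping_eqI) (simp add: lookup_sum lookup_single when_def in_keys_iff)

lemma cscale_single: "cscale c (single \<alpha> d) = single \<alpha> (c * d)"
  by (rule poly_mapping_eqI) (simp add: lookup_cscale lookup_single when_def)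

lemma cpoly_induct_single [case_names zero single add]:
  assumes "P 0" "\<And>\<alpha> c. P (single \<alpha> c)" "\<And>p q. P p \<Longrightarrow> P q \<Longrightarrow> P (p + q)"
  shows "P (p :: 'n cpoly)"
proof -
  have "P (\<Sum>\<alpha>\<in>A. single \<alpha> (lookup p \<alpha>))" if "finite A" for A
    using that by induction (auto intro: assms)
  then show ?thesis
    by (subst poly_mapping_sum_singles) simp
qed

lemma cscale_eq_mult: "cscale c p = single 0 c * p"
  by (induction p rule: cpoly_induct_single)
    (simp_all add: cpoly.scale_right_distrib cscale_single mult_single algebra_simps)

lemma cscale_mult_left: "cscale c p * q = cscale c (p * q)"
  unfolding cscale_eq_mult by (rule mult.assoc)

lemma cscale_mult_right: "p * cscale c q = cscale c (p * q)"
  by (metis cscale_mult_left mult.commute)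

lemma exponent_cases:
  fixes \<alpha> :: "'n \<Rightarrow>\<^sub>0 nat"
  obtains "\<alpha> = 0" | i \<beta> where "\<alpha> = single i 1 + \<beta>" 
proof (cases "\<alpha> = 0")
  case False
  then obtain i where i: "lookup \<alpha> i \<noteq> 0"
    by (metis lookup_zero poly_mapping_eqI)
  have "\<alpha> = single i 1 + (\<alpha> - single i 1)"
    by (rule poly_mapping_eqI) (use i in \<open>auto simp: lookup_add lookup_minus lookup_single when_def\<close>)
  with that show ?thesis by blast
qed (use that in auto)

lemma exponent_induct [case_names zero add]:
  fixes \<alpha> :: "'n::finite \<Rightarrow>\<^sub>0 nat"
  assumes "P 0" "\<And>i \<beta>. P \<beta> \<Longrightarrow> P (single i 1 + \<beta>)"
  shows "P \<alpha>"
proof (induction "\<Sum>i\<in>UNIV. lookup \<alpha> i" arbitrary: \<alpha> rule: less_induct)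
  case less
  show ?case
  proof (cases \<alpha> rule: exponent_cases)
    case (2 i \<beta>)
    have "(\<Sum>j\<in>UNIV. lookup \<alpha> j) = 1 + (\<Sum>j\<in>UNIV. lookup \<beta> j)"
      using 2 by (simp add: lookup_add sum.distrib lookup_single when_def)
    then show ?thesis using less 2 assms(2) by simp
  qed (use assms(1) in simp)
qed

text \<open>
  Identities between linear operators need checking only on \<open>1\<close> and under multiplication by a
  variable, where the product rule is available.
\<close>

lemma cpoly_induct [case_names one var scale add]:
  fixes p :: "'n::finite cpoly"
  assumes "P 1" "\<And>i p. P p \<Longrightarrow> P (var i * p)" "\<And>c p. P p \<Longrightarrow> P (cscale c p)"
    "\<And>p q. P p \<Longrightarrow> P q \<Longrightarrow> P (p + q)"
  shows "P p"
proof (induction p rule: cpoly_induct_single)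
  case zero
  show ?case using assms(3)[OF assms(1), of 0] by simp
next
  case (single \<alpha> c)
  have "P (single \<alpha> 1)"
  proof (induction \<alpha> rule: exponent_induct)
    case zero
    show ?case using assms(1) by simp
  next
    case (add i \<beta>)
    have "single (single i 1 + \<beta>) (1::complex) = var i * single \<beta> 1"
      by (simp add: mult_single)
    then show ?case using assms(2)[OF add] by simp
  qed
  from assms(3)[OF this, of c] show ?case by (simp add: cscale_single)
qed (use assms(4) in auto)

lemma partial_deriv_add: "partial_deriv i (p + q) = partial_deriv i p + partial_deriv i q"
  by (rule poly_mapping_eqI) (simp add: lookup_partial_deriv lookup_add algebra_simps)

lemma partial_deriv_scale: "partial_deriv i (cscale c q) = cscale c (partial_deriv i q)"
  by (rule poly_mapping_eqI) (simp add: lookup_partial_deriv lookup_cscale algebra_simps)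

lemma monomial_diff_zero: "monomial_diff 0 q = q"
proof -
  have "Finite_Set.fold (\<lambda>i. partial_deriv i ^^ lookup 0 i) q A = q" if "finite A" for A :: "'a set"
    using that
  proof induction
    case (insert x A)
    interpret comp_fun_commute "\<lambda>i. partial_deriv i ^^ lookup (0 :: 'a \<Rightarrow>\<^sub>0 nat) i"
      by (rule comp_fun_commute_partial_deriv)
    show ?case unfolding fold_insert[OF insert(1,2)] insert.IH by simp
  qed simp
  then show ?thesis by (simp add: monomial_diff_def)
qed

text \<open>
  The fold does not depend on the order of the variables and may end with \<open>i\<close>, so one more factor \<open>t\<^sub>i\<close> is one more derivative.
  This turns the fold into a recursion on exponents.
\<close>

lemma monomial_diff_step: "monomial_diff (single i 1 + \<alpha>) q = partial_deriv i (monomial_diff \<alpha> q)"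
proof -
  let ?f = "\<lambda>\<alpha> i. partial_deriv i ^^ lookup (\<alpha> :: 'a \<Rightarrow>\<^sub>0 nat) i"
  have ins: "monomial_diff \<beta> q = ?f \<beta> i (Finite_Set.fold (?f \<beta>) q (UNIV - {i}))" for \<beta>
  proof -
    interpret comp_fun_commute "?f \<beta>"
      by (rule comp_fun_commute_partial_deriv)
    show ?thesis
      unfolding monomial_diff_def using fold_rec[of UNIV i q] by simp
  qed
  have "Finite_Set.fold (?f (single i 1 + \<alpha>)) q (UNIV - {i}) = Finite_Set.fold (?f \<alpha>) q (UNIV - {i})"
    by (rule fold_closed_eq[where B = UNIV]) (auto simp: lookup_add lookup_single when_def)
  then show ?thesis
    by (simp add: ins lookup_add)
qed

lemma monomial_diff_add: "monomial_diff \<alpha> (p + q) = monomial_diff \<alpha> p + monomial_diff \<alpha> q"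
  by (induction \<alpha> rule: exponent_induct)
    (simp_all only: monomial_diff_zero monomial_diff_step partial_deriv_add)

lemma monomial_diff_scale: "monomial_diff \<alpha> (cscale c q) = cscale c (monomial_diff \<alpha> q)"
  by (induction \<alpha> rule: exponent_induct)
    (simp_all only: monomial_diff_zero monomial_diff_step partial_deriv_scale)

lemma diff_op_superset:
  assumes "finite A" "keys p \<subseteq> A"
  shows "diff_op p q = (\<Sum>\<alpha>\<in>A. cscale (lookup p \<alpha>) (monomial_diff \<alpha> q))"
  unfolding diff_op_def using assms
  by (intro sum.mono_neutral_left) (auto simp: in_keys_iff)

lemma diff_op_add_left: "diff_op (p + p') q = diff_op p q + diff_op p' q"
proof -
  let ?A = "keys p \<union> keys p'"
  have "diff_op (p + p') q = (\<Sum>\<alpha>\<in>?A. cscale (lookup (p + p') \<alpha>) (monomial_diff \<alpha> q))"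
    by (rule diff_op_superset) (simp_all add: Poly_Mapping.keys_add)
  moreover have "diff_op p q = (\<Sum>\<alpha>\<in>?A. cscale (lookup p \<alpha>) (monomial_diff \<alpha> q))"
    by (rule diff_op_superset) simp_all
  moreover have "diff_op p' q = (\<Sum>\<alpha>\<in>?A. cscale (lookup p' \<alpha>) (monomial_diff \<alpha> q))"
    by (rule diff_op_superset) simp_all
  ultimately show ?thesis
    by (simp add: lookup_add cpoly.scale_left_distrib sum.distrib)
qed

lemma diff_op_scale_left: "diff_op (cscale c p) q = cscale c (diff_op p q)"
proof -
  have "diff_op (cscale c p) q = (\<Sum>\<alpha>\<in>keys p. cscale (lookup (cscale c p) \<alpha>) (monomial_diff \<alpha> q))"
    by (rule diff_op_superset) (auto simp: in_keys_iff lookup_cscale)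
  also have "\<dots> = cscale c (diff_op p q)"
    by (simp add: diff_op_def cpoly.scale_sum_right lookup_cscale)
  finally show ?thesis .
qed

lemma diff_op_add_right: "diff_op p (q + q') = diff_op p q + diff_op p q'"
  by (simp add: diff_op_def monomial_diff_add cpoly.scale_right_distrib sum.distrib)

lemma diff_op_scale_right: "diff_op p (cscale c q) = cscale c (diff_op p q)"
  by (simp add: diff_op_def monomial_diff_scale cpoly.scale_sum_right mult.commute)

lemma diff_op_zero_left [simp]: "diff_op 0 q = 0"
  by (simp add: diff_op_def)

lemma diff_op_zero_right [simp]: "diff_op p 0 = 0"
  using diff_op_scale_right[of p 0 0] by simp

lemma diff_op_single: "diff_op (single \<alpha> c) q = cscale c (monomial_diff \<alpha> q)"
  by (subst diff_op_superset[of "{\<alpha>}"]) auto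

lemma diff_op_one [simp]: "diff_op 1 q = q"
  using diff_op_single[of 0 1 q] by (simp add: monomial_diff_zero)

lemma partial_deriv_zero [simp]: "partial_deriv i 0 = 0"
  by (simp add: partial_deriv_def)

lemma diff_op_var_mult: "diff_op (var i * p) q = partial_deriv i (diff_op p q)"
  by (induction p rule: cpoly_induct_single)
    (simp_all add: mult_single diff_op_single monomial_diff_step[simplified] partial_deriv_scale distrib_left
      diff_op_add_left partial_deriv_add)

lemma diff_op_var: "diff_op (var i) q = partial_deriv i q"
  using diff_op_var_mult[of i 1 q] by simp

text \<open>
  \<open>p \<mapsto> p(D)\<close> is a ring homomorphism into operators. This makes the kernel of an ideal
  depend only on generators, and the operators commute.
\<close>

lemma diff_op_mult: "diff_op (p * p') q = diff_op p (diff_op p' q)"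
  by (induction p rule: cpoly_induct)
    (simp_all add: diff_op_var_mult[simplified] mult.assoc cscale_mult_left diff_op_scale_left distrib_right
      diff_op_add_left)

lemma diff_op_commute: "diff_op p (diff_op p' q) = diff_op p' (diff_op p q)"
  by (metis diff_op_mult mult.commute)

lemma linear_form_eq_sum: "linear_form x = (\<Sum>i\<in>UNIV. cscale (of_real (x $ i)) (var i))"
  by (simp add: linear_form_def cscale_single)

lemma linear_form_add: "linear_form (x + y) = linear_form x + linear_form y"
  by (simp add: linear_form_def single_add sum.distrib)

lemma linear_form_scale: "linear_form (c *\<^sub>R x) = cscale (of_real c) (linear_form x)"
  by (simp add: linear_form_def cpoly.scale_sum_right cscale_single)

lemma linear_form_zero [simp]: "linear_form 0 = 0"
  by (simp add: linear_form_def)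

lemma var_eq_linear_form: "var i = linear_form (axis i 1)"
proof -
  have "linear_form (axis i 1) = (\<Sum>j\<in>UNIV. if j = i then var i else 0)"
    unfolding linear_form_def by (rule sum.cong) (auto simp: axis_def)
  then show ?thesis by simp
qed

lemma partial_deriv_var_mult:
  "partial_deriv i (var j * q) = (if i = j then q else 0) + var j * partial_deriv i q"
proof (induction q rule: cpoly_induct_single)
  case (single \<alpha> c)
  have pd: "partial_deriv i (single \<beta> c) = single (\<beta> - single i 1) (of_nat (lookup \<beta> i) * c)" for \<beta> and c :: complex
    by (cases "c = 0") (simp_all add: partial_deriv_def)
  show ?case
  proof (cases "i = j")
    case True
    have "lookup \<alpha> i \<noteq> 0 \<Longrightarrow> single i (Suc 0) + (\<alpha> - single i (Suc 0)) = \<alpha>"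
      by (rule poly_mapping_eqI) (auto simp: lookup_add lookup_minus lookup_single when_def)
    then have "var i * partial_deriv i (single \<alpha> c) = single \<alpha> (of_nat (lookup \<alpha> i) * c)"
      by (cases "lookup \<alpha> i = 0") (simp_all add: pd mult_single)
    moreover have "partial_deriv i (var i * single \<alpha> c) = single \<alpha> ((of_nat (lookup \<alpha> i) + 1) * c)"
      by (simp add: mult_single pd lookup_add add.commute)
    moreover have "single \<alpha> ((of_nat (lookup \<alpha> i) + 1) * c) = single \<alpha> c + single \<alpha> (of_nat (lookup \<alpha> i) * c)"
      by (simp add: distrib_right single_add add.commute)
    ultimately show ?thesis using True by simp
  next
    case False
    have "single j (Suc 0) + \<alpha> - single i (Suc 0) = single j (Suc 0) + (\<alpha> - single i (Suc 0))"
      using False by (intro poly_mapping_eqI) (auto simp: lookup_add lookup_minus lookup_single when_def)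
    with False show ?thesis
      by (simp add: mult_single pd lookup_add lookup_single when_def)
  qed
qed (simp_all add: distrib_left partial_deriv_add algebra_simps)

definition dir_deriv :: "real^'n \<Rightarrow> 'n::finite cpoly \<Rightarrow> 'n cpoly" where
  "dir_deriv \<eta> = diff_op (linear_form \<eta>)"

lemma diff_op_sum_left: "diff_op (sum f A) q = (\<Sum>a\<in>A. diff_op (f a) q)"
  by (induction A rule: infinite_finite_induct) (simp_all add: diff_op_add_left)

lemma dir_deriv_eq_sum: "dir_deriv \<eta> q = (\<Sum>i\<in>UNIV. cscale (of_real (\<eta> $ i)) (partial_deriv i q))"
  by (simp add: dir_deriv_def linear_form_eq_sum diff_op_sum_left diff_op_scale_left diff_op_var[simplified])

lemma dir_deriv_add: "dir_deriv \<eta> (p + q) = dir_deriv \<eta> p + dir_deriv \<eta> q"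
  by (simp add: dir_deriv_def diff_op_add_right)

lemma dir_deriv_scale: "dir_deriv \<eta> (cscale c q) = cscale c (dir_deriv \<eta> q)"
  by (simp add: dir_deriv_def diff_op_scale_right)

lemma dir_deriv_zero [simp]: "dir_deriv \<eta> 0 = 0"
  by (simp add: dir_deriv_def)

lemma dir_deriv_funpow_add: "(dir_deriv \<eta> ^^ k) (p + q) = (dir_deriv \<eta> ^^ k) p + (dir_deriv \<eta> ^^ k) q"
  by (induction k) (simp_all add: dir_deriv_add)

lemma dir_deriv_funpow_scale: "(dir_deriv \<eta> ^^ k) (cscale c q) = cscale c ((dir_deriv \<eta> ^^ k) q)"
  by (induction k) (simp_all add: dir_deriv_scale)

lemma dir_deriv_funpow_zero [simp]: "(dir_deriv \<eta> ^^ k) 0 = 0"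
  by (induction k) simp_all

lemma dir_deriv_scaled_direction: "dir_deriv (c *\<^sub>R \<eta>) q = cscale (of_real c) (dir_deriv \<eta> q)"
  by (simp add: dir_deriv_def linear_form_scale diff_op_scale_left)

lemma dir_deriv_var_mult: "dir_deriv \<eta> (var j * q) = cscale (of_real (\<eta> $ j)) q + var j * dir_deriv \<eta> q"
proof -
  have "dir_deriv \<eta> (var j * q)
      = (\<Sum>i\<in>UNIV. (if i = j then cscale (of_real (\<eta> $ i)) q else 0)
          + var j * cscale (of_real (\<eta> $ i)) (partial_deriv i q))"
    unfolding dir_deriv_eq_sum partial_deriv_var_mult
    by (rule sum.cong) (simp_all add: cpoly.scale_right_distrib cscale_mult_right)
  then show ?thesis
    by (simp add: sum.distrib dir_deriv_eq_sum flip: sum_distrib_left)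
qed

lemma dir_deriv_linear_form_mult:
  "dir_deriv \<eta> (linear_form x * q) = cscale (of_real (\<eta> \<bullet> x)) q + linear_form x * dir_deriv \<eta> q"
proof -
  have sum: "dir_deriv \<eta> (sum f A) = (\<Sum>a\<in>A. dir_deriv \<eta> (f a))" for f :: "'a \<Rightarrow> 'a cpoly" and A
    by (induction A rule: infinite_finite_induct) (simp_all add: dir_deriv_add)
  have "dir_deriv \<eta> (linear_form x * q) =
      (\<Sum>j\<in>UNIV. cscale (of_real (\<eta> $ j * x $ j)) q + cscale (of_real (x $ j)) (var j) * dir_deriv \<eta> q)"
    unfolding linear_form_eq_sum sum_distrib_right sum
    by (rule sum.cong) (simp_all only: cscale_mult_left dir_deriv_scale dir_deriv_var_mult
       cpoly.scale_right_distrib cpoly.scale_scale of_real_mult mult.commute[of "of_real (x $ _)"])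
  also have "\<dots> = cscale (of_real (\<eta> \<bullet> x)) q + linear_form x * dir_deriv \<eta> q"
    unfolding sum.distrib linear_form_eq_sum sum_distrib_right
    by (simp add: inner_vec_def flip: cpoly.scale_sum_left)
  finally show ?thesis .
qed

lemma dir_deriv_one [simp]: "dir_deriv \<eta> 1 = 0"
proof -
  have "partial_deriv i (1 :: 'a cpoly) = 0" for i
    by (simp add: partial_deriv_def)
  then show ?thesis by (simp add: dir_deriv_eq_sum)
qed

text \<open>
  Leibniz' rule with a factor of degree one: only two terms survive. For \<open>k = 0\<close> the second one
  vanishes by its coefficient.
\<close>

lemma dir_deriv_funpow_linear_form_mult:
  "(dir_deriv \<eta> ^^ k) (linear_form x * q) =
     linear_form x * (dir_deriv \<eta> ^^ k) q + cscale (of_nat k * of_real (\<eta> \<bullet> x)) ((dir_deriv \<eta> ^^ (k - 1)) q)"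
proof (induction k)
  case (Suc k)
  show ?case
  proof (cases k)
    case (Suc l)
    then show ?thesis using Suc.IH
      by (simp add: dir_deriv_add dir_deriv_linear_form_mult dir_deriv_scale algebra_simps
          flip: cpoly.scale_left_distrib)
  qed (simp add: dir_deriv_linear_form_mult)
qed simp

lemma dir_deriv_nilpotent: "\<exists>k. (dir_deriv \<eta> ^^ k) q = 0"
proof (induction q rule: cpoly_induct)
  case one
  show ?case by (rule exI[of _ 1]) simp
next
  case (var i q)
  then obtain k where k: "(dir_deriv \<eta> ^^ k) q = 0" by auto
  have "(dir_deriv \<eta> ^^ Suc k) (var i * q) = 0"
    unfolding var_eq_linear_form dir_deriv_funpow_linear_form_mult using k by simp
  then show ?case by blast
next
  case (scale c q)
  then obtain k where "(dir_deriv \<eta> ^^ k) q = 0" by auto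
  then have "(dir_deriv \<eta> ^^ k) (cscale c q) = 0" by (simp add: dir_deriv_funpow_scale)
  then show ?case by blast
next
  case (add p q)
  then obtain k l where "(dir_deriv \<eta> ^^ k) p = 0" "(dir_deriv \<eta> ^^ l) q = 0" by auto
  then have "(dir_deriv \<eta> ^^ (l + k)) p = 0" "(dir_deriv \<eta> ^^ (k + l)) q = 0"
    by (simp_all only: funpow_add o_apply dir_deriv_funpow_zero)
  then have "(dir_deriv \<eta> ^^ (k + l)) (p + q) = 0"
    by (simp add: dir_deriv_funpow_add add.commute)
  then show ?case by blast
qed

lemma dir_deriv_funpow_vanish_mono:
  assumes "(dir_deriv \<eta> ^^ k) q = 0" "k \<le> l"
  shows "(dir_deriv \<eta> ^^ l) q = 0"
proof -
  have "(dir_deriv \<eta> ^^ l) q = (dir_deriv \<eta> ^^ (l - k)) ((dir_deriv \<eta> ^^ k) q)"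
    using assms(2) by (simp flip: funpow_add o_apply[of "dir_deriv \<eta> ^^ (l - k)"])
  then show ?thesis using assms(1) by simp
qed

section \<open>The pairing and evaluation of polynomials\<close>

lemma poly_eval_zero_point: "poly_eval p 0 = lookup p 0"
proof -
  have "(\<Prod>i\<in>UNIV. complex_of_real ((0::real^'a) $ i) ^ lookup \<alpha> i) = (if \<alpha> = 0 then 1 else 0)" for \<alpha>
  proof (cases "\<alpha> = 0")
    case False
    then obtain i where "lookup \<alpha> i \<noteq> 0" by (metis lookup_zero poly_mapping_eqI)
    with False show ?thesis by (auto intro!: prod_zero)
  qed simp
  then have "poly_eval p 0 = (\<Sum>\<alpha>\<in>keys p. if \<alpha> = 0 then lookup p \<alpha> else 0)"
    unfolding poly_eval_def by (intro sum.cong) simp_all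
  then show ?thesis
    by (simp add: in_keys_iff)
qed

lemma pairing_eq: "pairing p q = lookup (diff_op p q) 0"
  by (simp add: pairing_def poly_eval_zero_point)

lemma pairing_add_left: "pairing (p + p') q = pairing p q + pairing p' q"
  by (simp add: pairing_eq diff_op_add_left lookup_add)

lemma pairing_add_right: "pairing p (q + q') = pairing p q + pairing p q'"
  by (simp add: pairing_eq diff_op_add_right lookup_add)

lemma pairing_scale_left: "pairing (cscale c p) q = c * pairing p q"
  by (simp add: pairing_eq diff_op_scale_left lookup_cscale)

lemma pairing_scale_right: "pairing p (cscale c q) = c * pairing p q"
  by (simp add: pairing_eq diff_op_scale_right lookup_cscale)

lemma pairing_zero_right [simp]: "pairing p 0 = 0"
  by (simp add: pairing_eq)

lemma pairing_zero_left [simp]: "pairing 0 p = 0"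
  by (simp add: pairing_eq)

lemma pairing_sum_left: "pairing (sum f A) q = (\<Sum>a\<in>A. pairing (f a) q)"
  by (induction A rule: infinite_finite_induct) (simp_all add: pairing_add_left)

lemma pairing_sum_right: "pairing q (sum f A) = (\<Sum>a\<in>A. pairing q (f a))"
  by (induction A rule: infinite_finite_induct) (simp_all add: pairing_add_right)

text \<open>
  The factor \<open>c\<close> is the quotient of factorials \<open>(\<alpha> + \<beta>)! / \<beta>!\<close>; only that it is nonzero matters.
\<close>

lemma lookup_monomial_diff: "\<exists>c\<noteq>0. \<forall>q. lookup (monomial_diff \<alpha> q) \<beta> = c * lookup q (\<alpha> + \<beta>)"
proof (induction \<alpha> arbitrary: \<beta> rule: exponent_induct)
  case zero
  show ?case by (rule exI[of _ 1]) (simp add: monomial_diff_zero)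
next
  case (add i \<alpha>)
  obtain c where "c \<noteq> 0" "\<forall>q. lookup (monomial_diff \<alpha> q) (\<beta> + single i 1) = c * lookup q (\<alpha> + (\<beta> + single i 1))"
    using add by blast
  then show ?case
    by (intro exI[of _ "of_nat (lookup \<beta> i + 1) * c"])
      (simp only: monomial_diff_step lookup_partial_deriv mult.assoc add.assoc
        add.left_commute[of \<alpha>] add.commute[of \<beta>] mult_eq_0_iff of_nat_eq_0_iff, simp add: add_ac)
qed

lemma pairing_nondegenerate:
  assumes "\<And>p. pairing p q = 0"
  shows "q = 0"
proof (rule poly_mapping_eqI)
  fix \<alpha>
  obtain c where "c \<noteq> 0" "lookup (monomial_diff \<alpha> q) 0 = c * lookup q (\<alpha> + 0)"
    using lookup_monomial_diff by blast
  moreover have "lookup (monomial_diff \<alpha> q) 0 = 0"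
    using assms[of "single \<alpha> 1"] by (simp add: pairing_eq diff_op_single)
  ultimately show "lookup q \<alpha> = lookup 0 \<alpha>" by simp
qed

lemma poly_eval_superset:
  assumes "finite A" "keys p \<subseteq> A"
  shows "poly_eval p t = (\<Sum>\<alpha>\<in>A. lookup p \<alpha> * (\<Prod>i\<in>UNIV. of_real (t $ i) ^ lookup \<alpha> i))"
  unfolding poly_eval_def using assms by (intro sum.mono_neutral_left) (auto simp: in_keys_iff)

lemma poly_eval_add: "poly_eval (p + q) t = poly_eval p t + poly_eval q t"
proof -
  let ?A = "keys p \<union> keys q"
  show ?thesis
    by (subst (1 2 3) poly_eval_superset[of ?A])
      (use Poly_Mapping.keys_add[of p q] in \<open>auto simp: lookup_add distrib_right sum.distrib\<close>)
qed

lemma poly_eval_scale: "poly_eval (cscale c p) t = c * poly_eval p t"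
  by (subst (1 2) poly_eval_superset[of "keys p"])
    (auto simp: in_keys_iff lookup_cscale sum_distrib_left mult.assoc)

lemma poly_eval_zero [simp]: "poly_eval 0 t = 0"
  by (simp add: poly_eval_def)

lemma poly_eval_one [simp]: "poly_eval 1 t = 1"
  by (simp add: poly_eval_def)

lemma poly_eval_sum: "poly_eval (sum f A) t = (\<Sum>a\<in>A. poly_eval (f a) t)"
  by (induction A rule: infinite_finite_induct) (simp_all add: poly_eval_add)

lemma poly_eval_single: "poly_eval (single \<alpha> c) t = c * (\<Prod>i\<in>UNIV. of_real (t $ i) ^ lookup \<alpha> i)"
  by (subst poly_eval_superset[of "{\<alpha>}"]) auto

lemma poly_eval_mult: "poly_eval (p * q) t = poly_eval p t * poly_eval q t"
proof -
  have 1: "poly_eval (single \<alpha> c * q) t = poly_eval (single \<alpha> c) t * poly_eval q t" for \<alpha> c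
    by (induction q rule: cpoly_induct_single)
      (simp_all add: mult_single poly_eval_single lookup_add power_add prod.distrib distrib_left poly_eval_add)
  show ?thesis
    by (induction p rule: cpoly_induct_single) (simp_all add: 1 distrib_right poly_eval_add)
qed

lemma poly_eval_power: "poly_eval (p ^ k) t = poly_eval p t ^ k"
  by (induction k) (simp_all add: poly_eval_mult)

lemma poly_eval_prod: "poly_eval (prod f A) t = (\<Prod>a\<in>A. poly_eval (f a) t)"
  by (induction A rule: infinite_finite_induct) (simp_all add: poly_eval_mult)

lemma poly_eval_var: "poly_eval (var i) t = of_real (t $ i)"
proof -
  have "(\<Prod>j\<in>UNIV. complex_of_real (t $ j) ^ lookup (single i 1) j) = (\<Prod>j\<in>{i}. of_real (t $ j))"
    by (rule prod.mono_neutral_cong_right) (auto simp: lookup_single)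
  then show ?thesis by (simp add: poly_eval_single)
qed

lemma poly_eval_linear_form: "poly_eval (linear_form x) t = of_real (x \<bullet> t)"
  by (simp add: linear_form_eq_sum poly_eval_sum poly_eval_scale poly_eval_var[simplified] inner_vec_def)

lemma poly_eval_has_derivative:
  "((\<lambda>s. poly_eval p (t + s *\<^sub>R axis i 1)) has_vector_derivative poly_eval (partial_deriv i p) t) (at 0)"
proof (induction p rule: cpoly_induct)
  case one
  have "partial_deriv i (1 :: 'a cpoly) = 0"
    by (simp add: partial_deriv_def)
  then show ?case by simp
next
  case (var j p)
  have v: "((\<lambda>s. complex_of_real ((t + s *\<^sub>R axis i 1) $ j)) has_vector_derivative (if i = j then 1 else 0)) (at 0)"
  proof -
    have "((\<lambda>s. complex_of_real (t $ j + s * (axis i 1 :: real^'a) $ j))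
        has_vector_derivative of_real (0 + (axis i 1 :: real^'a) $ j)) (at 0)"
      by (intro has_vector_derivative_of_real derivative_eq_intros) auto
    then show ?thesis by (cases "i = j") (simp_all add: axis_def)
  qed
  have d: "poly_eval (partial_deriv i (var j * p)) t
      = of_real ((t + 0 *\<^sub>R axis i 1) $ j) * poly_eval (partial_deriv i p) t
        + (if i = j then 1 else 0) * poly_eval p (t + 0 *\<^sub>R axis i 1)"
    unfolding partial_deriv_var_mult by (simp add: poly_eval_add poly_eval_mult poly_eval_var[simplified])
  show ?case
    using has_vector_derivative_mult[OF v var]
    unfolding d poly_eval_mult poly_eval_var .
next
  case (scale c p)
  show ?case
    using has_vector_derivative_mult_right[OF scale, of c]
    by (simp add: poly_eval_scale partial_deriv_scale)
next
  case (add p q)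
  show ?case
    using has_vector_derivative_add[OF add]
    by (simp add: poly_eval_add partial_deriv_add)
qed

text \<open>
  If a polynomial vanishes at all points then so do its partial derivatives, hence all
  its coefficients, which are derivatives at the origin up to nonzero factors.
\<close>

lemma poly_eq_0_if_eval_0:
  assumes "\<And>t. poly_eval p t = 0"
  shows "p = 0"
proof (rule poly_mapping_eqI)
  fix \<alpha>
  have "\<forall>t. poly_eval (monomial_diff \<alpha> p) t = 0"
  proof (induction \<alpha> rule: exponent_induct)
    case zero
    show ?case using assms by (simp add: monomial_diff_zero)
  next
    case (add i \<alpha>)
    show ?case
    proof
      fix t
      from poly_eval_has_derivative[of "monomial_diff \<alpha> p" t i] add
      have "((\<lambda>s. 0) has_vector_derivative poly_eval (partial_deriv i (monomial_diff \<alpha> p)) t) (at 0)"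
        by simp
      then show "poly_eval (monomial_diff (single i 1 + \<alpha>) p) t = 0"
        unfolding monomial_diff_step
        by (metis has_vector_derivative_const vector_derivative_unique_at)
    qed
  qed
  then have "lookup (monomial_diff \<alpha> p) 0 = 0"
    by (metis poly_eval_zero_point)
  with lookup_monomial_diff[of \<alpha> 0] show "lookup p \<alpha> = lookup 0 \<alpha>" by auto
qed

section \<open>Counting linear conditions\<close>

lemma underdetermined_system:
  fixes a :: "'m \<Rightarrow> 'v \<Rightarrow> 'a::field"
  assumes "finite M" "finite V" "card M < card V"
  shows "\<exists>c. (\<exists>v\<in>V. c v \<noteq> 0) \<and> (\<forall>m\<in>M. (\<Sum>v\<in>V. c v * a m v) = 0)"
  using assms
proof (induction M arbitrary: V a rule: finite_induct)
  case empty
  then have "V \<noteq> {}" by auto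
  then show ?case by (intro exI[of _ "\<lambda>_. 1"]) auto
next
  case (insert m M)
  show ?case
  proof (cases "\<forall>v\<in>V. a m v = 0")
    case True
    from insert have "card M < card V" by simp
    from insert.IH[OF insert.prems(1) this, of a] True show ?thesis
      by (auto simp: sum.neutral)
  next
    case False
    then obtain v0 where v0: "v0 \<in> V" "a m v0 \<noteq> 0" by blast
    define W where "W = V - {v0}"
    have W: "finite W" "card M < card W" "v0 \<notin> W" "V = insert v0 W"
      using insert v0 by (auto simp: W_def)
    obtain c where c: "\<exists>v\<in>W. c v \<noteq> 0"
      "\<forall>k\<in>M. (\<Sum>v\<in>W. c v * (a k v - a m v * a k v0 / a m v0)) = 0"
      using insert.IH[OF W(1,2), of "\<lambda>k v. a k v - a m v * a k v0 / a m v0"] by blast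
    \<comment> \<open>Eliminate the unknown at \<open>v0\<close> using the equation \<open>m\<close>, then restore it.\<close>
    define d where "d = (\<lambda>v. if v = v0 then - (\<Sum>v\<in>W. c v * a m v) / a m v0 else c v)"
    have d: "(\<Sum>v\<in>V. d v * a k v) = (\<Sum>v\<in>W. c v * (a k v - a m v * a k v0 / a m v0))" for k
    proof -
      have "(\<Sum>v\<in>W. d v * a k v) = (\<Sum>v\<in>W. c v * a k v)"
        using W(3) by (intro sum.cong) (auto simp: d_def)
      moreover have "d v0 * a k v0 = - (\<Sum>v\<in>W. c v * (a m v * a k v0 / a m v0))"
        by (simp add: d_def sum_distrib_right sum_divide_distrib mult.assoc)
      ultimately show ?thesis
        using W by (simp add: sum_subtractf right_diff_distrib)
    qed
    have "(\<Sum>v\<in>V. d v * a m v) = 0"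
      unfolding d using v0(2) by simp
    moreover have "\<exists>v\<in>V. d v \<noteq> 0"
      using c(1) W(3,4) by (auto simp: d_def)
    ultimately show ?thesis
      using c(2) d by (intro exI[of _ d]) auto
  qed
qed

text \<open>
  \<open>n\<close> polynomials suffice to complement \<open>J\<close>. Stating it through a spanning set
  avoids quotient spaces.
\<close>

definition codim_le :: "'n cpoly set \<Rightarrow> nat \<Rightarrow> bool" where
  "codim_le J n \<longleftrightarrow> (\<exists>S. finite S \<and> card S \<le> n \<and> (\<forall>p. \<exists>s\<in>cspan S. p - s \<in> J))"

lemma cspan_finite_sum:
  assumes "finite S" "s \<in> cspan S"
  obtains u where "s = (\<Sum>b\<in>S. cscale (u b) b)"
  using assms cpoly.span_finite[OF assms(1)] by auto

lemma cspan_sumI: "(\<And>b. b \<in> S \<Longrightarrow> f b \<in> cspan T) \<Longrightarrow> (\<Sum>b\<in>S. cscale (u b) (f b)) \<in> cspan T"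
  by (intro cpoly.span_sum cpoly.span_scale)

text \<open>
  Modulo \<open>J\<close>, each of the more than \<open>n\<close> polynomials \<open>f v\<close> has \<open>n\<close> coordinates. The family is
  indexed, so that repetitions among the \<open>f v\<close> do not spoil the count.
\<close>

lemma codim_le_dependent:
  assumes J: "cpoly.subspace J" and "codim_le J n" "finite V" "n < card V"
  shows "\<exists>x. (\<exists>v\<in>V. x v \<noteq> 0) \<and> (\<Sum>v\<in>V. cscale (x v) (f v)) \<in> J"
proof -
  obtain S where S: "finite S" "card S \<le> n" "\<forall>p. \<exists>s\<in>cspan S. p - s \<in> J"
    using assms(2) by (auto simp: codim_le_def)
  have "\<forall>p. \<exists>u. p - (\<Sum>b\<in>S. cscale (u b) b) \<in> J"
    by (metis S(1,3) cspan_finite_sum)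
  then obtain u where u: "\<And>p. p - (\<Sum>b\<in>S. cscale (u p b) b) \<in> J"
    by metis
  obtain x where x: "\<exists>v\<in>V. x v \<noteq> 0" "\<forall>b\<in>S. (\<Sum>v\<in>V. x v * u (f v) b) = 0"
    using underdetermined_system[OF S(1) assms(3), of "\<lambda>b v. u (f v) b"] S(2) assms(4) by auto
  have "(\<Sum>v\<in>V. cscale (x v) (\<Sum>b\<in>S. cscale (u (f v) b) b))
      = (\<Sum>b\<in>S. cscale (\<Sum>v\<in>V. x v * u (f v) b) b)"
    unfolding cpoly.scale_sum_right cpoly.scale_sum_left cpoly.scale_scale by (rule sum.swap)
  also have "\<dots> = 0" using x(2) by simp
  finally have "(\<Sum>v\<in>V. cscale (x v) (f v)) = (\<Sum>v\<in>V. cscale (x v) (f v - (\<Sum>b\<in>S. cscale (u (f v) b) b)))"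
    by (simp add: cpoly.scale_right_diff_distrib sum_subtractf)
  also have "\<dots> \<in> J"
    by (intro cpoly.subspace_sum[OF J] cpoly.subspace_scale[OF J] u)
  finally show ?thesis using x(1) by blast
qed

lemma codim_le_mono: "codim_le J m \<Longrightarrow> J \<subseteq> J' \<Longrightarrow> m \<le> n \<Longrightarrow> codim_le J' n"
  unfolding codim_le_def by (meson order_trans subsetD)

lemma mult_cspan: "s \<in> cspan S \<Longrightarrow> p * s \<in> cspan ((*) p ` S)"
proof (induction rule: cpoly.span_induct_alt)
  case (step c x y)
  then have "cscale c (p * x) \<in> cspan ((*) p ` S)"
    by (intro cpoly.span_scale cpoly.span_base) auto
  with step show ?case
    by (simp add: distrib_left cscale_mult_right cpoly.span_add)
qed (simp add: cpoly.span_zero)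

text \<open>
  Subadditivity along \<open>\<Pi>/J1 \<rightarrow> \<Pi>/J \<rightarrow> \<Pi>/J2\<close>, the first map being multiplication by \<open>p\<close>.
  Exactness in the middle amounts to \<open>J2 \<subseteq> J + p \<Pi>\<close>.
\<close>

lemma codim_le_extend:
  assumes J: "cpoly.subspace J"
    and 1: "\<And>q. q \<in> J1 \<Longrightarrow> p * q \<in> J" and 2: "\<And>q. q \<in> J2 \<Longrightarrow> \<exists>s. q - p * s \<in> J"
    and "codim_le J1 a" "codim_le J2 b"
  shows "codim_le J (a + b)"
proof -
  obtain S where S: "finite S" "card S \<le> a" "\<forall>p. \<exists>s\<in>cspan S. p - s \<in> J1"
    using assms(4) by (auto simp: codim_le_def)
  obtain T where T: "finite T" "card T \<le> b" "\<forall>p. \<exists>s\<in>cspan T. p - s \<in> J2"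
    using assms(5) by (auto simp: codim_le_def)
  let ?U = "T \<union> (*) p ` S"
  have "card ?U \<le> a + b"
    using card_Un_le[of T "(*) p ` S"] card_image_le[OF S(1), of "(*) p"] S(2) T(2) by simp
  moreover have "\<exists>u\<in>cspan ?U. v - u \<in> J" for v
  proof -
    obtain t s where t: "t \<in> cspan T" "v - t - p * s \<in> J"
      using T(3) 2 by metis
    obtain s' where s': "s' \<in> cspan S" "s - s' \<in> J1" using S(3) by blast
    have "(v - t - p * s) + p * (s - s') \<in> J"
      by (intro cpoly.subspace_add[OF J] t(2) 1 s'(2))
    then have "v - (t + p * s') \<in> J" by (simp add: algebra_simps)
    moreover have "t + p * s' \<in> cspan ?U"
      using t(1) mult_cspan[OF s'(1), of p]
      by (meson cpoly.span_add cpoly.span_mono subsetD sup.cobounded1 sup.cobounded2)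
    ultimately show ?thesis by blast
  qed
  ultimately show ?thesis
    unfolding codim_le_def using S(1) T(1) by (intro exI[of _ ?U]) auto
qed

text \<open>
  Write an element of \<open>J'\<close> outside \<open>J\<close> as a nontrivial combination of the complementary
  polynomials modulo \<open>J\<close>. One of them can then be solved for and dropped.
\<close>

lemma codim_le_reduce:
  assumes J: "cpoly.subspace J" and J': "cpoly.subspace J'" "J \<subseteq> J'"
    and "codim_le J a" "q \<in> J'" "q \<notin> J"
  shows "\<exists>b<a. codim_le J' b"
proof -
  obtain S where S: "finite S" "card S \<le> a" "\<forall>p. \<exists>s\<in>cspan S. p - s \<in> J"
    using assms(4) by (auto simp: codim_le_def)
  obtain s where s: "s \<in> cspan S" "q - s \<in> J" using S by blast
  have "s \<in> J'"
  proof -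
    have "q - (q - s) \<in> J'" by (rule cpoly.subspace_diff[OF J'(1) assms(5) subsetD[OF J'(2) s(2)]])
    then show ?thesis by simp
  qed
  have "s \<noteq> 0" using s(2) assms(6) by auto
  obtain u where u: "s = (\<Sum>b\<in>S. cscale (u b) b)"
    using cspan_finite_sum[OF S(1) s(1)] .
  with \<open>s \<noteq> 0\<close> obtain b0 where b0: "b0 \<in> S" "u b0 \<noteq> 0"
    by (metis (mono_tags, lifting) cpoly.scale_zero_left sum.neutral)
  have "\<exists>t\<in>cspan (S - {b0}). v - t \<in> J'" for v
  proof -
    obtain t where t: "t \<in> cspan S" "v - t \<in> J" using S(3) by blast
    obtain w where w: "t = (\<Sum>b\<in>S. cscale (w b) b)"
      using cspan_finite_sum[OF S(1) t(1)] .
    let ?k = "w b0 / u b0"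
    have "t - cscale ?k s = (\<Sum>b\<in>S. cscale (w b - ?k * u b) b)"
      by (simp add: w u cpoly.scale_left_diff_distrib sum_subtractf cpoly.scale_sum_right)
    also have "\<dots> = (\<Sum>b\<in>S - {b0}. cscale (w b - ?k * u b) b)"
      using S(1) b0 by (intro sum.mono_neutral_right) auto
    also have "\<dots> \<in> cspan (S - {b0})"
      by (intro cspan_sumI cpoly.span_base)
    finally have "t - cscale ?k s \<in> cspan (S - {b0})" .
    moreover have "(v - t) + cscale ?k s \<in> J'"
      using t(2) J' \<open>s \<in> J'\<close> by (intro cpoly.subspace_add cpoly.subspace_scale) auto
    ultimately show ?thesis
      by (intro bexI[of _ "t - cscale ?k s"]) (simp_all add: algebra_simps)
  qed
  moreover have "card (S - {b0}) < a"
    using S(1,2) b0(1) by (metis card_Diff1_less order_less_le_trans)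
  ultimately show ?thesis
    unfolding codim_le_def using S(1) by (intro exI[of _ "card (S - {b0})"]) auto
qed

lemma independent_nonzero_combination:
  assumes "cpoly.independent A" "finite A" "\<exists>v\<in>A. c v \<noteq> 0"
  shows "(\<Sum>v\<in>A. cscale (c v) v) \<noteq> 0"
  using assms(3) cpoly.independentD[OF assms(1,2) order_refl, of c] by blast

text \<open>
  The dimension of an infinite-dimensional space is \<open>0\<close> by convention, so bounds on dimensions are
  stated through independent sets.
\<close>

definition dim_at_least :: "'n cpoly set \<Rightarrow> nat \<Rightarrow> bool" where
  "dim_at_least U n \<longleftrightarrow> (\<exists>A. finite A \<and> n \<le> card A \<and> cpoly.independent A \<and> A \<subseteq> U)"

definition dim_at_most :: "'n cpoly set \<Rightarrow> nat \<Rightarrow> bool" where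
  "dim_at_most U n \<longleftrightarrow> (\<forall>A. finite A \<longrightarrow> cpoly.independent A \<longrightarrow> A \<subseteq> U \<longrightarrow> card A \<le> n)"

lemma dim_at_least_mono: "dim_at_least U m \<Longrightarrow> n \<le> m \<Longrightarrow> U \<subseteq> W \<Longrightarrow> dim_at_least W n"
  unfolding dim_at_least_def by (meson le_trans subset_trans)

lemma dim_at_most_mono: "dim_at_most W m \<Longrightarrow> m \<le> n \<Longrightarrow> U \<subseteq> W \<Longrightarrow> dim_at_most U n"
  unfolding dim_at_most_def by (meson le_trans subset_trans)

lemma dim_at_mostD:
  "dim_at_most U n \<Longrightarrow> finite A \<Longrightarrow> cpoly.independent A \<Longrightarrow> A \<subseteq> U \<Longrightarrow> card A \<le> n"
  by (simp add: dim_at_most_def)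

text \<open>
  A vector of \<open>W\<close> outside \<open>U\<close> could be added to an independent set of \<open>n\<close> elements of \<open>U\<close>.
\<close>

lemma basis_of_full_dim:
  assumes "dim_at_least U n" "dim_at_most W n" "U \<subseteq> W" "cpoly.subspace U"
  obtains A where "finite A" "card A = n" "cpoly.independent A" "cspan A = U" "U = W"
proof -
  obtain A where A: "finite A" "n \<le> card A" "cpoly.independent A" "A \<subseteq> U"
    using assms(1) by (auto simp: dim_at_least_def)
  have c: "card A = n" using A assms(2,3) by (simp add: dim_at_most_def antisym subset_trans)
  have sub: "cspan A \<subseteq> U" using A(4) assms(4) by (rule cpoly.span_minimal)
  moreover have "W \<subseteq> cspan A"
  proof
    fix w assume w: "w \<in> W"
    show "w \<in> cspan A"
    proof (rule ccontr)
      assume nin: "w \<notin> cspan A"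
      then have "cpoly.independent (insert w A)" using A(3) by (rule cpoly.independent_insertI)
      moreover have "w \<notin> A" using nin cpoly.span_base by blast
      moreover have "insert w A \<subseteq> W" using w A(4) assms(3) by blast
      ultimately have "card (insert w A) \<le> n"
        using dim_at_mostD[OF assms(2), of "insert w A"] A(1) by blast
      with \<open>w \<notin> A\<close> show False using A(1) c by simp
    qed
  qed
  ultimately have "cspan A = U" "U = W" using assms(3) by auto
  with A c show thesis by (intro that)
qed

lemma dim_at_most_codim:
  assumes J: "cpoly.subspace J" "codim_le J n" and U: "cpoly.subspace U" "U \<inter> J \<subseteq> {0}"
  shows "dim_at_most U n"
  unfolding dim_at_most_def
proof (intro allI impI)
  fix A assume A: "finite A" "cpoly.independent A" "A \<subseteq> U"
  show "card A \<le> n"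
  proof (rule ccontr)
    assume "\<not> card A \<le> n"
    then obtain x where x: "\<exists>v\<in>A. x v \<noteq> 0" "(\<Sum>v\<in>A. cscale (x v) v) \<in> J"
      using codim_le_dependent[OF J A(1), of "\<lambda>v. v"] by auto
    have "(\<Sum>v\<in>A. cscale (x v) v) \<in> U"
      using A(3) by (intro cpoly.subspace_sum[OF U(1)] cpoly.subspace_scale[OF U(1)]) auto
    then have "(\<Sum>v\<in>A. cscale (x v) v) = 0" using x(2) U(2) by blast
    with independent_nonzero_combination[OF A(2,1) x(1)] show False by blast
  qed
qed

text \<open>
  The rank-nullity inequality. A basis \<open>A0\<close> of the kernel is extended to a
  basis \<open>Q\<close>; the map is injective on the span of the remaining vectors, whose images are
  independent in \<open>W\<close>.
\<close>

lemma dim_at_least_kernel: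
  assumes T: "\<And>p q. T (p + q) = T p + T q" "\<And>c p. T (cscale c p) = cscale c (T p)"
    and U: "cpoly.subspace U" "dim_at_least U a" and W: "dim_at_most W w" "\<And>p. p \<in> U \<Longrightarrow> T p \<in> W"
  shows "dim_at_least {p \<in> U. T p = 0} (a - w)"
proof -
  have T0: "T 0 = 0" using T(2)[of 0 0] by simp
  have Tsum: "T (\<Sum>q\<in>S. f q) = (\<Sum>q\<in>S. T (f q))" for S :: "'c set" and f
    by (induction S rule: infinite_finite_induct) (simp_all add: T0 T(1))
  obtain A where A: "finite A" "a \<le> card A" "cpoly.independent A" "A \<subseteq> U"
    using U(2) by (auto simp: dim_at_least_def)
  have AU: "cspan A \<subseteq> U" using A(4) U(1) by (rule cpoly.span_minimal)
  let ?C = "{p \<in> cspan A. T p = 0}"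
  obtain A0 where A0: "A0 \<subseteq> ?C" "cpoly.independent A0" "?C \<subseteq> cspan A0"
    using cpoly.maximal_independent_subset[of ?C] by blast
  have "A0 \<subseteq> cspan A" using A0(1) by blast
  then obtain Q where Q: "A0 \<subseteq> Q" "Q \<subseteq> cspan A" "cpoly.independent Q" "cspan A \<subseteq> cspan Q"
    using cpoly.maximal_independent_subset_extend[OF _ A0(2)] by metis
  have fQ: "finite Q" using cpoly.independent_span_bound[OF A(1) Q(3,2)] by blast
  have "A \<subseteq> cspan Q" using Q(4) cpoly.span_superset by blast
  then have cQ: "a \<le> card Q" using cpoly.independent_span_bound[OF fQ A(3)] A(2) by simp
  define Q1 where "Q1 = Q - A0"
  have fin: "finite A0" "finite Q1" using fQ Q(1) finite_subset by (auto simp: Q1_def)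
  have triv: "x q = 0" if x: "(\<Sum>q\<in>Q1. cscale (x q) (T q)) = 0" "q \<in> Q1" for x q
  proof -
    let ?u = "\<Sum>q\<in>Q1. cscale (x q) q"
    have "T ?u = 0" using x(1) by (simp add: Tsum T(2))
    moreover have "?u \<in> cspan A"
      using Q(2) by (intro cspan_sumI) (auto simp: Q1_def)
    ultimately have "?u \<in> cspan A0" using A0(3) by blast
    then obtain y where y: "?u = (\<Sum>b\<in>A0. cscale (y b) b)"
      using cspan_finite_sum[OF fin(1)] by blast
    let ?z = "\<lambda>q. if q \<in> A0 then - y q else x q"
    have "(\<Sum>q\<in>Q. cscale (?z q) q) = (\<Sum>q\<in>Q1. cscale (?z q) q) + (\<Sum>q\<in>A0. cscale (?z q) q)"
      unfolding Q1_def using fQ Q(1) by (rule sum.subset_diff[rotated])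
    also have "(\<Sum>q\<in>Q1. cscale (?z q) q) = ?u"
      by (rule sum.cong) (auto simp: Q1_def)
    also have "(\<Sum>q\<in>A0. cscale (?z q) q) = - (\<Sum>b\<in>A0. cscale (y b) b)"
      by (simp add: sum_negf)
    finally have "(\<Sum>q\<in>Q. cscale (?z q) q) = 0" by (simp add: y)
    then have "?z q = 0"
      using cpoly.independentD[OF Q(3) fQ order_refl, of ?z q] x(2) by (auto simp: Q1_def)
    then show ?thesis using x(2) by (simp add: Q1_def)
  qed
  have inj: "inj_on T Q1"
  proof (rule inj_onI, rule ccontr)
    fix p q assume pq: "p \<in> Q1" "q \<in> Q1" "T p = T q" "p \<noteq> q"
    let ?x = "\<lambda>r. if r = p then 1 else if r = q then - 1 else (0 :: complex)"
    have "(\<Sum>r\<in>Q1. cscale (?x r) (T r)) = (\<Sum>r\<in>{p, q}. cscale (?x r) (T r))"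
      using pq fin by (intro sum.mono_neutral_right) auto
    also have "\<dots> = 0" using pq by simp
    finally have "?x p = 0" by (rule triv) (rule pq(1))
    then show False by simp
  qed
  have "cpoly.independent (T ` Q1)"
    unfolding cpoly.dependent_finite[OF finite_imageI[OF fin(2)]]
  proof
    assume "\<exists>u. (\<exists>v\<in>T ` Q1. u v \<noteq> 0) \<and> (\<Sum>v\<in>T ` Q1. cscale (u v) v) = 0"
    then obtain u where u: "\<exists>q\<in>Q1. u (T q) \<noteq> 0" "(\<Sum>v\<in>T ` Q1. cscale (u v) v) = 0" by blast
    from u(2) have "(\<Sum>q\<in>Q1. cscale (u (T q)) (T q)) = 0"
      by (simp add: sum.reindex[OF inj])
    from triv[OF this] u(1) show False by blast
  qed
  moreover have "T ` Q1 \<subseteq> W" using W(2) Q(2) AU by (auto simp: Q1_def)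
  ultimately have "card (T ` Q1) \<le> w" using W(1) fin(2) by (simp add: dim_at_most_def)
  then have "card Q1 \<le> w" by (simp add: card_image[OF inj])
  moreover have "card Q = card Q1 + card A0"
    using card_Diff_subset[OF fin(1) Q(1)] card_mono[OF fQ Q(1)] by (simp add: Q1_def)
  ultimately have "a - w \<le> card A0" using cQ by simp
  then show ?thesis
    unfolding dim_at_least_def using A0(1,2) fin(1) AU by (intro exI[of _ A0]) auto
qed

section \<open>Ideals generated by linear forms\<close>

lemma ideal_subspace: "cpoly.subspace (ideal_generated G)"
  unfolding cpoly.subspace_def
  by (auto simp: cscale_eq_mult intro: ring_module.span_zero ring_module.span_add ring_module.span_scale)

lemma ideal_mult_left: "p \<in> ideal_generated G \<Longrightarrow> q * p \<in> ideal_generated G"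
  by (rule ring_module.span_scale)

lemma ideal_mult_right: "p \<in> ideal_generated G \<Longrightarrow> p * q \<in> ideal_generated G"
  by (metis mult.commute ideal_mult_left)

lemma dir_deriv_linear_ideal:
  assumes "\<And>k. k \<in> S \<Longrightarrow> k \<bullet> \<eta> = 0" "p \<in> ideal_generated (linear_form ` S)"
  shows "dir_deriv \<eta> p \<in> ideal_generated (linear_form ` S)"
  using assms(2)
proof (induction rule: ring_module.span_induct_alt)
  case base
  show ?case by (simp add: ring_module.span_zero)
next
  case (step c x y)
  then obtain k where k: "k \<in> S" "x = linear_form k" by blast
  have "dir_deriv \<eta> (c * x) = dir_deriv \<eta> c * x"
    unfolding k(2) mult.commute[of c] dir_deriv_linear_form_mult
    using assms(1)[OF k(1)] by (simp add: inner_commute mult.commute)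
  moreover have "x \<in> ideal_generated (linear_form ` S)"
    using step(1) by (rule ring_module.span_base)
  ultimately show ?case
    by (auto simp: dir_deriv_add intro!: ring_module.span_add step ideal_mult_left)
qed

lemma dir_deriv_funpow_linear_ideal:
  assumes "\<And>k. k \<in> S \<Longrightarrow> k \<bullet> \<eta> = 0" "p \<in> ideal_generated (linear_form ` S)"
  shows "(dir_deriv \<eta> ^^ j) p \<in> ideal_generated (linear_form ` S)"
  using assms by (induction j) (auto intro: dir_deriv_linear_ideal)

text \<open>
  By Leibniz' rule modulo the ideal, \<open>D\<^sub>\<eta>\<^bsup>j+1\<^esup> (p\<^sub>x q) = p\<^sub>x D\<^sub>\<eta>\<^bsup>j+1\<^esup> q + (j + 1) (x \<bullet> \<eta>) D\<^sub>\<eta>\<^bsup>j\<^esup> q\<close>. For \<open>j + 1 \<ge> a\<close>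
  the left side is in the ideal, so membership of \<open>D\<^sub>\<eta>\<^bsup>j+1\<^esup> q\<close> passes down to \<open>D\<^sub>\<eta>\<^bsup>j\<^esup> q\<close>. The descent can
  start because \<open>D\<^sub>\<eta>\<close> is nilpotent on \<open>q\<close>. The truncated exponent makes the case \<open>a = 0\<close> useful
  too: it says that \<open>p\<^sub>x\<close> is not a zero divisor modulo the ideal.
\<close>

lemma dir_deriv_descent:
  assumes N: "N = ideal_generated (linear_form ` S)" and S: "\<And>k. k \<in> S \<Longrightarrow> k \<bullet> \<eta> = 0"
    and x: "x \<bullet> \<eta> \<noteq> 0" and "(dir_deriv \<eta> ^^ a) (linear_form x * q) \<in> N"
  shows "(dir_deriv \<eta> ^^ (a - 1)) q \<in> N"
proof -
  note N_sub = ideal_subspace[of "linear_form ` S", folded N]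
  have D: "p \<in> N \<Longrightarrow> (dir_deriv \<eta> ^^ j) p \<in> N" for p j
    using dir_deriv_funpow_linear_ideal[of S \<eta> p j] S by (simp add: N)
  obtain M where M: "(dir_deriv \<eta> ^^ M) q = 0" using dir_deriv_nilpotent by blast
  show ?thesis
  proof (rule inc_induct[of "a - 1" "max M (a - 1)"])
    show "(dir_deriv \<eta> ^^ max M (a - 1)) q \<in> N"
      using dir_deriv_funpow_vanish_mono[OF M, of "max M (a - 1)"] cpoly.subspace_0[OF N_sub] by simp
  next
    fix j assume j: "a - 1 \<le> j" "(dir_deriv \<eta> ^^ Suc j) q \<in> N"
    have "(dir_deriv \<eta> ^^ Suc j) (linear_form x * q) = (dir_deriv \<eta> ^^ (Suc j - a)) ((dir_deriv \<eta> ^^ a) (linear_form x * q))"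
    proof -
      have "Suc j = (Suc j - a) + a" using j(1) by simp
      then show ?thesis by (metis funpow_add o_apply)
    qed
    then have "(dir_deriv \<eta> ^^ Suc j) (linear_form x * q) \<in> N"
      using D[OF assms(4)] by simp
    moreover have "linear_form x * (dir_deriv \<eta> ^^ Suc j) q \<in> N"
      using j(2) by (simp only: N ideal_mult_left)
    ultimately have "(dir_deriv \<eta> ^^ Suc j) (linear_form x * q) - linear_form x * (dir_deriv \<eta> ^^ Suc j) q \<in> N"
      by (rule cpoly.subspace_diff[OF N_sub])
    then have "cscale (of_nat (Suc j) * of_real (\<eta> \<bullet> x)) ((dir_deriv \<eta> ^^ j) q) \<in> N"
      by (simp only: dir_deriv_funpow_linear_form_mult) simp
    then have "cscale (inverse (of_nat (Suc j) * of_real (\<eta> \<bullet> x)))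
        (cscale (of_nat (Suc j) * of_real (\<eta> \<bullet> x)) ((dir_deriv \<eta> ^^ j) q)) \<in> N"
      by (rule cpoly.subspace_scale[OF N_sub])
    moreover have "of_nat (Suc j) * complex_of_real (\<eta> \<bullet> x) \<noteq> 0"
      using x by (simp add: inner_commute del: of_nat_Suc)
    then have "cscale (inverse (of_nat (Suc j) * of_real (\<eta> \<bullet> x)))
        (cscale (of_nat (Suc j) * of_real (\<eta> \<bullet> x)) ((dir_deriv \<eta> ^^ j) q)) = (dir_deriv \<eta> ^^ j) q"
      unfolding cpoly.scale_scale by (subst left_inverse) simp_all
    ultimately show "(dir_deriv \<eta> ^^ j) q \<in> N" by simp
  qed simp
qed

lemma separating_direction:
  fixes x :: "'a::euclidean_space"
  assumes "x \<notin> span S"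
  obtains \<eta> where "\<And>k. k \<in> S \<Longrightarrow> k \<bullet> \<eta> = 0" "x \<bullet> \<eta> \<noteq> 0"
proof -
  obtain y z where yz: "y \<in> span S" "\<And>w. w \<in> span S \<Longrightarrow> orthogonal z w" "x = y + z"
    using orthogonal_subspace_decomp_exists[of S x] by blast
  have "z \<noteq> 0" using yz assms by auto
  have "y \<bullet> z = 0" using yz by (metis orthogonal_def inner_commute)
  show thesis
  proof (rule that[of z])
    show "k \<in> S \<Longrightarrow> k \<bullet> z = 0" for k
      using yz(2)[of k] by (simp add: span_base orthogonal_def inner_commute)
    show "x \<bullet> z \<noteq> 0" using \<open>z \<noteq> 0\<close> \<open>y \<bullet> z = 0\<close> by (simp add: yz(3) inner_add_left)
  qed
qed

lemma linear_form_cancel: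
  assumes "x \<notin> span S" "linear_form x * q \<in> ideal_generated (linear_form ` S)"
  shows "q \<in> ideal_generated (linear_form ` S)"
proof -
  obtain \<eta> where \<eta>: "\<And>k. k \<in> S \<Longrightarrow> k \<bullet> \<eta> = 0" "x \<bullet> \<eta> \<noteq> 0"
    using separating_direction[OF assms(1)] by blast
  from dir_deriv_descent[OF refl \<eta>(1,2), of S 0 q] assms(2) show ?thesis by simp
qed

section \<open>Deletion and contraction of internal bases\<close>

text \<open>
  The internal bases of \<open>R\<close> after contraction of \<open>K\<close>, with \<open>R\<close> and \<open>K\<close> disjoint. For each
  \<open>b \<in> B \<inter> I\<close> a witness \<open>y\<close> shows that \<open>b\<close> is not the greatest element of its fundamental cocircuit
  in \<open>R\<close>. The cardinality condition makes \<open>K \<union> B\<close> independent.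
\<close>

definition contracted_bases ::
  "('e \<Rightarrow> real^'n) \<Rightarrow> 'e rel \<Rightarrow> 'e set \<Rightarrow> 'e set \<Rightarrow> 'e set \<Rightarrow> 'e set set" where
  "contracted_bases X r I R K =
     {B. B \<subseteq> R \<and> card B + card K = CARD('n) \<and> span (X ` (K \<union> B)) = UNIV \<and>
        (\<forall>b\<in>B \<inter> I. \<exists>y\<in>R. X y \<notin> span (X ` (K \<union> (B - {b}))) \<and> y \<noteq> b \<and> (y, b) \<notin> r)}"

lemma finite_contracted_bases: "finite R \<Longrightarrow> finite (contracted_bases X r I R K)"
  by (rule finite_subset[of _ "Pow R"]) (auto simp: contracted_bases_def)

lemma full_dim_iff: "dim (S :: (real^'n) set) = CARD('n) \<longleftrightarrow> span S = UNIV"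
  using dim_eq_full[of S] by simp

lemma spanning_card:
  fixes X :: "'e \<Rightarrow> real^'n"
  assumes "finite A" "span (X ` A) = UNIV"
  shows "CARD('n) \<le> card A"
proof -
  have "CARD('n) = dim (X ` A)"
    by (rule full_dim_iff[THEN iffD2, OF assms(2), symmetric])
  also have "\<dots> \<le> card A"
    using dim_le_card'[of "X ` A"] card_image_le[OF assms(1), of X] assms(1) by (simp add: le_trans)
  finally show ?thesis .
qed

lemma basis_irredundant:
  fixes X :: "'e \<Rightarrow> real^'n"
  assumes "finite K" "finite B" "card B + card K = CARD('n)" "span (X ` (K \<union> B)) = UNIV" "y \<in> B"
  shows "X y \<notin> span (X ` (K \<union> (B - {y})))"
proof
  assume "X y \<in> span (X ` (K \<union> (B - {y})))"
  then have "X ` (K \<union> B) \<subseteq> span (X ` (K \<union> (B - {y})))"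
    by (auto intro: span_base)
  then have "span (X ` (K \<union> (B - {y}))) = UNIV"
    using assms(4) by (metis span_minimal subspace_span top.extremum_uniqueI)
  then have "CARD('n) \<le> card (K \<union> (B - {y}))"
    using assms by (intro spanning_card) auto
  also have "\<dots> \<le> card K + card (B - {y})" by (rule card_Un_le)
  also have "\<dots> < CARD('n)"
    using assms by (metis add.commute add_strict_left_mono card_Diff1_less)
  finally show False by simp
qed

lemma exists_greatest:
  assumes "finite A" "A \<noteq> {}" "trans r" "irrefl r" "total_on A r"
  shows "\<exists>m\<in>A. \<forall>a\<in>A. (m, a) \<notin> r"
  using assms(1,2,5)
proof (induction rule: finite_ne_induct)
  case (singleton x)
  then show ?case using assms(4) by (auto simp: irrefl_def)
next
  case (insert x F)
  then obtain m where m: "m \<in> F" "\<forall>a\<in>F. (m, a) \<notin> r"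
    by (meson subset_insertI total_on_subset)
  show ?case
  proof (cases "(m, x) \<in> r")
    case True
    then have "\<forall>a\<in>insert x F. (x, a) \<notin> r"
      using m assms(3,4) by (auto simp: irrefl_def dest: transD)
    then show ?thesis by blast
  next
    case False
    then show ?thesis using m by blast
  qed
qed

lemma exists_least:
  assumes "finite A" "A \<noteq> {}" "trans r" "irrefl r" "total_on A r"
  shows "\<exists>m\<in>A. \<forall>a\<in>A - {m}. (m, a) \<in> r"
proof -
  have "total_on A (r\<inverse>)" using assms(5) by simp
  moreover have "irrefl (r\<inverse>)" using assms(4) by (auto simp: irrefl_def)
  ultimately obtain m where "m \<in> A" "\<forall>a\<in>A. (m, a) \<notin> r\<inverse>"
    using exists_greatest[OF assms(1,2), of "r\<inverse>"] assms(3) by (auto simp: trans_def)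
  then show ?thesis
    using assms(5) by (auto simp: total_on_def)
qed

text \<open>
  Building a finite set from the top downwards, so that each new element is the least so far.
\<close>

lemma finite_least_induct [consumes 4, case_names empty insert]:
  assumes "finite R" "trans r" "irrefl r" "total_on R r"
    and "P {}"
    and "\<And>x R. finite R \<Longrightarrow> x \<notin> R \<Longrightarrow> total_on (insert x R) r \<Longrightarrow> (\<And>y. y \<in> R \<Longrightarrow> (x, y) \<in> r) \<Longrightarrow> P R \<Longrightarrow> P (insert x R)"
  shows "P R"
  using assms(1,4)
proof (induction "card R" arbitrary: R)
  case 0
  then show ?case using assms(5) by simp
next
  case (Suc n)
  then have "R \<noteq> {}" by auto
  then obtain x where x: "x \<in> R" "\<forall>a\<in>R - {x}. (x, a) \<in> r"
    using exists_least[OF Suc.prems(1) _ assms(2,3) Suc.prems(2)] by blast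
  let ?R = "R - {x}"
  have R: "insert x ?R = R" using x by blast
  have "total_on ?R r" using Suc.prems(2) by (rule total_on_subset) blast
  moreover have "n = card ?R"
    using Suc.hyps(2) Suc.prems(1) x(1) by simp
  ultimately have "P ?R"
    using Suc.hyps(1) Suc.prems(1) by simp
  from assms(6)[OF _ _ _ _ this, of x] show ?case
    using x Suc.prems R by auto
qed

text \<open>
  One stage of the recursion. Since \<open>x\<close> is below all other elements, it is never a witness against the
  activity of one of them, so its deletion does not affect which of them are active.
\<close>

locale deletion_contraction =
  fixes X :: "'e \<Rightarrow> real^'n" and r :: "'e rel" and I R K :: "'e set" and x :: 'e
  assumes finite_R: "finite R" and finite_K: "finite K" and x_R: "x \<notin> R" and x_K: "x \<notin> K"
    and trans: "trans r" and irrefl: "irrefl r" and total: "total_on (insert x R) r"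
    and least: "\<And>y. y \<in> R \<Longrightarrow> (x, y) \<in> r"
begin

abbreviation "all_bases \<equiv> contracted_bases X r I (insert x R) K"
abbreviation "deleted \<equiv> contracted_bases X r I R K"
abbreviation "contracted \<equiv> contracted_bases X r I R (insert x K)"

lemma not_below_x: "y \<in> R \<Longrightarrow> (y, x) \<notin> r"
  using least trans irrefl by (meson irreflD transD)

lemma deleted_iff: "B \<in> deleted \<longleftrightarrow> B \<in> all_bases \<and> x \<notin> B"
proof (cases "B \<subseteq> R")
  case True
  have "(\<exists>y\<in>insert x R. X y \<notin> S \<and> y \<noteq> b \<and> (y, b) \<notin> r) \<longleftrightarrow> (\<exists>y\<in>R. X y \<notin> S \<and> y \<noteq> b \<and> (y, b) \<notin> r)"
    if "b \<in> B \<inter> I" for b S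
    using least[of b] that True by blast
  moreover have "B \<subseteq> insert x R" "x \<notin> B" using True x_R by auto
  ultimately show ?thesis
    using True by (simp add: contracted_bases_def)
next
  case False
  then show ?thesis by (auto simp: contracted_bases_def)
qed

lemma contracted_if_all:
  assumes "B \<in> all_bases" "x \<in> B"
  shows "B - {x} \<in> contracted"
proof -
  have B: "B \<subseteq> insert x R" "card B + card K = CARD('n)" "span (X ` (K \<union> B)) = UNIV"
    "\<And>b. b \<in> B \<inter> I \<Longrightarrow> \<exists>y\<in>insert x R. X y \<notin> span (X ` (K \<union> (B - {b}))) \<and> y \<noteq> b \<and> (y, b) \<notin> r"
    using assms(1) by (auto simp: contracted_bases_def)
  have fB: "finite B" using B(1) finite_R finite_subset by blast
  have c: "card (B - {x}) + card (insert x K) = CARD('n)"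
    using B(2) assms(2) fB finite_K x_K card_Suc_Diff1[OF fB assms(2)] by simp
  have e: "insert x K \<union> (B - {x}) = K \<union> B" using assms(2) by blast
  have w: "\<exists>y\<in>R. X y \<notin> span (X ` (insert x K \<union> (B - {x} - {b}))) \<and> y \<noteq> b \<and> (y, b) \<notin> r"
    if "b \<in> (B - {x}) \<inter> I" for b
  proof -
    have eq: "insert x K \<union> (B - {x} - {b}) = K \<union> (B - {b})" using that assms(2) by blast
    have "b \<in> B \<inter> I" using that by blast
    from B(4)[OF this] obtain y where
      y: "y \<in> insert x R" "X y \<notin> span (X ` (K \<union> (B - {b})))" "y \<noteq> b" "(y, b) \<notin> r"
      by blast
    have "X x \<in> span (X ` (K \<union> (B - {b})))"
      using that assms(2) by (intro span_base) auto
    then have "y \<noteq> x" using y(2) by blast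
    then have "y \<in> R" using y(1) by blast
    then show ?thesis using y(2-4) unfolding eq by (intro bexI[of _ y] conjI)
  qed
  have "B - {x} \<subseteq> R" using B(1) by blast
  then show ?thesis
    unfolding contracted_bases_def mem_Collect_eq e using c B(3) w by (intro conjI ballI)
qed

lemma not_contracted_x: "B \<in> contracted \<Longrightarrow> x \<notin> B"
  using x_R by (auto simp: contracted_bases_def)

text \<open>
  The new element \<open>x\<close> itself must not become active. Its fundamental cocircuit contains another element
  unless \<open>R\<close> and \<open>K\<close> do not span, and that element is greater than \<open>x\<close>.
\<close>

lemma all_if_contracted:
  assumes "B \<in> contracted" and coloop: "x \<in> I \<Longrightarrow> span (X ` (K \<union> R)) = UNIV"
  shows "insert x B \<in> all_bases"
proof -
  have B: "B \<subseteq> R" "card B + card (insert x K) = CARD('n)" "span (X ` (insert x K \<union> B)) = UNIV"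
    "\<And>b. b \<in> B \<inter> I \<Longrightarrow> \<exists>y\<in>R. X y \<notin> span (X ` (insert x K \<union> (B - {b}))) \<and> y \<noteq> b \<and> (y, b) \<notin> r"
    using assms(1) by (auto simp: contracted_bases_def)
  have fB: "finite B" using B(1) finite_R finite_subset by blast
  have xB: "x \<notin> B" using B(1) x_R by blast
  have c: "card (insert x B) + card K = CARD('n)"
    using B(2) fB finite_K x_K xB by simp
  have "\<exists>y\<in>insert x R. X y \<notin> span (X ` (K \<union> (insert x B - {b}))) \<and> y \<noteq> b \<and> (y, b) \<notin> r"
    if b: "b \<in> insert x B \<inter> I" for b
  proof (cases "b = x")
    case True
    have "\<exists>y\<in>R. X y \<notin> span (X ` (K \<union> B))"
    proof (rule ccontr)
      assume "\<not> ?thesis"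
      then have "X ` (K \<union> R) \<subseteq> span (X ` (K \<union> B))" by (auto intro: span_base)
      then have "span (X ` (K \<union> B)) = UNIV"
        using coloop True b by (metis IntD2 span_minimal subspace_span top.extremum_uniqueI)
      then have "CARD('n) \<le> card (K \<union> B)"
        using fB finite_K by (intro spanning_card) auto
      also have "\<dots> \<le> card K + card B" by (rule card_Un_le)
      also have "\<dots> < CARD('n)" using c fB xB by simp
      finally show False by simp
    qed
    then obtain y where y: "y \<in> R" "X y \<notin> span (X ` (K \<union> B))" by blast
    have "insert x B - {x} = B" using xB by blast
    then show ?thesis using y not_below_x[OF y(1)] x_R True by auto
  next
    case False
    then have eq: "K \<union> (insert x B - {b}) = insert x K \<union> (B - {b})" by blast
    show ?thesis unfolding eq using B(4)[of b] b False by blast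
  qed
  moreover have "K \<union> insert x B = insert x K \<union> B" by blast
  ultimately show ?thesis
    using B(1,3) c unfolding contracted_bases_def by auto
qed

lemma coloop_no_bases:
  assumes "x \<in> I" "span (X ` (K \<union> R)) \<noteq> UNIV"
  shows "all_bases = {}"
proof (rule ccontr)
  assume "all_bases \<noteq> {}"
  then obtain B where "B \<in> all_bases" by blast
  then have B: "B \<subseteq> insert x R" "span (X ` (K \<union> B)) = UNIV"
    "\<And>b. b \<in> B \<inter> I \<Longrightarrow> \<exists>y\<in>insert x R. X y \<notin> span (X ` (K \<union> (B - {b}))) \<and> y \<noteq> b \<and> (y, b) \<notin> r"
    by (auto simp: contracted_bases_def)
  have "x \<in> B"
  proof (rule ccontr)
    assume "x \<notin> B"
    then have "K \<union> B \<subseteq> K \<union> R" using B(1) by blast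
    then have "span (X ` (K \<union> B)) \<subseteq> span (X ` (K \<union> R))" by (intro span_mono image_mono)
    with B(2) assms(2) show False by blast
  qed
  then obtain y where y: "y \<in> insert x R" "X y \<notin> span (X ` (K \<union> (B - {x})))" "y \<noteq> x"
    using B(3)[of x] assms(1) by blast
  have "X y \<in> span (insert (X x) (X ` (K \<union> (B - {x}))))"
    by (rule subsetD[OF span_mono[of "X ` (K \<union> B)"]]) (use B(2) in auto)
  then have "X x \<in> span (insert (X y) (X ` (K \<union> (B - {x}))))"
    using y(2) by (rule in_span_insert)
  also have "\<dots> \<subseteq> span (X ` (K \<union> R))"
    by (rule span_mono) (use y(1,3) B(1) in auto)
  finally have "X ` (K \<union> B) \<subseteq> span (X ` (K \<union> R))"
    using B(1) by (auto intro: span_base)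
  then show False
    using B(2) assms(2) by (metis span_minimal subspace_span top.extremum_uniqueI)
qed

lemma loop_bases:
  assumes "X x \<in> span (X ` K)"
  shows "all_bases = deleted"
proof -
  have "x \<notin> B" if "B \<in> all_bases" for B
  proof
    assume xB: "x \<in> B"
    have B: "B \<subseteq> insert x R" "card B + card K = CARD('n)" "span (X ` (K \<union> B)) = UNIV"
      using that by (auto simp: contracted_bases_def)
    have "finite B" using B(1) finite_R finite_subset by blast
    from basis_irredundant[OF finite_K this B(2,3) xB]
    have "X x \<notin> span (X ` (K \<union> (B - {x})))" .
    moreover have "span (X ` K) \<subseteq> span (X ` (K \<union> (B - {x})))" by (intro span_mono) blast
    ultimately show False using assms by blast
  qed
  then show ?thesis by (auto simp: deleted_iff)
qed

text \<open>
  Each internal basis can be brought to contain \<open>x\<close> by giving up one element: the greatest element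
  \<open>z\<close> of the circuit that \<open>x\<close> closes. If \<open>b\<close> lies on the circuit, its new cocircuit
  contains \<open>z\<close>, which exceeds \<open>b\<close>; if not, its cocircuit does not lose its old witness.
  Hence a set avoiding \<open>x\<close> that meets the internal bases through \<open>x\<close> meets all internal bases.
\<close>

lemma exchange_into:
  assumes "B \<in> all_bases" "x \<notin> B" "X x \<notin> span (X ` K)"
  shows "\<exists>B'\<in>all_bases. x \<in> B' \<and> B' \<subseteq> insert x B"
proof -
  let ?S = "\<lambda>B. span (X ` (K \<union> B))"
  have B: "B \<subseteq> R" "card B + card K = CARD('n)" "?S B = UNIV"
    "\<And>b. b \<in> B \<inter> I \<Longrightarrow> \<exists>y\<in>insert x R. X y \<notin> ?S (B - {b}) \<and> y \<noteq> b \<and> (y, b) \<notin> r"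
    using assms(1,2) by (auto simp: contracted_bases_def)
  have fB: "finite B" using B(1) finite_R finite_subset by blast
  have mono: "?S A \<subseteq> ?S A'" if "A \<subseteq> A'" for A A' by (intro span_mono image_mono) (use that in blast)
  have ins: "X ` (K \<union> insert y A) = insert (X y) (X ` (K \<union> A))" for y A by auto
  have irr: "X y \<notin> ?S (B - {y})" if "y \<in> B" for y
    using basis_irredundant[OF finite_K fB B(2,3) that] .
  define C where "C = {y \<in> B. X x \<notin> ?S (B - {y})}"
  \<comment> \<open>\<open>insert x C\<close> is the circuit of \<open>insert x B\<close> modulo \<open>K\<close>\<close>
  have "C \<noteq> {}"
  proof
    assume "C = {}"
    have "X x \<in> ?S (B - D)" if "finite D" "D \<subseteq> B" for D
      using that
    proof (induction D rule: finite_induct)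
      case empty
      then show ?case using B(3) by simp
    next
      case (insert y D)
      have y: "y \<in> B" "y \<notin> D" using insert by auto
      show ?case
      proof (rule ccontr)
        assume "X x \<notin> ?S (B - insert y D)"
        moreover have "X x \<in> span (insert (X y) (X ` (K \<union> (B - insert y D))))"
        proof -
          have "insert y (B - insert y D) = B - D" using y by blast
          then show ?thesis using insert by (simp flip: ins)
        qed
        ultimately have "X y \<in> span (insert (X x) (X ` (K \<union> (B - insert y D))))"
          using in_span_insert by blast
        moreover have "X x \<in> ?S (B - {y})" using \<open>C = {}\<close> y unfolding C_def by blast
        then have "insert (X x) (X ` (K \<union> (B - insert y D))) \<subseteq> ?S (B - {y})"
          by (auto intro: span_base)
        then have "span (insert (X x) (X ` (K \<union> (B - insert y D)))) \<subseteq> ?S (B - {y})"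
          by (rule span_minimal) simp
        ultimately show False using irr[OF y(1)] by blast
      qed
    qed
    from this[of B] fB assms(3) show False by simp
  qed
  moreover have "total_on C r"
    using total by (rule total_on_subset) (use B(1) in \<open>auto simp: C_def\<close>)
  moreover have "finite C" using fB by (simp add: C_def)
  ultimately obtain z where z: "z \<in> C" "\<forall>y\<in>C. (z, y) \<notin> r"
    using exists_greatest[OF _ _ trans irrefl] by blast
  have zB: "z \<in> B" "X x \<notin> ?S (B - {z})" using z by (auto simp: C_def)
  have zx: "z \<noteq> x" using zB assms(2) by blast
  have xz: "X x \<in> span (insert (X z) (X ` (K \<union> (B - {z}))))"
    using B(3) zB(1) by (simp add: insert_absorb flip: ins)
  have "X z \<in> span (insert (X x) (X ` (K \<union> (B - {z}))))"
    using in_span_insert[OF xz zB(2)] .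
  then have "X ` (K \<union> B) \<subseteq> ?S (insert x (B - {z}))"
    by (subst ins) (auto intro: span_base)
  then have spn: "?S (insert x (B - {z})) = UNIV"
    using B(3) by (metis span_minimal subspace_span top.extremum_uniqueI)
  have crd: "card (insert x (B - {z})) + card K = CARD('n)"
    using B(2) zB(1) fB assms(2) card_Suc_Diff1[OF fB zB(1)] by simp
  have "\<exists>y\<in>insert x R. X y \<notin> ?S (insert x (B - {z}) - {b}) \<and> y \<noteq> b \<and> (y, b) \<notin> r"
    if b: "b \<in> insert x (B - {z}) \<inter> I" for b
  proof (cases "b = x")
    case True
    have "insert x (B - {z}) - {x} = B - {z}" using assms(2) by blast
    then show ?thesis using True irr[OF zB(1)] zx not_below_x[of z] zB(1) B(1) by auto
  next
    case False
    with b have b: "b \<in> B" "b \<in> I" "b \<noteq> z" by auto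
    have eq: "insert x (B - {z}) - {b} = insert x (B - {z, b})" using False by blast
    show ?thesis
    proof (cases "b \<in> C")
      case True
      have "X z \<notin> ?S (insert x (B - {z, b}))"
      proof
        assume "X z \<in> ?S (insert x (B - {z, b}))"
        moreover have "X z \<notin> ?S (B - {z, b})"
          using irr[OF zB(1)] mono[of "B - {z, b}" "B - {z}"] by blast
        ultimately have "X x \<in> span (insert (X z) (X ` (K \<union> (B - {z, b}))))"
          unfolding ins using in_span_insert by blast
        moreover have "insert z (B - {z, b}) = B - {b}" using zB(1) b by blast
        ultimately have "X x \<in> ?S (B - {b})" by (simp flip: ins)
        with True show False by (simp add: C_def)
      qed
      then show ?thesis
        unfolding eq using z(2) True zB(1) B(1) b(3) by blast
    next
      case False
      then have "X x \<in> ?S (B - {b})" using b(1) by (simp add: C_def)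
      then have "?S (insert x (B - {z, b})) \<subseteq> ?S (B - {b})"
        by (subst ins, intro span_minimal) (auto intro: span_base)
      then show ?thesis
        unfolding eq using B(4)[of b] b by blast
    qed
  qed
  then have "insert x (B - {z}) \<in> all_bases"
    using B(1) spn crd unfolding contracted_bases_def by auto
  then show ?thesis by blast
qed

lemma card_deleted_contracted:
  assumes "x \<in> I \<Longrightarrow> span (X ` (K \<union> R)) = UNIV"
  shows "card deleted + card contracted \<le> card all_bases"
proof -
  have "inj_on (insert x) contracted"
    using not_contracted_x by (metis inj_onI insert_ident)
  then have "card contracted = card (insert x ` contracted)" by (simp add: card_image)
  moreover have "card deleted + card (insert x ` contracted) = card (deleted \<union> insert x ` contracted)"
  proof (rule card_Un_disjoint[symmetric])
    have "x \<notin> B" if "B \<in> deleted" for B using that by (simp add: deleted_iff)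
    then show "deleted \<inter> insert x ` contracted = {}" by auto
  qed (intro finite_imageI finite_contracted_bases finite_R)+
  moreover have "deleted \<union> insert x ` contracted \<subseteq> all_bases"
  proof (intro Un_least image_subsetI)
    show "deleted \<subseteq> all_bases" by (auto simp: deleted_iff)
    show "insert x B \<in> all_bases" if "B \<in> contracted" for B
      using that assms by (rule all_if_contracted)
  qed
  moreover have "finite all_bases" by (intro finite_contracted_bases finite.insertI finite_R)
  ultimately show ?thesis by (simp add: card_mono)
qed

end

section \<open>The ideal of hitting sets and the power kernel\<close>

text \<open>
  For \<open>K = {}\<close> and \<open>\<B>\<close> the internal bases, the sets \<open>Y\<close> are the long ones.
\<close>

definition hitting_ideal :: "('e \<Rightarrow> real^'n) \<Rightarrow> 'e set \<Rightarrow> 'e set \<Rightarrow> 'e set set \<Rightarrow> ('n::finite) cpoly set" where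
  "hitting_ideal X K R \<B> =
     ideal_generated (linear_form ` X ` K \<union> form_prod X ` {Y. Y \<subseteq> R \<and> (\<forall>B\<in>\<B>. Y \<inter> B \<noteq> {})})"

text \<open>
  The number of elements off the hyperplane orthogonal to \<open>\<eta>\<close>, minus one if one of them is in \<open>I\<close>.
  For finite \<open>R\<close> the subtraction does not truncate, since the set is nonempty in that case.
\<close>

definition kernel_order :: "('e \<Rightarrow> real^'n) \<Rightarrow> 'e set \<Rightarrow> 'e set \<Rightarrow> real^'n \<Rightarrow> nat" where
  "kernel_order X I R \<eta> =
     card {e\<in>R. X e \<bullet> \<eta> \<noteq> 0} - (if \<exists>b\<in>R \<inter> I. X b \<bullet> \<eta> \<noteq> 0 then 1 else 0)"

text \<open>
  The directions \<open>\<eta>\<close> orthogonal to \<open>K\<close> are those along which differentiation preserves the ideal of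
  the contracted forms.
\<close>

definition power_kernel :: "('e \<Rightarrow> real^'n) \<Rightarrow> 'e set \<Rightarrow> 'e set \<Rightarrow> 'e set \<Rightarrow> ('n::finite) cpoly set" where
  "power_kernel X I R K =
     {p. \<forall>\<eta>. \<eta> \<noteq> 0 \<longrightarrow> (\<forall>k\<in>K. X k \<bullet> \<eta> = 0) \<longrightarrow>
        (dir_deriv \<eta> ^^ kernel_order X I R \<eta>) p \<in> ideal_generated (linear_form ` X ` K)}"

lemma ideal_generated_subset: "(\<And>g. g \<in> G \<Longrightarrow> g \<in> ideal_generated H) \<Longrightarrow> ideal_generated G \<subseteq> ideal_generated H"
  by (meson ring_module.span_minimal ring_module.subspace_span subsetI)

lemma hitting_ideal_subspace: "cpoly.subspace (hitting_ideal X K R \<B>)"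
  unfolding hitting_ideal_def by (rule ideal_subspace)

lemma hitting_ideal_mult: "p \<in> hitting_ideal X K R \<B> \<Longrightarrow> q * p \<in> hitting_ideal X K R \<B>"
  unfolding hitting_ideal_def by (rule ideal_mult_left)

lemma contracted_ideal_subset: "ideal_generated (linear_form ` X ` K) \<subseteq> hitting_ideal X K R \<B>"
  unfolding hitting_ideal_def by (intro ring_module.span_mono) blast

lemma hitting_ideal_generator:
  "Y \<subseteq> R \<Longrightarrow> (\<And>B. B \<in> \<B> \<Longrightarrow> Y \<inter> B \<noteq> {}) \<Longrightarrow> form_prod X Y \<in> hitting_ideal X K R \<B>"
  unfolding hitting_ideal_def by (rule ring_module.span_base) blast

lemma hitting_ideal_no_bases: "p \<in> hitting_ideal X K R {}"
proof -
  have "form_prod X {} \<in> hitting_ideal X K R {}"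
    by (rule hitting_ideal_generator) auto
  then show ?thesis
    using hitting_ideal_mult[of 1 X K R "{}" p] by (simp add: form_prod_def)
qed

lemma ideal_induct [consumes 1, case_names base step]:
  "p \<in> ideal_generated G \<Longrightarrow> h 0 \<Longrightarrow> (\<And>c g q. g \<in> G \<Longrightarrow> h q \<Longrightarrow> h (c * g + q)) \<Longrightarrow> h p"
  by (rule ring_module.span_induct_alt)

lemma form_prod_insert: "finite Y \<Longrightarrow> x \<notin> Y \<Longrightarrow> form_prod X (insert x Y) = linear_form (X x) * form_prod X Y"
  by (simp add: form_prod_def)

lemma contracted_ideal_insert:
  "p \<in> ideal_generated (linear_form ` X ` insert x K) \<longleftrightarrow>
     (\<exists>s. p - linear_form (X x) * s \<in> ideal_generated (linear_form ` X ` K))"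
  using ring_module.span_breakdown_eq[of p "linear_form (X x)" "linear_form ` X ` K"]
  by (simp add: mult.commute)

lemma linear_form_in_ideal:
  assumes "v \<in> span S"
  shows "linear_form v \<in> ideal_generated (linear_form ` S)"
  using assms
proof (induction rule: span_induct_alt)
  case base
  show ?case by (simp add: ring_module.span_zero)
next
  case (step c k v)
  have "linear_form k \<in> ideal_generated (linear_form ` S)"
    by (rule ring_module.span_base) (use step(1) in auto)
  then show ?case
    unfolding linear_form_add linear_form_scale
    by (intro cpoly.subspace_add[OF ideal_subspace] cpoly.subspace_scale[OF ideal_subspace] step(2))
qed

text \<open>
  The ideal contains all the variables, so only the constants are left.
\<close>

lemma codim_le_linear_ideal:
  assumes "span S = UNIV"
  shows "codim_le (ideal_generated (linear_form ` S)) 1"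
proof -
  let ?N = "ideal_generated (linear_form ` S)"
  have lf: "linear_form v \<in> ?N" for v
    using assms by (intro linear_form_in_ideal) simp
  have "\<exists>s\<in>cspan {1}. p - s \<in> ?N" for p
  proof (induction p rule: cpoly_induct)
    case one
    then show ?case by (intro bexI[of _ 1]) (auto intro: ring_module.span_zero cpoly.span_base)
  next
    case (var i p)
    have "var i * p \<in> ?N"
      unfolding var_eq_linear_form by (rule ideal_mult_right[OF lf])
    then show ?case by (intro bexI[of _ 0]) (auto intro: cpoly.span_zero)
  next
    case (scale c p)
    then obtain s where "s \<in> cspan {1}" "p - s \<in> ?N" by blast
    then show ?case
      by (intro bexI[of _ "cscale c s"])
        (simp_all add: cpoly.subspace_scale[OF ideal_subspace] cpoly.span_scale
          flip: cpoly.scale_right_diff_distrib)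
  next
    case (add p q)
    then obtain s t where "s \<in> cspan {1}" "p - s \<in> ?N" "t \<in> cspan {1}" "q - t \<in> ?N" by blast
    then show ?case
      by (intro bexI[of _ "s + t"])
        (simp_all add: cpoly.subspace_add[OF ideal_subspace] cpoly.span_add add_diff_add)
  qed
  then show ?thesis unfolding codim_le_def by (intro exI[of _ "{1}"]) auto
qed

context deletion_contraction
begin

abbreviation "J_all \<equiv> hitting_ideal X K (insert x R) all_bases"
abbreviation "J_deleted \<equiv> hitting_ideal X K R deleted"
abbreviation "J_contracted \<equiv> hitting_ideal X (insert x K) R contracted"

lemma J_deleted_mult:
  assumes "q \<in> J_deleted"
  shows "linear_form (X x) * q \<in> J_all"
  using assms unfolding hitting_ideal_def[of X K R]
proof (induction rule: ideal_induct)
  case base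
  show ?case by (simp add: cpoly.subspace_0[OF hitting_ideal_subspace])
next
  case (step c g q)
  have "linear_form (X x) * g \<in> J_all"
    using step(1)
  proof
    assume "g \<in> linear_form ` X ` K"
    then have "g \<in> J_all"
      by (intro subsetD[OF contracted_ideal_subset] ring_module.span_base)
    then show ?thesis by (rule hitting_ideal_mult)
  next
    assume "g \<in> form_prod X ` {Y. Y \<subseteq> R \<and> (\<forall>B\<in>deleted. Y \<inter> B \<noteq> {})}"
    then obtain Y where Y: "g = form_prod X Y" "Y \<subseteq> R" "\<forall>B\<in>deleted. Y \<inter> B \<noteq> {}" by blast
    have "form_prod X (insert x Y) \<in> J_all"
    proof (rule hitting_ideal_generator)
      show "insert x Y \<inter> B \<noteq> {}" if "B \<in> all_bases" for B
        using Y(3) that deleted_iff[of B] by (cases "x \<in> B") auto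
    qed (use Y(2) in auto)
    then show ?thesis
      using Y x_R finite_R by (metis form_prod_insert finite_subset subsetD)
  qed
  from hitting_ideal_mult[OF this, of c]
  have "linear_form (X x) * (c * g) \<in> J_all" by (simp add: ac_simps)
  then show ?case
    unfolding distrib_left by (rule cpoly.subspace_add[OF hitting_ideal_subspace]) (rule step(2))
qed

text \<open>
  This is where \<open>exchange_into\<close> enters: a set that hits the bases of the contraction
  hits all internal bases.
\<close>

lemma J_contracted_lift:
  assumes "X x \<notin> span (X ` K)" "q \<in> J_contracted"
  shows "\<exists>s. q - linear_form (X x) * s \<in> J_all"
  using assms(2) unfolding hitting_ideal_def[of X "insert x K" R]
proof (induction rule: ideal_induct)
  case base
  show ?case by (intro exI[of _ 0]) (simp add: cpoly.subspace_0[OF hitting_ideal_subspace])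
next
  case (step c g q)
  have "\<exists>s. g - linear_form (X x) * s \<in> J_all"
    using step(1)
  proof
    assume "g \<in> linear_form ` X ` insert x K"
    then have "g \<in> ideal_generated (linear_form ` X ` insert x K)"
      by (rule ring_module.span_base)
    then show ?thesis
      unfolding contracted_ideal_insert using contracted_ideal_subset by blast
  next
    assume "g \<in> form_prod X ` {Y. Y \<subseteq> R \<and> (\<forall>B\<in>contracted. Y \<inter> B \<noteq> {})}"
    then obtain Y where Y: "g = form_prod X Y" "Y \<subseteq> R" "\<forall>B\<in>contracted. Y \<inter> B \<noteq> {}" by blast
    have hit: "Y \<inter> B \<noteq> {}" if "B \<in> all_bases" "x \<in> B" for B
      using contracted_if_all[OF that] Y(3) by blast
    have "g \<in> J_all"
      unfolding Y(1)
    proof (rule hitting_ideal_generator)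
      show "Y \<inter> B \<noteq> {}" if B: "B \<in> all_bases" for B
      proof (cases "x \<in> B")
        case False
        then obtain B' where "B' \<in> all_bases" "x \<in> B'" "B' \<subseteq> insert x B"
          using exchange_into[OF B _ assms(1)] by blast
        then show ?thesis using hit[of B'] Y(2) x_R by blast
      qed (use hit B in blast)
    qed (use Y(2) in blast)
    then show ?thesis by (metis diff_zero mult_zero_right)
  qed
  then obtain s where s: "g - linear_form (X x) * s \<in> J_all" by blast
  obtain t where t: "q - linear_form (X x) * t \<in> J_all" using step(2) by blast
  have "c * (g - linear_form (X x) * s) + (q - linear_form (X x) * t) \<in> J_all"
    by (intro cpoly.subspace_add[OF hitting_ideal_subspace] hitting_ideal_mult s t)
  also have "c * (g - linear_form (X x) * s) + (q - linear_form (X x) * t)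
      = (c * g + q) - linear_form (X x) * (c * s + t)"
    by (simp add: algebra_simps)
  finally show ?case by blast
qed

lemma J_all_subset_contracted:
  assumes "x \<in> I \<Longrightarrow> span (X ` (K \<union> R)) = UNIV"
  shows "J_all \<subseteq> J_contracted"
  unfolding hitting_ideal_def[of X K "insert x R"] hitting_ideal_def[of X "insert x K" R]
proof (rule ideal_generated_subset, fold hitting_ideal_def[of X "insert x K" R])
  fix g assume "g \<in> linear_form ` X ` K \<union> form_prod X ` {Y. Y \<subseteq> insert x R \<and> (\<forall>B\<in>all_bases. Y \<inter> B \<noteq> {})}"
  then show "g \<in> J_contracted"
  proof
    assume "g \<in> linear_form ` X ` K"
    then show ?thesis
      by (intro subsetD[OF contracted_ideal_subset] ring_module.span_base) blast
  next
    assume "g \<in> form_prod X ` {Y. Y \<subseteq> insert x R \<and> (\<forall>B\<in>all_bases. Y \<inter> B \<noteq> {})}"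
    then obtain Y where Y: "g = form_prod X Y" "Y \<subseteq> insert x R" "\<forall>B\<in>all_bases. Y \<inter> B \<noteq> {}" by blast
    show ?thesis
    proof (cases "x \<in> Y")
      case True
      have "finite Y" using Y(2) finite_R finite_subset by blast
      then have "g = form_prod X (Y - {x}) * linear_form (X x)"
        using True Y(1) form_prod_insert[of "Y - {x}" x X] by (simp add: insert_absorb mult.commute)
      moreover have "linear_form (X x) \<in> J_contracted"
        by (intro subsetD[OF contracted_ideal_subset] ring_module.span_base) blast
      ultimately show ?thesis by (simp only: hitting_ideal_mult)
    next
      case False
      have "Y \<inter> B \<noteq> {}" if "B \<in> contracted" for B
        using all_if_contracted[OF that assms] Y(3) False by blast
      then show ?thesis
        unfolding Y(1) by (intro hitting_ideal_generator) (use Y(2) False in auto)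
    qed
  qed
qed

lemma loop_ideal:
  assumes "X x \<in> span (X ` K)"
  shows "J_all = J_deleted"
proof
  show "J_deleted \<subseteq> J_all"
    unfolding loop_bases[OF assms] hitting_ideal_def by (intro ring_module.span_mono) blast
  show "J_all \<subseteq> J_deleted"
    unfolding hitting_ideal_def[of X K "insert x R"] hitting_ideal_def[of X K R]
  proof (rule ideal_generated_subset, fold hitting_ideal_def[of X K R])
    fix g assume "g \<in> linear_form ` X ` K \<union> form_prod X ` {Y. Y \<subseteq> insert x R \<and> (\<forall>B\<in>all_bases. Y \<inter> B \<noteq> {})}"
    then show "g \<in> J_deleted"
    proof
      assume "g \<in> linear_form ` X ` K"
      then show ?thesis
        by (intro subsetD[OF contracted_ideal_subset] ring_module.span_base)
    next
      assume "g \<in> form_prod X ` {Y. Y \<subseteq> insert x R \<and> (\<forall>B\<in>all_bases. Y \<inter> B \<noteq> {})}"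
      then obtain Y where Y: "g = form_prod X Y" "Y \<subseteq> insert x R" "\<forall>B\<in>all_bases. Y \<inter> B \<noteq> {}" by blast
      show ?thesis
      proof (cases "x \<in> Y")
        case True
        have "finite Y" using Y(2) finite_R finite_subset by blast
        then have "g = form_prod X (Y - {x}) * linear_form (X x)"
          using True Y(1) form_prod_insert[of "Y - {x}" x X] by (simp add: insert_absorb mult.commute)
        moreover have "linear_form (X x) \<in> J_deleted"
          by (intro subsetD[OF contracted_ideal_subset] linear_form_in_ideal assms)
        ultimately show ?thesis by (simp only: hitting_ideal_mult)
      next
        case False
        show ?thesis
          unfolding Y(1) by (intro hitting_ideal_generator) (use Y False loop_bases[OF assms] in auto)
      qed
    qed
  qed
qed

end

text \<open>
  Deletion and contraction of the least element. The recursion ends with no element left, where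
  the ideal is either everything or contains all linear forms.
\<close>

lemma codim_hitting_ideal:
  fixes X :: "'e \<Rightarrow> real^'n"
  assumes "finite R" "trans r" "irrefl r" "total_on R r" "finite K" "K \<inter> R = {}" "card K = dim (X ` K)"
  shows "codim_le (hitting_ideal X K R (contracted_bases X r I R K)) (card (contracted_bases X r I R K))"
  using assms(1-4,5-7)
proof (induction arbitrary: K rule: finite_least_induct)
  case empty
  show ?case
  proof (cases "contracted_bases X r I {} K = {}")
    case True
    then show ?thesis
      using hitting_ideal_no_bases[of _ X K "{}"] by (auto simp: codim_le_def intro!: exI[of _ "{}"])
  next
    case False
    then have ne: "contracted_bases X r I {} K = {{}}" and spn: "span (X ` K) = UNIV"
      by (auto simp: contracted_bases_def)
    have "codim_le (ideal_generated (linear_form ` X ` K)) 1"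
      using spn by (rule codim_le_linear_ideal)
    then show ?thesis
      using contracted_ideal_subset by (rule codim_le_mono) (simp add: ne)
  qed
next
  case (insert x R)
  interpret deletion_contraction X r I R K x
    by unfold_locales (use insert assms(2,3) in auto)
  consider "all_bases = {}" | "all_bases \<noteq> {}" "X x \<in> span (X ` K)" | "all_bases \<noteq> {}" "X x \<notin> span (X ` K)"
    by blast
  then show ?case
  proof cases
    case 1
    then show ?thesis
      using hitting_ideal_no_bases[of _ X K "insert x R"] by (auto simp: codim_le_def intro!: exI[of _ "{}"])
  next
    case 2
    have "codim_le J_deleted (card deleted)"
      using insert by (intro insert.IH) auto
    then show ?thesis
      unfolding loop_ideal[OF 2(2)] unfolding loop_bases[OF 2(2)] .
  next
    case 3
    have "codim_le J_deleted (card deleted)"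
      using insert by (intro insert.IH) auto
    moreover have "card (insert x K) = dim (X ` insert x K)"
      using insert.prems 3(2) x_K by (simp add: dim_insert)
    then have "codim_le J_contracted (card contracted)"
      using insert by (intro insert.IH) auto
    ultimately have "codim_le J_all (card deleted + card contracted)"
      using codim_le_extend[OF hitting_ideal_subspace J_deleted_mult J_contracted_lift[OF 3(2)]] by blast
    then show ?thesis
      using card_deleted_contracted coloop_no_bases 3(1) by (metis codim_le_mono order_refl)
  qed
qed

text \<open>
  The assumption that the codimension of the ideal is as large as the number of bases is inherited
  by deletion and contraction, as the two upper bounds add up to at most that number. By
  contraction, \<open>p\<close> is a multiple \<open>p\<^sub>x q\<close> modulo the contracted forms. By Leibniz' rule \<open>q\<close> is in the power
  kernel of the deletion, and it must be in the ideal of the deletion: otherwise the ideal \<open>{s. p\<^sub>x s \<in> J}\<close>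
  would be strictly larger than the latter, and the codimension of \<open>J\<close> too small.
\<close>

lemma power_kernel_inter_hitting_ideal:
  fixes X :: "'e \<Rightarrow> real^'n"
  assumes "finite R" "trans r" "irrefl r" "total_on R r" "finite K" "K \<inter> R = {}" "card K = dim (X ` K)"
    and "\<And>n. codim_le (hitting_ideal X K R (contracted_bases X r I R K)) n \<Longrightarrow> card (contracted_bases X r I R K) \<le> n"
    and "p \<in> power_kernel X I R K" "p \<in> hitting_ideal X K R (contracted_bases X r I R K)"
  shows "p \<in> ideal_generated (linear_form ` X ` K)"
  using assms(1-4,5-)
proof (induction arbitrary: K p rule: finite_least_induct)
  case (empty K p)
  show ?case
  proof (cases "span (X ` K) = UNIV")
    case True
    then have "card K = CARD('n)"
      using empty(3) by (simp add: full_dim_iff)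
    then have "contracted_bases X r I {} K = {{}}"
      using True by (auto simp: contracted_bases_def)
    then show ?thesis using empty(6) by (simp add: hitting_ideal_def)
  next
    case False
    then obtain v where "v \<notin> span (X ` K)" by blast
    then obtain \<eta> where "\<And>k. k \<in> X ` K \<Longrightarrow> k \<bullet> \<eta> = 0" "v \<bullet> \<eta> \<noteq> 0"
      using separating_direction by blast
    then show ?thesis
      using empty(5) by (auto simp: power_kernel_def kernel_order_def dest!: spec[of _ \<eta>])
  qed
next
  case (insert x R K p)
  interpret deletion_contraction X r I R K x
    by unfold_locales (use insert assms(2,3) in auto)
  let ?N = "ideal_generated (linear_form ` X ` K)"
  have p: "(dir_deriv \<eta> ^^ kernel_order X I (insert x R) \<eta>) p \<in> ?N"
    if "\<eta> \<noteq> 0" "\<And>k. k \<in> K \<Longrightarrow> X k \<bullet> \<eta> = 0" for \<eta>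
    using insert.prems(5) that by (auto simp: power_kernel_def)
  have order_eq: "kernel_order X I (insert x R) \<eta> = kernel_order X I R \<eta>" if "X x \<bullet> \<eta> = 0" for \<eta>
  proof -
    have "{e \<in> insert x R. X e \<bullet> \<eta> \<noteq> 0} = {e \<in> R. X e \<bullet> \<eta> \<noteq> 0}" using that by auto
    moreover have "(\<exists>b\<in>insert x R \<inter> I. X b \<bullet> \<eta> \<noteq> 0) \<longleftrightarrow> (\<exists>b\<in>R \<inter> I. X b \<bullet> \<eta> \<noteq> 0)" using that by auto
    ultimately show ?thesis by (simp only: kernel_order_def)
  qed
  have order_le: "kernel_order X I (insert x R) \<eta> - 1 \<le> kernel_order X I R \<eta>" if "X x \<bullet> \<eta> \<noteq> 0" for \<eta>
  proof -
    have "{e \<in> insert x R. X e \<bullet> \<eta> \<noteq> 0} = insert x {e \<in> R. X e \<bullet> \<eta> \<noteq> 0}" using that by auto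
    then have "card {e \<in> insert x R. X e \<bullet> \<eta> \<noteq> 0} = Suc (card {e \<in> R. X e \<bullet> \<eta> \<noteq> 0})"
      using finite_R x_R by simp
    then show ?thesis by (auto simp: kernel_order_def)
  qed
  show ?case
  proof (cases "X x \<in> span (X ` K)")
    case True
    have "p \<in> power_kernel X I R K"
      unfolding power_kernel_def
    proof (intro CollectI allI impI)
      fix \<eta> :: "real^'n" assume \<eta>: "\<eta> \<noteq> 0" "\<forall>k\<in>K. X k \<bullet> \<eta> = 0"
      have "X x \<bullet> \<eta> = 0"
        using True \<eta>(2) by (induction rule: span_induct_alt) (auto simp: inner_add_left)
      then show "(dir_deriv \<eta> ^^ kernel_order X I R \<eta>) p \<in> ?N"
        using p[OF \<eta>(1)] \<eta>(2) order_eq by metis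
    qed
    then show ?thesis
      using insert.prems unfolding loop_ideal[OF True] unfolding loop_bases[OF True]
      by (intro insert.IH[of K p]) auto
  next
    case False
    show ?thesis
    proof (cases "x \<in> I \<and> span (X ` (K \<union> R)) \<noteq> UNIV")
      case True
      then obtain v where "v \<notin> span (X ` (K \<union> R))" by blast
      then obtain \<eta> where \<eta>: "\<And>k. k \<in> X ` (K \<union> R) \<Longrightarrow> k \<bullet> \<eta> = 0" "v \<bullet> \<eta> \<noteq> 0"
        using separating_direction by blast
      \<comment> \<open>The order at \<open>\<eta>\<close> is zero: either no element is off the hyperplane, or only \<open>x\<close>, which is in \<open>I\<close>.\<close>
      have "{e \<in> insert x R. X e \<bullet> \<eta> \<noteq> 0} = (if X x \<bullet> \<eta> = 0 then {} else {x})"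
        using \<eta>(1) by auto
      then have "kernel_order X I (insert x R) \<eta> = 0"
        using True by (auto simp: kernel_order_def)
      moreover have "\<eta> \<noteq> 0" using \<eta>(2) by auto
      ultimately show ?thesis using p[of \<eta>] \<eta>(1) by auto
    next
      case noncoloop: False
      have dim': "card (insert x K) = dim (X ` insert x K)"
        using insert.prems False x_K by (simp add: dim_insert)
      have U: "codim_le J_deleted (card deleted)" "codim_le J_contracted (card contracted)"
        using insert dim' by (auto intro!: codim_hitting_ideal assms(2,3) elim: total_on_subset)
      have split: "card deleted + card contracted \<le> card all_bases"
        using card_deleted_contracted noncoloop by blast
      have tight: "card all_bases \<le> a + b" if "codim_le J_deleted a" "codim_le J_contracted b" for a b
        using insert.prems(4)
          codim_le_extend[OF hitting_ideal_subspace J_deleted_mult J_contracted_lift[OF False] that] by blast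
      have "p \<in> power_kernel X I R (insert x K)"
        unfolding power_kernel_def
      proof (intro CollectI allI impI)
        fix \<eta> :: "real^'n" assume \<eta>: "\<eta> \<noteq> 0" "\<forall>k\<in>insert x K. X k \<bullet> \<eta> = 0"
        have "?N \<subseteq> ideal_generated (linear_form ` X ` insert x K)"
          by (intro ring_module.span_mono) blast
        then show "(dir_deriv \<eta> ^^ kernel_order X I R \<eta>) p \<in> ideal_generated (linear_form ` X ` insert x K)"
          using p[OF \<eta>(1)] \<eta>(2) order_eq[of \<eta>] by auto
      qed
      moreover have "p \<in> J_contracted"
        using J_all_subset_contracted noncoloop insert.prems(6) by blast
      moreover have "card contracted \<le> n" if "codim_le J_contracted n" for n
        using tight[OF U(1) that] split by simp
      ultimately have "p \<in> ideal_generated (linear_form ` X ` insert x K)"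
        using insert.prems insert.hyps dim' by (intro insert.IH[of "insert x K" p]) auto
      then obtain q where q: "p - linear_form (X x) * q \<in> ?N"
        unfolding contracted_ideal_insert by blast
      have D: "(dir_deriv \<eta> ^^ kernel_order X I (insert x R) \<eta>) (linear_form (X x) * q) \<in> ?N"
        if "\<eta> \<noteq> 0" "\<And>k. k \<in> K \<Longrightarrow> X k \<bullet> \<eta> = 0" for \<eta>
      proof -
        have "(dir_deriv \<eta> ^^ j) (p - linear_form (X x) * q) \<in> ?N" for j
          using that q by (intro dir_deriv_funpow_linear_ideal) auto
        moreover have "(dir_deriv \<eta> ^^ j) p = (dir_deriv \<eta> ^^ j) (linear_form (X x) * q)
            + (dir_deriv \<eta> ^^ j) (p - linear_form (X x) * q)" for j
          by (simp flip: dir_deriv_funpow_add)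
        ultimately show ?thesis
          using cpoly.subspace_diff[OF ideal_subspace p[OF that]] by (metis add_diff_cancel_right')
      qed
      have "q \<in> power_kernel X I R K"
        unfolding power_kernel_def
      proof (intro CollectI allI impI)
        \<comment> \<open>If \<open>x\<close> is orthogonal to \<open>\<eta>\<close> then \<open>p\<^sub>x\<close> cancels; otherwise the order drops by one.\<close>
        fix \<eta> :: "real^'n" assume \<eta>: "\<eta> \<noteq> 0" "\<forall>k\<in>K. X k \<bullet> \<eta> = 0"
        have Dq: "(dir_deriv \<eta> ^^ kernel_order X I (insert x R) \<eta>) (linear_form (X x) * q) \<in> ?N"
          using D \<eta> by blast
        show "(dir_deriv \<eta> ^^ kernel_order X I R \<eta>) q \<in> ?N"
        proof (cases "X x \<bullet> \<eta> = 0")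
          case True
          then have "linear_form (X x) * (dir_deriv \<eta> ^^ kernel_order X I R \<eta>) q \<in> ?N"
            using Dq order_eq[OF True] by (simp add: dir_deriv_funpow_linear_form_mult inner_commute)
          with False show ?thesis by (rule linear_form_cancel)
        next
          case nz: False
          let ?k = "kernel_order X I (insert x R) \<eta> - 1"
          have "(dir_deriv \<eta> ^^ ?k) q \<in> ?N"
            using \<eta>(2) by (intro dir_deriv_descent[OF refl _ nz Dq]) auto
          then have "(dir_deriv \<eta> ^^ (kernel_order X I R \<eta> - ?k)) ((dir_deriv \<eta> ^^ ?k) q) \<in> ?N"
            by (rule dir_deriv_funpow_linear_ideal[rotated]) (use \<eta>(2) in auto)
          moreover have "kernel_order X I R \<eta> - ?k + ?k = kernel_order X I R \<eta>"
            using order_le[OF nz] by simp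
          ultimately show ?thesis by (metis funpow_add o_apply)
        qed
      qed
      moreover have "q \<in> J_deleted"
      proof (rule ccontr)
        assume "q \<notin> J_deleted"
        define J' where "J' = {s. linear_form (X x) * s \<in> J_all}"
        have "cpoly.subspace J'"
        proof (rule cpoly.subspaceI)
          show "0 \<in> J'"
            unfolding J'_def mem_Collect_eq mult_zero_right by (rule cpoly.subspace_0[OF hitting_ideal_subspace])
        next
          fix s t assume "s \<in> J'" "t \<in> J'"
          then show "s + t \<in> J'"
            unfolding J'_def mem_Collect_eq distrib_left by (rule cpoly.subspace_add[OF hitting_ideal_subspace])
        next
          fix c s assume "s \<in> J'"
          then show "cscale c s \<in> J'"
            unfolding J'_def mem_Collect_eq cscale_mult_right by (rule cpoly.subspace_scale[OF hitting_ideal_subspace])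
        qed
        moreover have "J_deleted \<subseteq> J'" using J_deleted_mult by (auto simp: J'_def)
        moreover have "p - (p - linear_form (X x) * q) \<in> J_all"
          by (rule cpoly.subspace_diff[OF hitting_ideal_subspace insert.prems(6) subsetD[OF contracted_ideal_subset q]])
        then have "q \<in> J'" by (simp add: J'_def)
        ultimately obtain a where a: "a < card deleted" "codim_le J' a"
          using codim_le_reduce[OF hitting_ideal_subspace _ _ U(1) _ \<open>q \<notin> J_deleted\<close>] by blast
        have "codim_le J_all (a + card contracted)"
          by (rule codim_le_extend[OF hitting_ideal_subspace _ J_contracted_lift[OF False] a(2) U(2)])
            (simp add: J'_def)
        then show False using insert.prems(4) split a(1) by fastforce
      qed
      moreover have "card deleted \<le> n" if "codim_le J_deleted n" for n
        using tight[OF that U(2)] split by simp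
      ultimately have "q \<in> ?N"
        using insert.prems by (intro insert.IH[of K q]) auto
      then have "linear_form (X x) * q + (p - linear_form (X x) * q) \<in> ?N"
        by (intro cpoly.subspace_add[OF ideal_subspace] ideal_mult_left q)
      then show ?thesis by simp
    qed
  qed
qed

section \<open>The least space\<close>

text \<open>
  The homogeneous part of degree \<open>j\<close> of the exponential sum with coefficients \<open>c\<close>.
\<close>

definition exp_sum_part :: "(real^'n) set \<Rightarrow> (real^'n \<Rightarrow> complex) \<Rightarrow> nat \<Rightarrow> ('n::finite) cpoly" where
  "exp_sum_part V c j = (\<Sum>v\<in>V. cscale (c v / fact j) (linear_form v ^ j))"

lemma homogeneous_sum: "(\<And>a. a \<in> A \<Longrightarrow> homogeneous k (f a)) \<Longrightarrow> homogeneous k (sum f A)"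
proof (induction A rule: infinite_finite_induct)
  case (insert a A)
  then show ?case
    using Poly_Mapping.keys_add[of "f a" "sum f A"] by (auto simp: homogeneous_def)
qed (simp_all add: homogeneous_def)

lemma homogeneous_scale: "homogeneous k p \<Longrightarrow> homogeneous k (cscale c p)"
  by (auto simp: homogeneous_def in_keys_iff lookup_cscale)

lemma homogeneous_mult:
  assumes "homogeneous j p" "homogeneous k q"
  shows "homogeneous (j + k) (p * q)"
  using assms Poly_Mapping.keys_mult[of p q]
  by (fastforce simp: homogeneous_def lookup_add sum.distrib)

lemma homogeneous_linear_form: "homogeneous 1 (linear_form v)"
  unfolding linear_form_def
  by (intro homogeneous_sum) (auto simp: homogeneous_def lookup_single when_def)

lemma homogeneous_linear_form_power: "homogeneous j (linear_form v ^ j)"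
proof (induction j)
  case (Suc j)
  then show ?case
    using homogeneous_mult[OF homogeneous_linear_form Suc] by simp
qed (simp add: homogeneous_def)

lemma homogeneous_exp_sum_part: "homogeneous j (exp_sum_part V c j)"
  unfolding exp_sum_part_def by (intro homogeneous_sum homogeneous_scale homogeneous_linear_form_power)

lemma exp_sum_part_expansion:
  "homogeneous_expansion (\<lambda>t. \<Sum>v\<in>V. c v * exp (of_real (v \<bullet> t))) (exp_sum_part V c)"
  unfolding homogeneous_expansion_def
proof (intro conjI allI)
  fix t
  have "(\<lambda>j. c v * ((complex_of_real (v \<bullet> t)) ^ j /\<^sub>R fact j)) sums (c v * exp (of_real (v \<bullet> t)))" for v
    by (intro sums_mult exp_converges)
  then have "(\<lambda>j. \<Sum>v\<in>V. c v * ((complex_of_real (v \<bullet> t)) ^ j /\<^sub>R fact j)) sums (\<Sum>v\<in>V. c v * exp (of_real (v \<bullet> t)))"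
    by (intro sums_sum)
  then show "(\<lambda>j. poly_eval (exp_sum_part V c j) t) sums (\<Sum>v\<in>V. c v * exp (of_real (v \<bullet> t)))"
    by (simp add: exp_sum_part_def poly_eval_sum poly_eval_scale poly_eval_power poly_eval_linear_form
        scaleR_conv_of_real field_simps)
qed (rule homogeneous_exp_sum_part)

lemma poly_eval_homogeneous:
  assumes "homogeneous k p"
  shows "poly_eval p (s *\<^sub>R t) = of_real s ^ k * poly_eval p t"
proof -
  have "(\<Prod>i\<in>UNIV. complex_of_real ((s *\<^sub>R t) $ i) ^ lookup \<alpha> i)
      = of_real s ^ k * (\<Prod>i\<in>UNIV. of_real (t $ i) ^ lookup \<alpha> i)" if "\<alpha> \<in> keys p" for \<alpha>
    using assms that by (simp add: homogeneous_def power_mult_distrib prod.distrib flip: power_sum)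
  then show ?thesis
    by (simp add: poly_eval_def sum_distrib_left mult.left_commute)
qed

text \<open>
  Differentiating the series term by term shifts the coefficients down, up to nonzero factors.
\<close>

lemma real_powser_zero:
  fixes a :: "nat \<Rightarrow> real"
  assumes "\<And>s. (\<lambda>j. a j * s ^ j) sums 0"
  shows "a m = 0"
  using assms
proof (induction m arbitrary: a)
  case 0
  have "(\<lambda>j. a j * 0 ^ j) sums a 0" by (rule powser_sums_zero)
  with 0[of 0] show ?case using sums_unique2 by blast
next
  case (Suc m)
  have sm: "summable (\<lambda>j. a j * s ^ j)" for s using Suc.prems sums_summable by blast
  have "(\<lambda>j. diffs a j * s ^ j) sums 0" for s
  proof -
    have "((\<lambda>s. suminf (\<lambda>j. a j * s ^ j)) has_field_derivative (suminf (\<lambda>j. diffs a j * s ^ j))) (at s)"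
      by (rule termdiffs_strong[OF sm, of _ "\<bar>s\<bar> + 1"]) simp
    moreover have "suminf (\<lambda>j. a j * s ^ j) = 0" for s
      by (rule sums_unique[symmetric]) (rule Suc.prems)
    ultimately have "((\<lambda>s. 0) has_field_derivative (suminf (\<lambda>j. diffs a j * s ^ j))) (at s)"
      by simp
    then have "suminf (\<lambda>j. diffs a j * s ^ j) = 0"
      using DERIV_unique[OF _ DERIV_const] by blast
    moreover have "summable (\<lambda>j. diffs a j * s ^ j)"
      by (rule termdiff_converges_all) (rule sm)
    ultimately show ?thesis by (metis summable_sums)
  qed
  from Suc.IH[OF this] show ?case by (simp add: diffs_def)
qed

text \<open>
  On the line through \<open>t\<close> an expansion is a power series in the parameter.
\<close>

lemma homogeneous_expansion_unique:
  assumes "homogeneous_expansion f F" "homogeneous_expansion f G"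
  shows "F = G"
proof
  fix m
  have "poly_eval (F m + cscale (-1) (G m)) t = 0" for t
  proof -
    let ?d = "\<lambda>j. poly_eval (F j) t - poly_eval (G j) t"
    have d: "(\<lambda>j. ?d j * of_real s ^ j) sums 0" for s
    proof -
      have "(\<lambda>j. poly_eval (F j) (s *\<^sub>R t) - poly_eval (G j) (s *\<^sub>R t)) sums (f (s *\<^sub>R t) - f (s *\<^sub>R t))"
        using assms by (intro sums_diff) (auto simp: homogeneous_expansion_def)
      moreover have h: "homogeneous j (F j)" "homogeneous j (G j)" for j
        using assms by (auto simp: homogeneous_expansion_def)
      ultimately show ?thesis
        by (simp add: poly_eval_homogeneous[OF h(1)] poly_eval_homogeneous[OF h(2)] right_diff_distrib mult.commute[of _ "of_real s ^ _"])
    qed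
    have "Re (?d m) = 0"
      using sums_Re[OF d] by (intro real_powser_zero[of "\<lambda>j. Re (?d j)"]) (simp flip: of_real_power)
    moreover have "Im (?d m) = 0"
      using sums_Im[OF d] by (intro real_powser_zero[of "\<lambda>j. Im (?d j)"]) (simp flip: of_real_power)
    ultimately have "?d m = 0" by (intro complex_eqI) simp_all
    then show ?thesis
      unfolding poly_eval_add poly_eval_scale by simp
  qed
  then have "F m + cscale (-1) (G m) = 0" by (rule poly_eq_0_if_eval_0)
  then show "F m = G m" by simp
qed

lemma is_least_exp_iff:
  "is_least (\<lambda>t. \<Sum>v\<in>V. c v * exp (of_real (v \<bullet> t))) g \<longleftrightarrow>
     (\<exists>j. exp_sum_part V c j \<noteq> 0 \<and> (\<forall>k<j. exp_sum_part V c k = 0) \<and> g = exp_sum_part V c j)"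
  unfolding is_least_def using exp_sum_part_expansion homogeneous_expansion_unique by blast

lemma dir_deriv_linear_form_power:
  "dir_deriv y (linear_form v ^ Suc j) = cscale (of_nat (Suc j) * of_real (y \<bullet> v)) (linear_form v ^ j)"
proof (induction j)
  case 0
  show ?case using dir_deriv_linear_form_mult[of y v 1] by simp
next
  case (Suc j)
  have "dir_deriv y (linear_form v ^ Suc (Suc j))
     = cscale (of_real (y \<bullet> v)) (linear_form v ^ Suc j) + linear_form v * dir_deriv y (linear_form v ^ Suc j)"
    by (simp only: power_Suc[of _ "Suc j"] dir_deriv_linear_form_mult)
  also have "\<dots> = cscale (of_nat (Suc (Suc j)) * of_real (y \<bullet> v)) (linear_form v ^ Suc j)"
    unfolding Suc cscale_mult_right power_Suc[symmetric] cpoly.scale_left_distrib[symmetric]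
    by (simp add: algebra_simps)
  finally show ?case .
qed

lemma dir_deriv_sum: "dir_deriv \<eta> (sum f A) = (\<Sum>a\<in>A. dir_deriv \<eta> (f a))"
  by (induction A rule: infinite_finite_induct) (simp_all add: dir_deriv_add)

lemma exp_sum_part_zero_coeffs: "(\<And>v. v \<in> V \<Longrightarrow> c v = 0) \<Longrightarrow> exp_sum_part V c j = 0"
  by (simp add: exp_sum_part_def)

lemma dir_deriv_exp_sum_part_0: "dir_deriv y (exp_sum_part V c 0) = 0"
  by (simp add: exp_sum_part_def dir_deriv_sum dir_deriv_scale)

text \<open>
  \<open>D\<^sub>y - \<mu>\<close> multiplies the coefficient at \<open>v\<close> by \<open>y \<bullet> v - \<mu>\<close>, compared degree by degree.
\<close>

lemma dir_deriv_exp_sum_part_Suc: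
  "dir_deriv y (exp_sum_part V c (Suc j))
     = exp_sum_part V (\<lambda>v. c v * of_real (y \<bullet> v - \<mu>)) j + cscale (of_real \<mu>) (exp_sum_part V c j)"
proof -
  have "dir_deriv y (exp_sum_part V c (Suc j)) =
      (\<Sum>v\<in>V. cscale (c v / fact (Suc j) * (of_nat (Suc j) * of_real (y \<bullet> v))) (linear_form v ^ j))"
    unfolding exp_sum_part_def dir_deriv_sum dir_deriv_scale dir_deriv_linear_form_power cpoly.scale_scale ..
  also have "c v / fact (Suc j) * (of_nat (Suc j) * of_real (y \<bullet> v))
      = c v * of_real (y \<bullet> v - \<mu>) / fact j + of_real \<mu> * (c v / fact j)" for v
    by (simp add: field_simps del: of_nat_Suc)
  then have "(\<Sum>v\<in>V. cscale (c v / fact (Suc j) * (of_nat (Suc j) * of_real (y \<bullet> v))) (linear_form v ^ j))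
      = exp_sum_part V (\<lambda>v. c v * of_real (y \<bullet> v - \<mu>)) j + cscale (of_real \<mu>) (exp_sum_part V c j)"
    by (simp only: exp_sum_part_def cpoly.scale_left_distrib sum.distrib cpoly.scale_sum_right cpoly.scale_scale)
  finally show ?thesis .
qed

text \<open>
  Applied to a series that starts in degree \<open>j\<close>, the operators \<open>D\<^sub>y - \<lambda>\<^sub>y\<close> and \<open>D\<^sub>y\<close> agree on the
  lowest term, and the result starts in degree \<open>j - 1\<close>. Iterating over \<open>Y\<close> computes \<open>p\<^sub>Y(D)\<close> on the lowest term.
\<close>

lemma diff_op_form_prod_exp_sum_part:
  assumes "finite Y" "\<And>i. i < j \<Longrightarrow> exp_sum_part V c i = 0"
  shows "diff_op (form_prod X Y) (exp_sum_part V c j) =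
    (if card Y \<le> j then exp_sum_part V (\<lambda>v. c v * (\<Prod>y\<in>Y. of_real (X y \<bullet> v - lam y))) (j - card Y) else 0)"
  using assms
proof (induction Y arbitrary: c j rule: finite_induct)
  case empty
  then show ?case by (simp add: form_prod_def)
next
  case (insert y Y)
  have step: "diff_op (form_prod X (insert y Y)) q = diff_op (form_prod X Y) (dir_deriv (X y) q)" for q
    using insert.hyps
    by (simp add: form_prod_insert diff_op_mult dir_deriv_def diff_op_commute[of "linear_form (X y)"])
  let ?c = "\<lambda>v. c v * of_real (X y \<bullet> v - lam y)"
  show ?case
  proof (cases j)
    case 0
    then show ?thesis
      using insert.hyps by (simp add: step dir_deriv_exp_sum_part_0)
  next
    case (Suc k)
    have "exp_sum_part V c k = 0" using insert.prems[of k] Suc by simp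
    then have d: "dir_deriv (X y) (exp_sum_part V c (Suc k)) = exp_sum_part V ?c k"
      using dir_deriv_exp_sum_part_Suc[of "X y" V c k "lam y"] Suc by simp
    have "exp_sum_part V ?c i = 0" if "i < k" for i
      using dir_deriv_exp_sum_part_Suc[of "X y" V c i "lam y"] insert.prems[of i] insert.prems[of "Suc i"] that Suc
      by simp
    from insert.IH[OF this] show ?thesis
      using insert.hyps Suc by (simp add: step d mult.assoc del: of_real_diff)
  qed
qed

text \<open>
  Linear independence of exponentials. If all homogeneous parts vanish, so do those obtained after
  multiplying the coefficients by a product of affine functions of \<open>v\<close>. The product chosen here vanishes
  on \<open>V\<close> except at \<open>v0\<close>.
\<close>

lemma exp_sum_part_nonzero:
  assumes "finite V" "v0 \<in> V" "c v0 \<noteq> 0"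
  shows "\<exists>j. exp_sum_part V c j \<noteq> 0"
proof (rule ccontr)
  assume *: "\<nexists>j. exp_sum_part V c j \<noteq> 0"
  let ?Y = "V - {v0}"
  let ?X = "\<lambda>w. v0 - w"
  let ?lam = "\<lambda>w. (v0 - w) \<bullet> w"
  let ?c = "\<lambda>v. c v * (\<Prod>y\<in>?Y. of_real (?X y \<bullet> v - ?lam y))"
  have "exp_sum_part V ?c 0 = 0"
    using diff_op_form_prod_exp_sum_part[of ?Y "card ?Y" V c ?X ?lam] assms(1) * by simp
  moreover have "exp_sum_part V ?c 0 = (\<Sum>v\<in>V. cscale (?c v) 1)"
    by (simp add: exp_sum_part_def)
  moreover have "(\<Sum>v\<in>V. cscale (?c v) (1 :: 'a cpoly)) = cscale (?c v0) 1"
  proof -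
    have "?c v = 0" if "v \<in> V - {v0}" for v
      using assms(1) that by (auto intro!: prod_zero bexI[of _ v])
    then have "(\<Sum>v\<in>V. cscale (?c v) (1 :: 'a cpoly)) = (\<Sum>v\<in>{v0}. cscale (?c v) 1)"
      using assms(1,2) by (intro sum.mono_neutral_right) auto
    then show ?thesis by simp
  qed
  ultimately have "cscale (?c v0) (1 :: 'a cpoly) = 0" by simp
  then have "?c v0 = 0" by simp
  then obtain w where "w \<in> ?Y" "(v0 - w) \<bullet> v0 - (v0 - w) \<bullet> w = 0"
    using assms by (auto simp: prod_zero_iff simp flip: of_real_diff)
  then have "(v0 - w) \<bullet> (v0 - w) = 0" by (simp add: inner_diff_right)
  with \<open>w \<in> ?Y\<close> show False by simp
qed

abbreviation total_degree :: "('n::finite \<Rightarrow>\<^sub>0 nat) \<Rightarrow> nat" where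
  "total_degree \<alpha> \<equiv> \<Sum>i\<in>UNIV. lookup \<alpha> i"

text \<open>
  Gaussian elimination on leading terms. Choose an exponential sum satisfying the constraints \<open>M\<close>, and a monomial \<open>\<alpha>\<close>
  of its least term. Exponential sums without the monomial \<open>\<alpha>\<close> have least terms without \<open>\<alpha>\<close>,
  so their least terms do not span the chosen one. Each step costs a single constraint.
\<close>

lemma independent_least_parts:
  assumes "finite V" "finite M" "card M + k \<le> card V"
  shows "\<exists>A. finite A \<and> card A = k \<and> cpoly.independent A \<and>
    (\<forall>g\<in>A. \<exists>c j. (\<forall>\<alpha>\<in>M. lookup (exp_sum_part V c (total_degree \<alpha>)) \<alpha> = 0) \<and>
        exp_sum_part V c j \<noteq> 0 \<and> (\<forall>i<j. exp_sum_part V c i = 0) \<and> g = exp_sum_part V c j)"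
    (is "\<exists>A. _ A \<and> _ A \<and> _ A \<and> (\<forall>g\<in>A. ?L M g)")
  using assms(2,3)
proof (induction k arbitrary: M)
  case 0
  show ?case by (intro exI[of _ "{}"]) (simp add: cpoly.independent_empty)
next
  case (Suc k)
  have van: "lookup g \<alpha> = 0" if "?L M' g" "\<alpha> \<in> M'" for g M' \<alpha>
  proof -
    obtain c j where cj: "\<forall>\<alpha>\<in>M'. lookup (exp_sum_part V c (total_degree \<alpha>)) \<alpha> = 0" "g = exp_sum_part V c j"
      using \<open>?L M' g\<close> by blast
    show ?thesis
    proof (cases "total_degree \<alpha> = j")
      case True
      then show ?thesis using cj that(2) by auto
    next
      case False
      then show ?thesis
        using homogeneous_exp_sum_part[of j V c] by (auto simp: homogeneous_def cj(2) in_keys_iff)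
    qed
  qed
  obtain c where c: "\<exists>v\<in>V. c v \<noteq> 0"
    "\<forall>\<alpha>\<in>M. (\<Sum>v\<in>V. c v * (lookup (linear_form v ^ total_degree \<alpha>) \<alpha> / fact (total_degree \<alpha>))) = 0"
    using underdetermined_system[OF Suc.prems(1) assms(1),
        of "\<lambda>\<alpha> v. lookup (linear_form v ^ total_degree \<alpha>) \<alpha> / fact (total_degree \<alpha>)"] Suc.prems(2) by auto
  have cM: "\<forall>\<alpha>\<in>M. lookup (exp_sum_part V c (total_degree \<alpha>)) \<alpha> = 0"
    using c(2) by (simp add: exp_sum_part_def lookup_sum lookup_cscale)
  define j where "j = (LEAST j. exp_sum_part V c j \<noteq> 0)"
  have j: "exp_sum_part V c j \<noteq> 0" "\<forall>i<j. exp_sum_part V c i = 0"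
    using exp_sum_part_nonzero[OF assms(1)] c(1) LeastI_ex[of "\<lambda>j. exp_sum_part V c j \<noteq> 0"] not_less_Least
    unfolding j_def by blast+
  let ?g = "exp_sum_part V c j"
  have g: "?L M ?g" using cM j by blast
  obtain \<alpha> where \<alpha>: "lookup ?g \<alpha> \<noteq> 0"
    using j(1) by (metis lookup_zero poly_mapping_eqI)
  have "card (insert \<alpha> M) + k \<le> card V"
    using Suc.prems by (simp add: card_insert_if)
  then obtain A where A: "finite A" "card A = k" "cpoly.independent A" "\<forall>g\<in>A. ?L (insert \<alpha> M) g"
    using Suc.IH[of "insert \<alpha> M"] Suc.prems(1) by blast
  have "lookup q \<alpha> = 0" if "q \<in> cspan A" for q
    using that
  proof (induction rule: cpoly.span_induct_alt)
    case (step c x y)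
    then have "lookup x \<alpha> = 0" using A(4) van[of "insert \<alpha> M" x \<alpha>] by blast
    then show ?case using step by (simp add: lookup_add lookup_cscale)
  qed simp
  then have nin: "?g \<notin> cspan A" using \<alpha> by blast
  then have "?g \<notin> A" using cpoly.span_base by blast
  have "?L M g'" if "g' \<in> A" for g' using A(4) that by (meson insertCI)
  with g have "\<forall>g'\<in>insert ?g A. ?L M g'" by blast
  moreover have "card (insert ?g A) = Suc k" using A(1,2) \<open>?g \<notin> A\<close> by simp
  moreover have "cpoly.independent (insert ?g A)"
    using nin A(3) by (rule cpoly.independent_insertI)
  ultimately show ?case using A(1) by (intro exI[of _ "insert ?g A"]) simp
qed

lemma least_space_dim:
  assumes "finite V"
  shows "\<exists>A. finite A \<and> card A = card V \<and> cpoly.independent A \<and> A \<subseteq> least_space V"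
proof -
  obtain A where A: "finite A" "card A = card V" "cpoly.independent A"
    "\<forall>g\<in>A. \<exists>c j. exp_sum_part V c j \<noteq> 0 \<and> (\<forall>i<j. exp_sum_part V c i = 0) \<and> g = exp_sum_part V c j"
    using independent_least_parts[OF assms, of "{}" "card V"] by auto
  have "g \<in> least_space V" if "g \<in> A" for g
  proof -
    from bspec[OF A(4) that] obtain c j
      where cj: "exp_sum_part V c j \<noteq> 0" "\<forall>i<j. exp_sum_part V c i = 0" "g = exp_sum_part V c j"
      by (elim exE conjE)
    let ?f = "\<lambda>t. \<Sum>v\<in>V. c v * exp (of_real (v \<bullet> t))"
    have "is_least ?f g" unfolding is_least_exp_iff using cj by (intro exI[of _ j]) simp
    moreover have "?f \<noteq> (\<lambda>t. 0)"
    proof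
      assume "?f = (\<lambda>t. 0)"
      then have "homogeneous_expansion (\<lambda>t. 0) (exp_sum_part V c)"
        using exp_sum_part_expansion[of c V] by simp
      moreover have "homogeneous_expansion (\<lambda>t. 0) (\<lambda>j. 0)"
        by (simp add: homogeneous_expansion_def homogeneous_def)
      ultimately have "exp_sum_part V c = (\<lambda>j. 0)"
        by (rule homogeneous_expansion_unique)
      then show False using cj(1) by simp
    qed
    moreover have "?f \<in> Exp_space V" by (auto simp: Exp_space_def)
    ultimately show ?thesis
      unfolding least_space_def by (intro cpoly.span_base) blast
  qed
  with A show ?thesis by blast
qed

section \<open>The least space inside the kernel of an ideal\<close>

lemma ker_ideal_subspace: "cpoly.subspace (ker_ideal J)"
  unfolding cpoly.subspace_def ker_ideal_def by (auto simp: diff_op_add_right diff_op_scale_right)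

lemma ker_ideal_generated:
  assumes "\<And>g. g \<in> G \<Longrightarrow> diff_op g q = 0"
  shows "q \<in> ker_ideal (ideal_generated G)"
proof -
  have "diff_op p q = 0" if "p \<in> ideal_generated G" for p
    using that by (induction rule: ideal_induct) (simp_all add: diff_op_add_left diff_op_mult assms)
  then show ?thesis by (simp add: ker_ideal_def)
qed

lemma least_space_subset_kernel:
  assumes "finite R" "\<And>Y. Y \<in> \<Y> \<Longrightarrow> Y \<subseteq> R"
    and "\<And>Y v. Y \<in> \<Y> \<Longrightarrow> v \<in> V \<Longrightarrow> \<exists>y\<in>Y. X y \<bullet> v = lam y"
  shows "least_space V \<subseteq> ker_ideal (ideal_generated (form_prod X ` \<Y>))"
  unfolding least_space_def
proof (intro cpoly.span_minimal ker_ideal_subspace subsetI)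
  fix g assume "g \<in> {g. \<exists>f\<in>Exp_space V. f \<noteq> (\<lambda>t. 0) \<and> is_least f g}"
  then obtain f where f: "f \<in> Exp_space V" "is_least f g" by blast
  then obtain c where fc: "f = (\<lambda>t. \<Sum>v\<in>V. c v * exp (of_real (v \<bullet> t)))" by (auto simp: Exp_space_def)
  from f(2) obtain j where j: "\<forall>i<j. exp_sum_part V c i = 0" "g = exp_sum_part V c j"
    unfolding fc is_least_exp_iff by blast
  show "g \<in> ker_ideal (ideal_generated (form_prod X ` \<Y>))"
  proof (rule ker_ideal_generated)
    fix h assume "h \<in> form_prod X ` \<Y>"
    then obtain Y where Y: "Y \<in> \<Y>" "h = form_prod X Y" by blast
    have fin: "finite Y" using assms(1,2) Y(1) finite_subset by blast
    have "exp_sum_part V (\<lambda>v. c v * (\<Prod>y\<in>Y. of_real (X y \<bullet> v - lam y))) i = 0" for i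
    proof (rule exp_sum_part_zero_coeffs)
      fix v assume "v \<in> V"
      then obtain y where "y \<in> Y" "X y \<bullet> v = lam y" using assms(3)[OF Y(1)] by blast
      then have "(\<Prod>y\<in>Y. complex_of_real (X y \<bullet> v - lam y)) = 0"
        using fin by (intro prod_zero) auto
      then show "c v * (\<Prod>y\<in>Y. complex_of_real (X y \<bullet> v - lam y)) = 0" by simp
    qed
    then show "diff_op h g = 0"
      using diff_op_form_prod_exp_sum_part[OF fin, of j V c X lam] j by (simp add: Y(2))
  qed
qed

lemma pairing_ker_ideal: "p \<in> J \<Longrightarrow> u \<in> ker_ideal J \<Longrightarrow> pairing p u = 0"
  by (simp add: ker_ideal_def pairing_eq)

text \<open>
  More than \<open>n\<close> independent elements of the kernel would have a nonzero combination orthogonal to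
  the complement of \<open>J\<close>; it is orthogonal to \<open>J\<close> as well.
\<close>

lemma ker_ideal_dim_le:
  assumes "codim_le J n" "A \<subseteq> ker_ideal J" "cpoly.independent A" "finite A"
  shows "card A \<le> n"
proof (rule ccontr)
  assume "\<not> card A \<le> n"
  obtain S where S: "finite S" "card S \<le> n" "\<forall>p. \<exists>s\<in>cspan S. p - s \<in> J"
    using assms(1) by (auto simp: codim_le_def)
  then obtain c where c: "\<exists>v\<in>A. c v \<noteq> 0" "\<forall>s\<in>S. (\<Sum>v\<in>A. c v * pairing s v) = 0"
    using underdetermined_system[OF S(1) assms(4), of pairing] \<open>\<not> card A \<le> n\<close> by auto
  let ?u = "\<Sum>v\<in>A. cscale (c v) v"
  have u: "?u \<in> ker_ideal J"
    using assms(2) by (intro cpoly.subspace_sum[OF ker_ideal_subspace] cpoly.subspace_scale[OF ker_ideal_subspace]) auto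
  have uS: "pairing s ?u = 0" if "s \<in> S" for s
    using c(2) that by (simp add: pairing_sum_right pairing_scale_right)
  have "pairing p ?u = 0" for p
  proof -
    obtain s where s: "s \<in> cspan S" "p - s \<in> J" using S(3) by blast
    have "pairing s ?u = 0"
      using s(1) by (induction rule: cpoly.span_induct_alt)
        (simp_all only: pairing_zero_left pairing_add_left pairing_scale_left uS mult_zero_right add_0)
    moreover have "pairing (p - s) ?u = 0" using s(2) u by (rule pairing_ker_ideal)
    ultimately show ?thesis using pairing_add_left[of s "p - s" ?u] by simp
  qed
  then have "?u = 0" by (rule pairing_nondegenerate)
  with independent_nonzero_combination[OF assms(3,4) c(1)] show False by blast
qed

section \<open>Vertices of the arrangement\<close>

lemma bases_iff:
  fixes X :: "'e \<Rightarrow> real^'n"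
  assumes "finite E"
  shows "B \<in> bases X E \<longleftrightarrow> B \<subseteq> E \<and> card B = CARD('n) \<and> span (X ` B) = UNIV"
proof
  assume B: "B \<in> bases X E"
  then have "card B = card (X ` B)" by (auto simp: bases_def indep_subsets_def card_image)
  also have "\<dots> = dim (X ` B)" using B by (simp add: bases_def indep_subsets_def dim_eq_card_independent)
  also have "\<dots> = CARD('n)"
    using B by (simp add: bases_def full_dim_iff)
  finally show "B \<subseteq> E \<and> card B = CARD('n) \<and> span (X ` B) = UNIV"
    using B by (auto simp: bases_def indep_subsets_def)
next
  assume B: "B \<subseteq> E \<and> card B = CARD('n) \<and> span (X ` B) = UNIV"
  then have fin: "finite B" using assms finite_subset by blast
  have dimB: "dim (X ` B) = CARD('n)"
    using B by (simp add: full_dim_iff)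
  have "CARD('n) \<le> card (X ` B)" using dim_le_card'[of "X ` B"] fin dimB by simp
  then have c: "card (X ` B) = card B" using card_image_le[OF fin, of X] B by simp
  then have "inj_on X B" using fin by (simp add: eq_card_imp_inj_on)
  moreover have "independent (X ` B)"
    using fin c B by (intro card_le_dim_spanning[of _ UNIV]) auto
  ultimately show "B \<in> bases X E" using B by (auto simp: bases_def indep_subsets_def)
qed

lemma vertex_mem:
  fixes X :: "'e \<Rightarrow> real^'n"
  assumes "finite E" "B \<in> bases X E" "b \<in> B"
  shows "X b \<bullet> vertex X lam B = lam b"
proof -
  have B: "inj_on X B" "independent (X ` B)" "span (X ` B) = UNIV"
    using assms(2) by (auto simp: bases_def indep_subsets_def)
  obtain g :: "real^'n \<Rightarrow> real" where g: "linear g" "\<forall>v\<in>X ` B. g v = lam (inv_into B X v)"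
    using linear_independent_extend[OF B(2), of "\<lambda>v. lam (inv_into B X v)"] by blast
  define t where "t = adjoint g 1"
  have "v \<bullet> t = g v" for v
    using adjoint_works[OF g(1), of v 1] by (simp add: t_def)
  then have t: "X e \<bullet> t = lam e" if "e \<in> B" for e
    using g(2) that B(1) by simp
  have uniq: "s = t" if "\<And>e. e \<in> B \<Longrightarrow> X e \<bullet> s = lam e" for s
  proof -
    have "v \<bullet> (s - t) = 0" if "v \<in> span (X ` B)" for v
      using that by (induction rule: span_induct_alt)
        (auto simp: inner_add_left inner_diff_right t \<open>\<And>e. e \<in> B \<Longrightarrow> X e \<bullet> s = lam e\<close>)
    from this[of "s - t"] show ?thesis using B(3) by simp
  qed
  have "(\<Inter>b\<in>B. hyperplane X lam b) = {t}"
    using t uniq by (auto simp: hyperplane_def)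
  then show ?thesis using t[OF assms(3)] by (simp add: vertex_def)
qed

text \<open>
  Otherwise \<open>n + 1\<close> hyperplanes of a simple arrangement would have a common point.
\<close>

lemma vertex_not_mem:
  fixes X :: "'e \<Rightarrow> real^'n"
  assumes "finite E" "simple_arrangement X E lam" "B \<in> bases X E" "y \<in> E - B"
  shows "X y \<bullet> vertex X lam B \<noteq> lam y"
proof
  assume y: "X y \<bullet> vertex X lam B = lam y"
  have B: "B \<subseteq> E" "card B = CARD('n)" using assms(3) bases_iff[OF assms(1)] by auto
  let ?S = "\<Inter>e\<in>insert y B. hyperplane X lam e"
  have mem: "vertex X lam B \<in> ?S"
    using y vertex_mem[OF assms(1,3)] by (auto simp: hyperplane_def)
  have sub: "insert y B \<subseteq> E" using assms(4) B(1) by blast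
  have "?S = {} \<or> aff_dim ?S = int CARD('n) - int (card (insert y B))"
    using assms(2) sub unfolding simple_arrangement_def by (simp only:)
  with mem have "aff_dim ?S = int CARD('n) - int (card (insert y B))" by (metis empty_iff)
  also have "\<dots> = -1" using assms(1,4) B finite_subset by (subst card_insert_disjoint) auto
  finally have "?S = {}" by (rule aff_dim_empty[THEN iffD2])
  with mem show False by (metis empty_iff)
qed

lemma inj_on_vertex:
  fixes X :: "'e \<Rightarrow> real^'n"
  assumes "finite E" "simple_arrangement X E lam"
  shows "inj_on (vertex X lam) (bases X E)"
proof (rule inj_onI)
  fix B B' assume B: "B \<in> bases X E" "B' \<in> bases X E" "vertex X lam B = vertex X lam B'"
  have "B' \<subseteq> B"
  proof
    fix y assume y: "y \<in> B'"
    then have "X y \<bullet> vertex X lam B = lam y" using vertex_mem[OF assms(1) B(2)] B(3) by simp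
    moreover have "y \<in> E" using y B(2) bases_iff[OF assms(1)] by blast
    ultimately show "y \<in> B" using vertex_not_mem[OF assms B(1)] by blast
  qed
  moreover have "card B' = card B" "finite B"
    using B bases_iff[OF assms(1)] assms(1) finite_subset by metis+
  ultimately show "B = B'" by (metis card_subset_eq)
qed

lemma least_space_hitting_ideal:
  fixes X :: "'e \<Rightarrow> real^'n"
  assumes "finite E" "\<B> \<subseteq> bases X E" "R \<subseteq> E"
  shows "least_space (vertex X lam ` \<B>) \<subseteq> ker_ideal (hitting_ideal X {} R \<B>)"
  unfolding hitting_ideal_def
  using least_space_subset_kernel[of R "{Y. Y \<subseteq> R \<and> (\<forall>B\<in>\<B>. Y \<inter> B \<noteq> {})}" "vertex X lam ` \<B>" X lam]
    vertex_mem[OF assms(1), of _ X _ lam] assms finite_subset by fastforce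

lemma hitting_ideal_codim_ge:
  fixes X :: "'e \<Rightarrow> real^'n"
  assumes "finite E" "simple_arrangement X E lam" "\<B> \<subseteq> bases X E" "R \<subseteq> E"
    and "codim_le (hitting_ideal X {} R \<B>) n"
  shows "card \<B> \<le> n"
proof -
  have "finite (bases X E)"
    by (rule finite_subset[of _ "Pow E"]) (auto simp: bases_def indep_subsets_def assms(1))
  then have fin: "finite \<B>" using assms(3) finite_subset by blast
  have "card (vertex X lam ` \<B>) = card \<B>"
    using inj_on_vertex[OF assms(1,2)] assms(3) by (intro card_image) (rule inj_on_subset)
  then obtain A where "finite A" "card A = card \<B>" "cpoly.independent A" "A \<subseteq> least_space (vertex X lam ` \<B>)"
    using least_space_dim[of "vertex X lam ` \<B>"] fin by auto
  then show ?thesis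
    using ker_ideal_dim_le[OF assms(5)] least_space_hitting_ideal[OF assms(1,3,4)] by (metis order_trans)
qed

section \<open>The central space as a kernel\<close>

lemma dir_deriv_form_prod_orthogonal:
  assumes "finite Y" "\<And>y. y \<in> Y \<Longrightarrow> X y \<bullet> \<eta> = 0"
  shows "dir_deriv \<eta> (form_prod X Y) = 0"
  using assms
  by (induction Y rule: finite_induct)
    (simp_all add: form_prod_insert dir_deriv_linear_form_mult inner_commute, simp add: form_prod_def)

text \<open>
  Each derivative must hit a different factor that is not orthogonal to \<open>\<eta>\<close>; with as many derivatives as
  such factors, all of them are used up.
\<close>

lemma dir_deriv_form_prod:
  assumes "finite Y"
  shows "\<exists>c. (dir_deriv \<eta> ^^ card {y \<in> Y. X y \<bullet> \<eta> \<noteq> 0}) (form_prod X Y)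
    = cscale c (form_prod X {y \<in> Y. X y \<bullet> \<eta> = 0})"
  using assms
proof (induction Y rule: finite_induct)
  case empty
  show ?case by (intro exI[of _ 1]) simp
next
  case (insert y Y)
  let ?k = "card {y \<in> Y. X y \<bullet> \<eta> \<noteq> 0}" and ?q = "form_prod X {y \<in> Y. X y \<bullet> \<eta> = 0}"
  obtain c where c: "(dir_deriv \<eta> ^^ ?k) (form_prod X Y) = cscale c ?q"
    using insert.IH by blast
  show ?case
  proof (cases "X y \<bullet> \<eta> = 0")
    case True
    have "{z \<in> insert y Y. X z \<bullet> \<eta> \<noteq> 0} = {y \<in> Y. X y \<bullet> \<eta> \<noteq> 0}"
      "{z \<in> insert y Y. X z \<bullet> \<eta> = 0} = insert y {y \<in> Y. X y \<bullet> \<eta> = 0}"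
      using True by auto
    then show ?thesis
      using insert.hyps True c
      by (intro exI[of _ c])
        (simp add: form_prod_insert dir_deriv_funpow_linear_form_mult inner_commute cscale_mult_right)
  next
    case False
    have "{z \<in> insert y Y. X z \<bullet> \<eta> \<noteq> 0} = insert y {y \<in> Y. X y \<bullet> \<eta> \<noteq> 0}"
      "{z \<in> insert y Y. X z \<bullet> \<eta> = 0} = {y \<in> Y. X y \<bullet> \<eta> = 0}"
      using False by auto
    then have k: "card {z \<in> insert y Y. X z \<bullet> \<eta> \<noteq> 0} = Suc ?k"
      and q: "{z \<in> insert y Y. X z \<bullet> \<eta> = 0} = {y \<in> Y. X y \<bullet> \<eta> = 0}"
      using insert.hyps by auto
    have "(dir_deriv \<eta> ^^ Suc ?k) (form_prod X Y) = 0"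
      unfolding funpow.simps o_apply c dir_deriv_scale
      by (subst dir_deriv_form_prod_orthogonal) (use insert.hyps in auto)
    then have "(dir_deriv \<eta> ^^ Suc ?k) (form_prod X (insert y Y))
        = cscale (of_nat (Suc ?k) * of_real (\<eta> \<bullet> X y) * c) ?q"
      unfolding form_prod_insert[OF insert.hyps] dir_deriv_funpow_linear_form_mult diff_Suc_1 c by simp
    then show ?thesis unfolding k q by blast
  qed
qed

lemma dir_deriv_form_prod_zero:
  assumes "finite Y" "card {y \<in> Y. X y \<bullet> \<eta> \<noteq> 0} < k"
  shows "(dir_deriv \<eta> ^^ k) (form_prod X Y) = 0"
proof -
  obtain c where c: "(dir_deriv \<eta> ^^ card {y \<in> Y. X y \<bullet> \<eta> \<noteq> 0}) (form_prod X Y)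
      = cscale c (form_prod X {y \<in> Y. X y \<bullet> \<eta> = 0})"
    using dir_deriv_form_prod[OF assms(1)] by blast
  have "(dir_deriv \<eta> ^^ Suc (card {y \<in> Y. X y \<bullet> \<eta> \<noteq> 0})) (form_prod X Y) = 0"
    unfolding funpow.simps o_apply c dir_deriv_scale
    by (subst dir_deriv_form_prod_orthogonal) (use assms(1) in auto)
  then show ?thesis by (rule dir_deriv_funpow_vanish_mono) (use assms(2) in simp)
qed

lemma P_central_subspace: "cpoly.subspace (P_central X A)"
  unfolding P_central_def by (rule cpoly.subspace_span)

lemma power_kernel_iff:
  "p \<in> power_kernel X I R {} \<longleftrightarrow> (\<forall>\<eta>. \<eta> \<noteq> 0 \<longrightarrow> (dir_deriv \<eta> ^^ kernel_order X I R \<eta>) p = 0)"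
  by (simp add: power_kernel_def ring_module.span_empty)

lemma power_kernel_subspace: "cpoly.subspace (power_kernel X I R {})"
  by (rule cpoly.subspaceI)
    (simp_all add: power_kernel_iff dir_deriv_funpow_add dir_deriv_funpow_scale)

lemma spanning_not_orthogonal:
  fixes S :: "(real^'n) set"
  assumes "span S = UNIV" "\<eta> \<noteq> 0"
  shows "\<exists>x\<in>S. x \<bullet> \<eta> \<noteq> 0"
proof (rule ccontr)
  assume orth: "\<not> ?thesis"
  have "v \<bullet> \<eta> = 0" if "v \<in> span S" for v
    using that by (induction rule: span_induct_alt) (use orth in \<open>auto simp: inner_add_left\<close>)
  then have "\<eta> \<bullet> \<eta> = 0" using assms(1) by simp
  with assms(2) show False by simp
qed

text \<open>
  The complement of \<open>Y\<close> spans, hence has an element not orthogonal to \<open>\<eta>\<close>, and \<open>Y\<close> has fewer of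
  them than \<open>A\<close>.
\<close>

lemma P_central_subset_kernel:
  fixes X :: "'e \<Rightarrow> real^'n"
  assumes "finite A"
  shows "P_central X A \<subseteq> power_kernel X {} A {}"
  unfolding P_central_def
proof (intro cpoly.span_minimal power_kernel_subspace subsetI)
  fix g assume "g \<in> {form_prod X Y |Y. Y \<subseteq> A \<and> dim (X ` (A - Y)) = CARD('n)}"
  then obtain Y where Y: "g = form_prod X Y" "Y \<subseteq> A" "span (X ` (A - Y)) = UNIV"
    by (auto simp: full_dim_iff)
  show "g \<in> power_kernel X {} A {}"
    unfolding power_kernel_iff
  proof (intro allI impI)
    fix \<eta> :: "real^'n" assume "\<eta> \<noteq> 0"
    then obtain e where e: "e \<in> A - Y" "X e \<bullet> \<eta> \<noteq> 0"
      using spanning_not_orthogonal[OF Y(3)] by blast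
    have "{y \<in> Y. X y \<bullet> \<eta> \<noteq> 0} \<subset> {y \<in> A. X y \<bullet> \<eta> \<noteq> 0}"
      using Y(2) e by blast
    then have "card {y \<in> Y. X y \<bullet> \<eta> \<noteq> 0} < kernel_order X {} A \<eta>"
      using assms by (simp add: kernel_order_def psubset_card_mono)
    then show "(dir_deriv \<eta> ^^ kernel_order X {} A \<eta>) g = 0"
      unfolding Y(1) using Y(2) assms finite_subset by (intro dir_deriv_form_prod_zero) auto
  qed
qed

locale arrangement =
  fixes X :: "'e \<Rightarrow> real^'n" and E :: "'e set" and r :: "'e rel" and lam :: "'e \<Rightarrow> real"
  assumes finite_E: "finite E" and order: "strict_linear_order_on E r"
    and simple: "simple_arrangement X E lam"
begin

lemma trans: "trans r" and irrefl: "irrefl r" and total: "R \<subseteq> E \<Longrightarrow> total_on R r"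
  using order by (auto simp: strict_linear_order_on_def intro: total_on_subset)

lemma contracted_bases_internal:
  assumes "R \<subseteq> E"
  shows "contracted_bases X r I R {} = internal_bases X R r I"
proof -
  have fR: "finite R" using assms finite_E finite_subset by blast
  have act: "\<not> internally_active X R r I B b \<longleftrightarrow>
      (b \<in> I \<longrightarrow> (\<exists>y\<in>R. X y \<notin> span (X ` (B - {b})) \<and> y \<noteq> b \<and> (y, b) \<notin> r))"
    if "B \<in> bases X R" "b \<in> B" for B b
  proof -
    have B: "B \<subseteq> R" "card B = CARD('n)" "span (X ` B) = UNIV"
      using that(1) bases_iff[OF fR] by auto
    have "X b \<notin> span (X ` (B - {b}))"
      using basis_irredundant[of "{}" B X b] B fR finite_subset that(2) by auto
    then show ?thesis
      using that(2) B(1) unfolding internally_active_def Let_def by auto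
  qed
  show ?thesis
  proof (rule set_eqI)
    fix B
    have "(\<forall>b\<in>B \<inter> I. \<exists>y\<in>R. X y \<notin> span (X ` (B - {b})) \<and> y \<noteq> b \<and> (y, b) \<notin> r)
        \<longleftrightarrow> \<not> (\<exists>b\<in>B. internally_active X R r I B b)" if "B \<in> bases X R"
      using act[OF that] by blast
    then show "B \<in> contracted_bases X r I R {} \<longleftrightarrow> B \<in> internal_bases X R r I"
      unfolding internal_bases_def contracted_bases_def mem_Collect_eq Un_empty_left card.empty add_0_right
      using bases_iff[OF fR, of B] by blast
  qed
qed

lemma internal_bases_subset: "R \<subseteq> E \<Longrightarrow> internal_bases X R r I \<subseteq> bases X E"
  by (auto simp: internal_bases_def bases_def indep_subsets_def)

lemma codim_internal:
  assumes "R \<subseteq> E"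
  shows "codim_le (hitting_ideal X {} R (internal_bases X R r I)) (card (internal_bases X R r I))"
  using codim_hitting_ideal[of R r "{}" X I] assms finite_E finite_subset trans irrefl total
  by (auto simp: contracted_bases_internal)

text \<open>
  The tightness required for the recursion is supplied by the vertices of the simple arrangement.
\<close>

lemma kernel_inter_hitting_ideal:
  assumes "R \<subseteq> E" "p \<in> power_kernel X I R {}" "p \<in> hitting_ideal X {} R (internal_bases X R r I)"
  shows "p = 0"
proof -
  have "card (internal_bases X R r I) \<le> n"
    if "codim_le (hitting_ideal X {} R (internal_bases X R r I)) n" for n
    using hitting_ideal_codim_ge[OF finite_E simple internal_bases_subset[OF assms(1)] assms(1) that] .
  then have "p \<in> ideal_generated (linear_form ` X ` {})"
    using assms finite_E finite_subset trans irrefl total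
    by (intro power_kernel_inter_hitting_ideal[of R r "{}" X I p]) (auto simp: contracted_bases_internal)
  then show ?thesis by (simp add: ring_module.span_empty)
qed

lemma power_kernel_dim_le:
  assumes "R \<subseteq> E"
  shows "dim_at_most (power_kernel X I R {}) (card (internal_bases X R r I))"
  using dim_at_most_codim[OF hitting_ideal_subspace codim_internal[OF assms] power_kernel_subspace]
    kernel_inter_hitting_ideal[OF assms] by blast

lemma internal_bases_empty: "internal_bases X R r {} = bases X R"
  by (simp add: internal_bases_def internally_active_def)

lemma shifted_product_in_span:
  assumes "finite Z"
  shows "(\<Prod>y\<in>Z. linear_form (X y) - cscale (of_real (lam y)) 1) \<in> cspan {form_prod X Y |Y. Y \<subseteq> Z}"
  using assms
proof (induction Z rule: finite_induct)
  case empty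
  have "form_prod X {} \<in> {form_prod X Y |Y. Y \<subseteq> {}}" by blast
  then show ?case by (simp add: form_prod_def cpoly.span_base)
next
  case (insert z Z)
  let ?q = "\<Prod>y\<in>Z. linear_form (X y) - cscale (of_real (lam y)) 1"
  have "(*) (linear_form (X z)) ` {form_prod X Y |Y. Y \<subseteq> Z} \<subseteq> {form_prod X Y |Y. Y \<subseteq> insert z Z}"
  proof (clarify, intro exI conjI)
    fix Y assume Y: "Y \<subseteq> Z"
    then show "linear_form (X z) * form_prod X Y = form_prod X (insert z Y)"
      using insert.hyps finite_subset by (subst form_prod_insert) auto
  qed (use insert in auto)
  then have "linear_form (X z) * ?q \<in> cspan {form_prod X Y |Y. Y \<subseteq> insert z Z}"
    using mult_cspan[OF insert.IH] cpoly.span_mono by blast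
  moreover have "?q \<in> cspan {form_prod X Y |Y. Y \<subseteq> insert z Z}"
    by (rule subsetD[OF cpoly.span_mono insert.IH]) blast
  then have "cscale (of_real (lam z)) ?q \<in> cspan {form_prod X Y |Y. Y \<subseteq> insert z Z}"
    by (rule cpoly.span_scale)
  ultimately have "linear_form (X z) * ?q - cscale (of_real (lam z)) ?q \<in> cspan {form_prod X Y |Y. Y \<subseteq> insert z Z}"
    by (rule cpoly.span_diff)
  also have "linear_form (X z) * ?q - cscale (of_real (lam z)) ?q
      = (linear_form (X z) - cscale (of_real (lam z)) 1) * ?q"
    by (simp add: left_diff_distrib cscale_mult_left)
  finally show ?case using insert.hyps by simp
qed

text \<open>
  The product of \<open>p\<^sub>y - \<lambda>\<^sub>y\<close> over \<open>y \<in> A - B\<close> vanishes at all vertices except the one of \<open>B\<close>,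
  because the arrangement is simple.
\<close>

lemma P_central_dim_at_least:
  assumes "A \<subseteq> E"
  shows "dim_at_least (P_central X A) (card (bases X A))"
proof -
  have fA: "finite A" using assms finite_E finite_subset by blast
  have fb: "finite (bases X A)"
    by (rule finite_subset[of _ "Pow A"]) (auto simp: bases_def indep_subsets_def fA)
  define q where "q B = (\<Prod>y\<in>A - B. linear_form (X y) - cscale (of_real (lam y)) 1)" for B
  have qP: "q B \<in> P_central X A" if "B \<in> bases X A" for B
  proof -
    have B: "B \<subseteq> A" "span (X ` B) = UNIV" using that bases_iff[OF fA] by auto
    have "dim (X ` (A - Y)) = CARD('n)" if "Y \<subseteq> A - B" for Y
    proof -
      have "span (X ` B) \<subseteq> span (X ` (A - Y))" using that B(1) by (intro span_mono image_mono) blast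
      then show ?thesis using B(2) by (simp add: full_dim_iff top.extremum_uniqueI)
    qed
    then have "{form_prod X Y |Y. Y \<subseteq> A - B} \<subseteq> {form_prod X Y |Y. Y \<subseteq> A \<and> dim (X ` (A - Y)) = CARD('n)}"
      by blast
    from subsetD[OF cpoly.span_mono[OF this] shifted_product_in_span] show ?thesis
      using fA by (simp add: q_def P_central_def)
  qed
  have bE: "bases X A \<subseteq> bases X E" using assms by (auto simp: bases_def indep_subsets_def)
  have ev: "poly_eval (q B) (vertex X lam B') = 0 \<longleftrightarrow> B \<noteq> B'"
    if B: "B \<in> bases X A" "B' \<in> bases X A" for B B'
  proof -
    have "poly_eval (linear_form (X y) - cscale (of_real (lam y)) 1) t = of_real (X y \<bullet> t - lam y)" for y t
    proof -
      have "poly_eval (linear_form (X y) + cscale (- of_real (lam y)) 1) t = of_real (X y \<bullet> t - lam y)"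
        unfolding poly_eval_add poly_eval_scale poly_eval_linear_form by simp
      then show ?thesis by (simp add: cpoly.scale_minus_left)
    qed
    then have "poly_eval (q B) (vertex X lam B') = 0 \<longleftrightarrow> (\<exists>y\<in>A - B. X y \<bullet> vertex X lam B' = lam y)"
      using fA by (simp add: q_def poly_eval_prod prod_zero_iff del: of_real_diff)
    also have "\<dots> \<longleftrightarrow> (\<exists>y\<in>A - B. y \<in> B')"
      using vertex_mem[OF finite_E, of B' X] vertex_not_mem[OF finite_E simple, of B'] B(2) bE assms by blast
    also have "\<dots> \<longleftrightarrow> \<not> B' \<subseteq> B"
      using B(2) bases_iff[OF fA] by blast
    also have "\<dots> \<longleftrightarrow> B \<noteq> B'"
      using B bases_iff[OF fA] fA finite_subset by (metis card_subset_eq order_refl)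
    finally show ?thesis .
  qed
  have inj: "inj_on q (bases X A)"
    using ev by (intro inj_onI) metis
  have "cpoly.independent (q ` bases X A)"
    unfolding cpoly.dependent_finite[OF finite_imageI[OF fb]]
  proof
    assume "\<exists>u. (\<exists>v\<in>q ` bases X A. u v \<noteq> 0) \<and> (\<Sum>v\<in>q ` bases X A. cscale (u v) v) = 0"
    then obtain u B' where u: "B' \<in> bases X A" "u (q B') \<noteq> 0" "(\<Sum>v\<in>q ` bases X A. cscale (u v) v) = 0" by blast
    have "0 = poly_eval (\<Sum>B\<in>bases X A. cscale (u (q B)) (q B)) (vertex X lam B')"
      using u(3) by (simp add: sum.reindex[OF inj])
    also have "\<dots> = (\<Sum>B\<in>bases X A. u (q B) * poly_eval (q B) (vertex X lam B'))"
      by (simp add: poly_eval_sum poly_eval_scale)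
    also have "\<dots> = (\<Sum>B\<in>{B'}. u (q B) * poly_eval (q B) (vertex X lam B'))"
      using u(1) fb ev by (intro sum.mono_neutral_right) auto
    finally have "poly_eval (q B') (vertex X lam B') = 0" using u(2) by simp
    with ev[OF u(1) u(1)] show False by blast
  qed
  then show ?thesis
    unfolding dim_at_least_def using fb qP card_image[OF inj] by (intro exI[of _ "q ` bases X A"]) auto
qed

lemma P_central_eq_kernel:
  assumes "A \<subseteq> E"
  shows "P_central X A = power_kernel X {} A {}"
proof -
  have "finite A" using assms finite_E finite_subset by blast
  then show ?thesis
    using basis_of_full_dim[OF P_central_dim_at_least[OF assms] _ P_central_subset_kernel P_central_subspace]
      power_kernel_dim_le[OF assms, of "{}"] by (metis internal_bases_empty)
qed

text \<open>
  Deleting \<open>b\<close> lowers the order at \<open>\<eta>\<close> by one if \<open>b\<close> is not orthogonal to \<open>\<eta>\<close>. The strictest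
  condition among \<open>b \<in> I\<close> is the one recorded by \<open>kernel_order\<close>.
\<close>

lemma P_minus_eq_kernel:
  assumes "R \<subseteq> E" "I \<subseteq> R"
  shows "P_minus X R I = power_kernel X I R {}"
proof (cases "I = {}")
  case True
  then show ?thesis using P_central_eq_kernel[OF assms(1)] by (simp add: P_minus_def)
next
  case False
  have fR: "finite R" using assms finite_E finite_subset by blast
  have central: "P_central X (R - {b}) = power_kernel X {} (R - {b}) {}" for b
    using assms(1) by (intro P_central_eq_kernel) blast
  have card: "kernel_order X {} (R - {b}) \<eta> = card {e \<in> R. X e \<bullet> \<eta> \<noteq> 0} - (if X b \<bullet> \<eta> \<noteq> 0 then 1 else 0)"
    if "b \<in> I" for b \<eta>
  proof -
    have "{e \<in> R - {b}. X e \<bullet> \<eta> \<noteq> 0} = {e \<in> R. X e \<bullet> \<eta> \<noteq> 0} - {b}" by blast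
    then show ?thesis using that assms(2) fR by (auto simp: kernel_order_def card_Diff_singleton_if)
  qed
  show ?thesis
  proof
    show "P_minus X R I \<subseteq> power_kernel X I R {}"
    proof
      fix p assume "p \<in> P_minus X R I"
      then have p: "(dir_deriv \<eta> ^^ kernel_order X {} (R - {b}) \<eta>) p = 0" if "b \<in> I" "\<eta> \<noteq> 0" for b \<eta>
        using False that by (auto simp: P_minus_def central power_kernel_iff)
      show "p \<in> power_kernel X I R {}"
        unfolding power_kernel_iff
      proof (intro allI impI)
        fix \<eta> :: "real^'n" assume "\<eta> \<noteq> 0"
        obtain b where b: "b \<in> I" "(\<exists>b\<in>R \<inter> I. X b \<bullet> \<eta> \<noteq> 0) \<longleftrightarrow> X b \<bullet> \<eta> \<noteq> 0"
          using False assms(2) by blast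
        have "kernel_order X I R \<eta> = kernel_order X {} (R - {b}) \<eta>"
          using card[OF b(1)] b(2) by (simp add: kernel_order_def)
        then show "(dir_deriv \<eta> ^^ kernel_order X I R \<eta>) p = 0"
          using p[OF b(1) \<open>\<eta> \<noteq> 0\<close>] by simp
      qed
    qed
    show "power_kernel X I R {} \<subseteq> P_minus X R I"
    proof
      fix p assume p: "p \<in> power_kernel X I R {}"
      have "p \<in> P_central X (R - {b})" if b: "b \<in> I" for b
        unfolding central power_kernel_iff
      proof (intro allI impI)
        fix \<eta> :: "real^'n" assume "\<eta> \<noteq> 0"
        have "kernel_order X I R \<eta> \<le> kernel_order X {} (R - {b}) \<eta>"
          unfolding card[OF b] using b assms(2) by (auto simp: kernel_order_def)
        moreover have "(dir_deriv \<eta> ^^ kernel_order X I R \<eta>) p = 0"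
          using p \<open>\<eta> \<noteq> 0\<close> by (simp add: power_kernel_iff)
        ultimately show "(dir_deriv \<eta> ^^ kernel_order X {} (R - {b}) \<eta>) p = 0"
          by (rule dir_deriv_funpow_vanish_mono[rotated])
      qed
      then show "p \<in> P_minus X R I" using False by (auto simp: P_minus_def)
    qed
  qed
qed

end

section \<open>The dimension of the semi-internal space\<close>

context arrangement
begin

lemma spanning_exchange:
  assumes "span (insert u S) = UNIV" "\<And>s. s \<in> S \<Longrightarrow> s \<bullet> \<eta> = (0::real)" "u \<bullet> \<eta> \<noteq> 0" "w \<bullet> \<eta> = 0"
  shows "w \<in> span S"
proof -
  have "w \<in> span (insert u S)" using assms(1) by simp
  then obtain k where k: "w - k *\<^sub>R u \<in> span S" using span_breakdown_eq by blast
  then have "(w - k *\<^sub>R u) \<bullet> \<eta> = 0"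
    by (induction rule: span_induct_alt) (auto simp: inner_add_left assms(2))
  then have "k = 0" using assms(3,4) by (simp add: inner_diff_left)
  then show ?thesis using k by simp
qed

text \<open>
  If \<open>A - Y\<close> spans and \<open>D\<^sub>\<eta>\<close> to the given power does not kill \<open>p\<^sub>Y\<close>, then \<open>A - Y\<close> has exactly one element \<open>e0\<close>
  that is not orthogonal to \<open>\<eta>\<close>. Its orthogonal elements thus span the hyperplane, and \<open>b\<close>
  may take the place of \<open>e0\<close>.
\<close>

lemma dir_deriv_P_central:
  assumes "A \<subseteq> E" "b \<in> A" "X b \<bullet> \<eta> = 1" "p \<in> P_central X A"
  shows "(dir_deriv \<eta> ^^ (card {e \<in> A. X e \<bullet> \<eta> \<noteq> 0} - 1)) p \<in> P_central X ({e \<in> A. X e \<bullet> \<eta> = 0} \<union> {b})"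
    (is "(_ ^^ ?k) p \<in> P_central X ?A")
  using assms(4) unfolding P_central_def[of X A]
proof (induction rule: cpoly.span_induct_alt)
  case base
  show ?case by (simp add: cpoly.subspace_0[OF P_central_subspace])
next
  case (step c g q)
  then obtain Y where Y: "g = form_prod X Y" "Y \<subseteq> A" "span (X ` (A - Y)) = UNIV"
    by (auto simp: full_dim_iff)
  have fA: "finite A" using assms(1) finite_E finite_subset by blast
  then have fY: "finite Y" using Y(2) finite_subset by blast
  let ?Y1 = "{y \<in> Y. X y \<bullet> \<eta> \<noteq> 0}" and ?Y0 = "{y \<in> Y. X y \<bullet> \<eta> = 0}" and ?A1 = "{e \<in> A. X e \<bullet> \<eta> \<noteq> 0}"
  have "\<eta> \<noteq> 0" using assms(3) by auto
  then obtain e0 where e0: "e0 \<in> A - Y" "X e0 \<bullet> \<eta> \<noteq> 0"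
    using spanning_not_orthogonal[OF Y(3)] by blast
  have sub: "?Y1 \<subseteq> ?A1 - {e0}" using Y(2) e0 by blast
  have cA: "card (?A1 - {e0}) = ?k" using fA e0 by simp
  have "(dir_deriv \<eta> ^^ ?k) g \<in> P_central X ?A"
  proof (cases "card ?Y1 = ?k")
    case False
    have "card ?Y1 \<le> ?k" unfolding cA[symmetric] using fA by (intro card_mono sub) simp
    then have "(dir_deriv \<eta> ^^ ?k) g = 0"
      unfolding Y(1) using False fY by (intro dir_deriv_form_prod_zero) auto
    then show ?thesis by (simp add: cpoly.subspace_0[OF P_central_subspace])
  next
    case True
    then have Y1: "?Y1 = ?A1 - {e0}"
      using card_subset_eq[OF _ sub] fA cA by simp
    have "X ` (A - Y) \<subseteq> insert (X e0) (X ` (?A - ?Y0 - {b}))"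
    proof
      fix v assume "v \<in> X ` (A - Y)"
      then obtain e where e: "e \<in> A" "e \<notin> Y" "v = X e" by blast
      show "v \<in> insert (X e0) (X ` (?A - ?Y0 - {b}))"
      proof (cases "X e \<bullet> \<eta> = 0")
        case True
        then have "e \<noteq> b" using assms(3) by auto
        then show ?thesis using e True by blast
      next
        case False
        then have "e = e0" using e(1,2) Y1 by blast
        then show ?thesis using e(3) by blast
      qed
    qed
    from span_mono[OF this] have "span (insert (X e0) (X ` (?A - ?Y0 - {b}))) = UNIV"
      unfolding Y(3) by (rule top.extremum_uniqueI)
    note exch = spanning_exchange[OF this, of \<eta>]
    have "v \<in> span (X ` (?A - ?Y0))" for v
    proof -
      have "v - (v \<bullet> \<eta>) *\<^sub>R X b \<in> span (X ` (?A - ?Y0 - {b}))"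
        by (rule exch) (use e0(2) assms(3) in \<open>auto simp: inner_diff_left\<close>)
      also have "\<dots> \<subseteq> span (X ` (?A - ?Y0))" by (intro span_mono image_mono) blast
      finally have "v - (v \<bullet> \<eta>) *\<^sub>R X b \<in> span (X ` (?A - ?Y0))" .
      moreover have "X b \<in> span (X ` (?A - ?Y0))"
        using assms(3) by (intro span_base) auto
      ultimately have "(v - (v \<bullet> \<eta>) *\<^sub>R X b) + (v \<bullet> \<eta>) *\<^sub>R X b \<in> span (X ` (?A - ?Y0))"
        by (intro span_add span_scale)
      then show ?thesis by simp
    qed
    then have "span (X ` (?A - ?Y0)) = UNIV" by (intro UNIV_eq_I[symmetric])
    then have "dim (X ` (?A - ?Y0)) = CARD('n)" by (simp only: full_dim_iff)
    moreover have "?Y0 \<subseteq> ?A" using Y(2) by blast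
    ultimately have "form_prod X ?Y0 \<in> P_central X ?A"
      unfolding P_central_def by (intro cpoly.span_base) blast
    moreover obtain d where "(dir_deriv \<eta> ^^ ?k) g = cscale d (form_prod X ?Y0)"
      using dir_deriv_form_prod[OF fY, of X \<eta>] unfolding Y(1) True by blast
    ultimately show ?thesis by (simp add: cpoly.subspace_scale[OF P_central_subspace])
  qed
  then show ?case
    unfolding dir_deriv_funpow_add dir_deriv_funpow_scale
    by (intro cpoly.subspace_add[OF P_central_subspace] cpoly.subspace_scale[OF P_central_subspace] step(2))
qed

lemma dir_deriv_P_minus:
  assumes "I \<subseteq> E" "b \<in> E - I" "X b \<bullet> \<eta> = 1" "\<And>e. e \<in> I \<Longrightarrow> X e \<bullet> \<eta> = 0" "p \<in> P_minus X E I"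
  shows "(dir_deriv \<eta> ^^ (card {e \<in> E. X e \<bullet> \<eta> \<noteq> 0} - 1)) p \<in> P_minus X ({e \<in> E. X e \<bullet> \<eta> = 0} \<union> {b}) I"
proof (cases "I = {}")
  case True
  then show ?thesis
    using dir_deriv_P_central[of E b \<eta> p] assms by (simp add: P_minus_def)
next
  case False
  let ?A = "{e \<in> E. X e \<bullet> \<eta> = 0} \<union> {b}"
  have "(dir_deriv \<eta> ^^ (card {e \<in> E. X e \<bullet> \<eta> \<noteq> 0} - 1)) p \<in> P_central X (?A - {a})" if a: "a \<in> I" for a
  proof -
    have "{e \<in> E - {a}. X e \<bullet> \<eta> \<noteq> 0} = {e \<in> E. X e \<bullet> \<eta> \<noteq> 0}" using assms(4)[OF a] by auto
    moreover have "{e \<in> E - {a}. X e \<bullet> \<eta> = 0} \<union> {b} = ?A - {a}" using a assms(2) by blast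
    moreover have "p \<in> P_central X (E - {a})" using assms(5) a False by (simp add: P_minus_def)
    ultimately show ?thesis
      using dir_deriv_P_central[of "E - {a}" b \<eta> p] assms(2,3) a by auto
  qed
  then show ?thesis using False by (simp add: P_minus_def)
qed

text \<open>
  Adding the new least element \<open>b\<close> to \<open>I\<close> discards the set \<open>\<A>\<close> of those internal bases in which
  \<open>b\<close> is active, and imposes new equations on the normals \<open>\<eta>\<close> with \<open>\<eta> \<bottom> I\<close>, \<open>b \<bullet> \<eta> = 1\<close>. The equation for \<open>\<eta>\<close>
  costs at most the dimension of a semi-internal space, which is bounded by the number of \<open>B \<in> \<A>\<close>
  such that \<open>\<eta>\<close> is orthogonal to \<open>B - {b}\<close>. For all but finitely many \<open>\<eta>\<close> this number is \<open>0\<close>,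
  and the equation holds already.
\<close>

lemma P_minus_dim_step:
  assumes "b \<in> E" "I \<subseteq> E" "b \<notin> I"
    and above: "\<And>x. x \<in> E - insert b I \<Longrightarrow> (x, b) \<in> r" "\<And>y. y \<in> I \<Longrightarrow> (b, y) \<in> r"
    and IH: "dim_at_least (P_minus X E I) (card (internal_bases X E r I))"
  shows "dim_at_least (P_minus X E (insert b I)) (card (internal_bases X E r (insert b I)))"
proof -
  let ?m = "\<lambda>\<eta>. card {e \<in> E. X e \<bullet> \<eta> \<noteq> 0} - 1"
  let ?E = "\<lambda>\<eta>. {e \<in> E. X e \<bullet> \<eta> = 0} \<union> {b}"
  let ?B = "internal_bases X E r I"
  define \<A> where "\<A> = {B \<in> ?B. b \<in> B \<and> (\<forall>y\<in>E. X y \<notin> span (X ` (B - {b})) \<longrightarrow> y \<noteq> b \<longrightarrow> (y, b) \<in> r)}"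
  have fin: "finite ?B" "finite \<A>"
    by (rule finite_subset[of _ "Pow E"]; auto simp: \<A>_def internal_bases_def bases_def indep_subsets_def finite_E)+
  have basis: "card B = CARD('n)" "span (X ` B) = UNIV" "B \<subseteq> E" "X b \<notin> span (X ` (B - {b}))"
    if "B \<in> \<A>" for B
  proof -
    have B: "B \<in> bases X E" "b \<in> B" using that by (auto simp: \<A>_def internal_bases_def)
    then show "card B = CARD('n)" "span (X ` B) = UNIV" "B \<subseteq> E"
      using bases_iff[OF finite_E] by auto
    then show "X b \<notin> span (X ` (B - {b}))"
      using basis_irredundant[of "{}" B X b] B(2) finite_E finite_subset by auto
  qed
  have "internal_bases X E r (insert b I) \<subseteq> ?B - \<A>"
  proof
    fix B assume "B \<in> internal_bases X E r (insert b I)"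
    then have B: "B \<in> bases X E" "\<And>e. e \<in> B \<Longrightarrow> \<not> internally_active X E r (insert b I) B e"
      by (auto simp: internal_bases_def)
    have "internally_active X E r (insert b I) B e" if "internally_active X E r I B e" for e
      using that by (auto simp: internally_active_def Let_def)
    then have "B \<in> ?B" using B by (auto simp: internal_bases_def)
    moreover have "internally_active X E r (insert b I) B b" if "B \<in> \<A>"
      using that basis(4)[OF that] assms(1) by (simp add: internally_active_def Let_def \<A>_def)
    then have "B \<notin> \<A>" using B(2)[of b] by (auto simp: \<A>_def)
    ultimately show "B \<in> ?B - \<A>" by blast
  qed
  then have count_B: "card (internal_bases X E r (insert b I)) \<le> card (?B - \<A>)"
    using fin by (intro card_mono) auto
  \<comment> \<open>The value \<open>1\<close> at \<open>b\<close> makes the normal of the hyperplane spanned by \<open>B - {b}\<close> unique.\<close>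
  define is_normal where "is_normal B \<eta> \<longleftrightarrow> X b \<bullet> \<eta> = 1 \<and> (\<forall>e\<in>B - {b}. X e \<bullet> \<eta> = 0)" for B \<eta>
  have "\<exists>\<eta>. is_normal B \<eta>" if B: "B \<in> \<A>" for B
  proof -
    obtain \<eta> where \<eta>: "\<And>k. k \<in> X ` (B - {b}) \<Longrightarrow> k \<bullet> \<eta> = 0" "X b \<bullet> \<eta> \<noteq> 0"
      using separating_direction[OF basis(4)[OF B]] by blast
    then have "is_normal B ((1 / (X b \<bullet> \<eta>)) *\<^sub>R \<eta>)" by (auto simp: is_normal_def)
    then show ?thesis by blast
  qed
  then obtain nor where nor: "\<And>B. B \<in> \<A> \<Longrightarrow> is_normal B (nor B)" by metis
  have unique: "nor B = \<eta>" if B: "B \<in> \<A>" "is_normal B \<eta>" for B \<eta>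
  proof (rule ccontr)
    assume "nor B \<noteq> \<eta>"
    then obtain e where e: "e \<in> B" "X e \<bullet> (nor B - \<eta>) \<noteq> 0"
      using spanning_not_orthogonal[OF basis(2)[OF B(1)], of "nor B - \<eta>"] by auto
    then show False
      using nor[OF B(1)] B(2) by (cases "e = b") (auto simp: is_normal_def inner_diff_right)
  qed
  have I_orth: "X e \<bullet> nor B = 0" if "B \<in> \<A>" "e \<in> I" for B e
  proof -
    have "(e, b) \<notin> r" using above(2)[OF that(2)] trans irrefl by (meson irreflD transD)
    then have "X e \<in> span (X ` (B - {b}))"
      using that assms(2,3) by (auto simp: \<A>_def)
    then show ?thesis
      by (induction rule: span_induct_alt) (use nor[OF that(1)] in \<open>auto simp: is_normal_def inner_add_left\<close>)
  qed
  have count: "card (internal_bases X (?E \<eta>) r I) \<le> card {B \<in> \<A>. nor B = \<eta>}"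
    if \<eta>: "X b \<bullet> \<eta> = 1" "\<And>e. e \<in> I \<Longrightarrow> X e \<bullet> \<eta> = 0" for \<eta>
  proof (rule card_mono)
    show "finite {B \<in> \<A>. nor B = \<eta>}" using fin by simp
    show "internal_bases X (?E \<eta>) r I \<subseteq> {B \<in> \<A>. nor B = \<eta>}"
    proof
      fix B assume BE: "B \<in> internal_bases X (?E \<eta>) r I"
      have sub: "?E \<eta> \<subseteq> E" using assms(1) by blast
      from BE have B: "B \<subseteq> ?E \<eta>" "card B = CARD('n)" "span (X ` B) = UNIV"
        "\<forall>e\<in>B \<inter> I. \<exists>y\<in>?E \<eta>. X y \<notin> span (X ` (B - {e})) \<and> y \<noteq> e \<and> (y, e) \<notin> r"
        unfolding contracted_bases_internal[OF sub, symmetric] by (auto simp: contracted_bases_def)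
      have "\<exists>y\<in>E. X y \<notin> span (X ` (B - {e})) \<and> y \<noteq> e \<and> (y, e) \<notin> r" if "e \<in> B \<inter> I" for e
        using bspec[OF B(4) that] sub by (elim bexE) (rule bexI, assumption, blast)
      then have BI: "B \<in> ?B"
        unfolding contracted_bases_internal[OF order_refl, symmetric]
        using B(2,3) subset_trans[OF B(1) sub] by (simp add: contracted_bases_def)
      have "b \<in> B"
      proof (rule ccontr)
        assume "b \<notin> B"
        then have "X e \<bullet> \<eta> = 0" if "e \<in> B" for e using B(1) that by blast
        moreover have "\<eta> \<noteq> 0" using \<eta>(1) by auto
        ultimately show False using spanning_not_orthogonal[OF B(3), of \<eta>] by blast
      qed
      have orth: "X e \<bullet> \<eta> = 0" if "e \<in> B - {b}" for e using B(1) that by blast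
      have "(y, b) \<in> r" if y: "y \<in> E" "X y \<notin> span (X ` (B - {b}))" "y \<noteq> b" for y
      proof (cases "y \<in> I")
        case True
        have "insert (X b) (X ` (B - {b})) = X ` B" using \<open>b \<in> B\<close> by blast
        then have "X y \<in> span (X ` (B - {b}))"
          using spanning_exchange[of "X b" "X ` (B - {b})" \<eta> "X y"] B(3) orth \<eta> True by auto
        then show ?thesis using y(2) by blast
      qed (use above(1) y in blast)
      then have "B \<in> \<A>" using BI \<open>b \<in> B\<close> by (simp add: \<A>_def)
      moreover have "is_normal B \<eta>" using orth \<eta>(1) by (simp add: is_normal_def)
      ultimately show "B \<in> {B \<in> \<A>. nor B = \<eta>}" using unique by blast
    qed
  qed
  have target: "dim_at_most (P_minus X (?E \<eta>) I) (card {B \<in> \<A>. nor B = \<eta>})"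
    if \<eta>: "X b \<bullet> \<eta> = 1" "\<And>e. e \<in> I \<Longrightarrow> X e \<bullet> \<eta> = 0" for \<eta>
  proof -
    have sub: "?E \<eta> \<subseteq> E" "I \<subseteq> ?E \<eta>" using assms(1,2) \<eta>(2) by auto
    show ?thesis
      unfolding P_minus_eq_kernel[OF sub]
      by (rule dim_at_most_mono[OF power_kernel_dim_le[OF sub(1)] count[OF \<eta>] order_refl])
  qed
  let ?U = "\<lambda>F. {p \<in> P_minus X E I. \<forall>\<eta>\<in>F. (dir_deriv \<eta> ^^ ?m \<eta>) p = 0}"
  have U: "cpoly.subspace (?U F)" for F
  proof -
    have "cpoly.subspace (P_minus X E I)"
      unfolding P_minus_eq_kernel[OF order_refl assms(2)] by (rule power_kernel_subspace)
    then show ?thesis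
      by (auto simp: cpoly.subspace_def dir_deriv_funpow_add dir_deriv_funpow_scale)
  qed
  have normal: "X b \<bullet> \<eta> = 1" "\<And>e. e \<in> I \<Longrightarrow> X e \<bullet> \<eta> = 0" if "\<eta> \<in> nor ` \<A>" for \<eta>
    using that nor I_orth by (auto simp: is_normal_def)
  have "dim_at_least (?U F) (card ?B - (\<Sum>\<eta>\<in>F. card {B \<in> \<A>. nor B = \<eta>}))"
    if "finite F" "F \<subseteq> nor ` \<A>" for F
    using that
  proof (induction F rule: finite_induct)
    case empty
    then show ?case using IH by simp
  next
    case (insert \<eta> F)
    have \<eta>: "\<eta> \<in> nor ` \<A>" using insert.prems by blast
    have "dim_at_least {p \<in> ?U F. (dir_deriv \<eta> ^^ ?m \<eta>) p = 0}
        (card ?B - (\<Sum>\<eta>\<in>F. card {B \<in> \<A>. nor B = \<eta>}) - card {B \<in> \<A>. nor B = \<eta>})"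
    proof (rule dim_at_least_kernel[OF dir_deriv_funpow_add dir_deriv_funpow_scale U _ target])
      show "(dir_deriv \<eta> ^^ ?m \<eta>) p \<in> P_minus X (?E \<eta>) I" if "p \<in> ?U F" for p
        using that assms(1-3) normal[OF \<eta>] by (intro dir_deriv_P_minus) auto
    qed (use insert normal[OF \<eta>] in auto)
    moreover have "{p \<in> ?U F. (dir_deriv \<eta> ^^ ?m \<eta>) p = 0} = ?U (insert \<eta> F)" by auto
    ultimately show ?case using insert.hyps by (simp add: add.commute)
  qed
  from this[of "nor ` \<A>"] fin
  have "dim_at_least (?U (nor ` \<A>)) (card ?B - (\<Sum>\<eta>\<in>nor ` \<A>. card {B \<in> \<A>. nor B = \<eta>}))" by simp
  also have "(\<Sum>\<eta>\<in>nor ` \<A>. card {B \<in> \<A>. nor B = \<eta>}) = card \<A>"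
    using sum.image_gen[OF fin(2), of "\<lambda>_. 1::nat" nor] by simp
  also have "card ?B - card \<A> = card (?B - \<A>)"
    using fin by (intro card_Diff_subset[symmetric]) (auto simp: \<A>_def)
  finally have big: "dim_at_least (?U (nor ` \<A>)) (card (?B - \<A>))" .
  have "?U (nor ` \<A>) \<subseteq> P_minus X E (insert b I)"
  proof
    fix p assume p: "p \<in> ?U (nor ` \<A>)"
    have bI: "insert b I \<subseteq> E" using assms(1,2) by blast
    have pI: "(dir_deriv \<zeta> ^^ kernel_order X I E \<zeta>) p = 0" if "\<zeta> \<noteq> 0" for \<zeta>
      using p that unfolding P_minus_eq_kernel[OF order_refl assms(2)] by (simp add: power_kernel_iff)
    show "p \<in> P_minus X E (insert b I)"
      unfolding P_minus_eq_kernel[OF order_refl bI] power_kernel_iff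
    proof (intro allI impI)
      fix \<zeta> :: "real^'n" assume "\<zeta> \<noteq> 0"
      show "(dir_deriv \<zeta> ^^ kernel_order X (insert b I) E \<zeta>) p = 0"
      proof (cases "(\<exists>e\<in>I. X e \<bullet> \<zeta> \<noteq> 0) \<or> X b \<bullet> \<zeta> = 0")
        case True
        then have "(\<exists>e\<in>E \<inter> insert b I. X e \<bullet> \<zeta> \<noteq> 0) \<longleftrightarrow> (\<exists>e\<in>E \<inter> I. X e \<bullet> \<zeta> \<noteq> 0)"
          using assms(1,2) by blast
        then have "kernel_order X (insert b I) E \<zeta> = kernel_order X I E \<zeta>" by (simp only: kernel_order_def)
        then show ?thesis using pI[OF \<open>\<zeta> \<noteq> 0\<close>] by simp
      next
        case False
        \<comment> \<open>The only directions in which the order drops by the passage from \<open>I\<close> to \<open>insert b I\<close>.\<close>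
        define \<eta> where "\<eta> = (1 / (X b \<bullet> \<zeta>)) *\<^sub>R \<zeta>"
        have \<eta>: "X b \<bullet> \<eta> = 1" "\<And>e. e \<in> I \<Longrightarrow> X e \<bullet> \<eta> = 0" and \<zeta>: "\<zeta> = (X b \<bullet> \<zeta>) *\<^sub>R \<eta>"
          using False by (auto simp: \<eta>_def)
        have "(dir_deriv \<eta> ^^ ?m \<eta>) p = 0"
        proof (cases "\<eta> \<in> nor ` \<A>")
          case True
          then show ?thesis using p by blast
        next
          case nin: False
          have "dim_at_most (P_minus X (?E \<eta>) I) (card {B \<in> \<A>. nor B = \<eta>})"
            by (rule target) (use \<eta> in auto)
          moreover have "{B \<in> \<A>. nor B = \<eta>} = {}" using nin by blast
          ultimately have zero: "dim_at_most (P_minus X (?E \<eta>) I) 0" by simp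
          have mem: "(dir_deriv \<eta> ^^ ?m \<eta>) p \<in> P_minus X (?E \<eta>) I"
            using p assms(1-3) \<eta> by (intro dir_deriv_P_minus) auto
          show ?thesis
          proof (rule ccontr)
            assume "(dir_deriv \<eta> ^^ ?m \<eta>) p \<noteq> 0"
            then have "cpoly.independent {(dir_deriv \<eta> ^^ ?m \<eta>) p}" by simp
            with dim_at_mostD[OF zero, of "{(dir_deriv \<eta> ^^ ?m \<eta>) p}"] mem show False by simp
          qed
        qed
        moreover have "(dir_deriv \<zeta> ^^ k) p = cscale (of_real (X b \<bullet> \<zeta>) ^ k) ((dir_deriv \<eta> ^^ k) p)" for k
        proof (induction k)
          case (Suc k)
          have "(dir_deriv \<zeta> ^^ Suc k) p = dir_deriv ((X b \<bullet> \<zeta>) *\<^sub>R \<eta>) ((dir_deriv \<zeta> ^^ k) p)"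
            using \<zeta> by simp
          then show ?case
            unfolding Suc dir_deriv_scaled_direction dir_deriv_scale by simp
        qed simp
        moreover have "kernel_order X (insert b I) E \<zeta> = ?m \<eta>"
          using False assms(1) by (auto simp: kernel_order_def \<eta>_def)
        ultimately show ?thesis by simp
      qed
    qed
  qed
  with big count_B show ?thesis by (rule dim_at_least_mono)
qed

lemma P_minus_dim_at_least:
  assumes "I \<subseteq> E" "\<forall>x\<in>E - I. \<forall>y\<in>I. (x, y) \<in> r"
  shows "dim_at_least (P_minus X E I) (card (internal_bases X E r I))"
proof -
  have "finite I" "total_on I r" using assms(1) finite_E finite_subset total by blast+
  from this(1) trans irrefl this(2) assms show ?thesis
  proof (induction rule: finite_least_induct)
    case empty
    show ?case
      using P_central_dim_at_least[OF order_refl] by (simp add: P_minus_def internal_bases_empty)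
  next
    case (insert b I)
    show ?case
    proof (rule P_minus_dim_step)
      show "dim_at_least (P_minus X E I) (card (internal_bases X E r I))"
        using insert by (intro insert.IH) auto
    qed (use insert in auto)
  qed
qed

end

section \<open>Duality\<close>

text \<open>
  \<open>n + 1\<close> polynomials, \<open>v\<close> and a basis of \<open>P\<close>, are dependent modulo \<open>J\<close>, and \<open>v\<close> must occur in the relation.
\<close>

lemma ideal_complement:
  assumes J: "cpoly.subspace J" "codim_le J n" and P: "cpoly.subspace P" "P \<inter> J \<subseteq> {0}" "dim_at_least P n"
  shows "\<exists>j p. v = j + p \<and> j \<in> J \<and> p \<in> P"
proof -
  obtain A where A: "finite A" "n \<le> card A" "cpoly.independent A" "A \<subseteq> P"
    using P(3) by (auto simp: dim_at_least_def)
  show ?thesis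
  proof (cases "v \<in> P")
    case True
    then show ?thesis using cpoly.subspace_0[OF J(1)] by (intro exI[of _ 0] exI[of _ v]) simp
  next
    case False
    then have vA: "v \<notin> A" using A(4) by blast
    obtain x where x: "\<exists>a\<in>insert v A. x a \<noteq> 0" "(\<Sum>a\<in>insert v A. cscale (x a) a) \<in> J"
      using codim_le_dependent[OF J, of "insert v A" "\<lambda>a. a"] A(1,2) vA by auto
    define p where "p = (\<Sum>a\<in>A. cscale (x a) a)"
    have pP: "p \<in> P"
      unfolding p_def using A(4) by (intro cpoly.subspace_sum[OF P(1)] cpoly.subspace_scale[OF P(1)]) auto
    have j: "cscale (x v) v + p \<in> J" using x(2) A(1) vA by (simp add: p_def)
    have "x v \<noteq> 0"
    proof
      assume "x v = 0"
      then have "p = 0" using j pP P(2) by auto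
      moreover have "\<exists>a\<in>A. x a \<noteq> 0" using x(1) \<open>x v = 0\<close> by auto
      ultimately show False
        using independent_nonzero_combination[OF A(3,1), of x] by (simp add: p_def)
    qed
    let ?c = "inverse (x v)"
    have "v = cscale ?c (cscale (x v) v + p) + cscale (- ?c) p"
      using \<open>x v \<noteq> 0\<close> by (simp add: cpoly.scale_right_distrib)
    moreover have "cscale ?c (cscale (x v) v + p) \<in> J" by (rule cpoly.subspace_scale[OF J(1) j])
    moreover have "cscale (- ?c) p \<in> P" by (rule cpoly.subspace_scale[OF P(1) pP])
    ultimately show ?thesis by blast
  qed
qed

lemma pairing_in_dual:
  assumes "cpoly.subspace D"
  shows "restrict (pairing p) D \<in> dual_space D"
  unfolding dual_space_def
  using cpoly.subspace_add[OF assms] cpoly.subspace_scale[OF assms]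
  by (simp add: pairing_add_right pairing_scale_right)

text \<open>
  A pairing of spaces of equal finite dimension that is nondegenerate on one side is perfect: both
  injectivity and surjectivity come from counting unknowns against equations.
\<close>

lemma pairing_bij_dual:
  assumes P: "finite Q" "cpoly.independent Q" "cspan Q = P" "card Q = n"
    and D: "finite A" "cpoly.independent A" "cspan A = D" "card A = n"
    and nondeg: "\<And>u. u \<in> D \<Longrightarrow> (\<And>p. p \<in> P \<Longrightarrow> pairing p u = 0) \<Longrightarrow> u = 0"
  shows "bij_betw (\<lambda>p. restrict (pairing p) D) P (dual_space D)"
proof -
  have subD: "cpoly.subspace D" and subP: "cpoly.subspace P"
    using D(3) P(3) cpoly.subspace_span by blast+
  have A_D: "A \<subseteq> D" and Q_P: "Q \<subseteq> P" using D(3) P(3) cpoly.span_superset by blast+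
  have zero: "p = 0" if p: "p \<in> P" "\<And>u. u \<in> D \<Longrightarrow> pairing p u = 0" for p
  proof (rule ccontr)
    assume "p \<noteq> 0"
    obtain y where y: "p = (\<Sum>q\<in>Q. cscale (y q) q)"
      using cspan_finite_sum[OF P(1)] p(1) P(3) by blast
    then obtain q0 where q0: "q0 \<in> Q" "y q0 \<noteq> 0" using \<open>p \<noteq> 0\<close> by (metis (mono_tags, lifting) cpoly.scale_zero_left sum.neutral)
    \<comment> \<open>Some nonzero \<open>u \<in> D\<close> is orthogonal to all of \<open>Q\<close> but \<open>q0\<close>; since \<open>p\<close> involves \<open>q0\<close>, to \<open>q0\<close> as well.\<close>
    have "card (Q - {q0}) < card A" using P(1,4) D(4) q0(1) by (metis card_Diff1_less)
    then obtain c where c: "\<exists>a\<in>A. c a \<noteq> 0" "\<forall>q\<in>Q - {q0}. (\<Sum>a\<in>A. c a * pairing q a) = 0"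
      using underdetermined_system[of "Q - {q0}" A pairing] P(1) D(1) by auto
    define u where "u = (\<Sum>a\<in>A. cscale (c a) a)"
    have uD: "u \<in> D"
      unfolding u_def using A_D by (intro cpoly.subspace_sum[OF subD] cpoly.subspace_scale[OF subD]) auto
    have uq: "pairing q u = 0" if "q \<in> Q - {q0}" for q
      using c(2) that by (simp add: u_def pairing_sum_right pairing_scale_right)
    have "0 = pairing p u" using p(2)[OF uD] by simp
    also have "\<dots> = (\<Sum>q\<in>Q. y q * pairing q u)" by (simp add: y pairing_sum_left pairing_scale_left)
    also have "\<dots> = y q0 * pairing q0 u"
      using uq P(1) q0(1) by (simp add: sum.remove[of Q q0])
    finally have "pairing q0 u = 0" using q0(2) by simp
    with uq have uQ: "pairing q u = 0" if "q \<in> Q" for q using that by blast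
    have "pairing p' u = 0" if p': "p' \<in> P" for p'
    proof -
      obtain z where "p' = (\<Sum>q\<in>Q. cscale (z q) q)" using cspan_finite_sum[OF P(1)] p' P(3) by blast
      then show ?thesis using uQ by (simp add: pairing_sum_left pairing_scale_left)
    qed
    then have "u = 0" using nondeg uD by blast
    with independent_nonzero_combination[OF D(2,1) c(1)] show False by (simp add: u_def)
  qed
  have inj: "inj_on (\<lambda>p. restrict (pairing p) D) P"
  proof (rule inj_onI)
    fix p q assume pq: "p \<in> P" "q \<in> P" "restrict (pairing p) D = restrict (pairing q) D"
    have "pairing (p - q) u = 0" if "u \<in> D" for u
    proof -
      have "pairing p u = pairing q u" using fun_cong[OF pq(3), of u] that by simp
      then show ?thesis using pairing_add_left[of "p - q" q u] by simp
    qed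
    then have "p - q = 0" using zero cpoly.subspace_diff[OF subP pq(1,2)] by blast
    then show "p = q" by simp
  qed
  have surj: "\<exists>p\<in>P. \<phi> = restrict (pairing p) D" if \<phi>: "\<phi> \<in> dual_space D" for \<phi>
  proof -
    have lin: "\<phi> (u + v) = \<phi> u + \<phi> v" "\<phi> (cscale c u) = c * \<phi> u" if "u \<in> D" "v \<in> D" for u v c
      using \<phi> that by (auto simp: dual_space_def)
    \<comment> \<open>The coefficient at \<open>None\<close> is that of \<open>\<phi>\<close>; there is one unknown more than equations.\<close>
    let ?V = "insert None (Some ` Q)"
    let ?a = "\<lambda>a w. case w of None \<Rightarrow> - \<phi> a | Some q \<Rightarrow> pairing q a"
    have "card A < card ?V" using P(1,4) D(4) by (simp add: card_image)
    then obtain c where c: "\<exists>w\<in>?V. c w \<noteq> 0" "\<forall>a\<in>A. (\<Sum>w\<in>?V. c w * ?a a w) = 0"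
      using underdetermined_system[of A ?V ?a] P(1) D(1) by auto
    define p where "p = (\<Sum>q\<in>Q. cscale (c (Some q)) q)"
    have pP: "p \<in> P"
      unfolding p_def using Q_P by (intro cpoly.subspace_sum[OF subP] cpoly.subspace_scale[OF subP]) auto
    have onA: "pairing p a = c None * \<phi> a" if "a \<in> A" for a
      using c(2) that P(1) by (simp add: sum.reindex p_def pairing_sum_left pairing_scale_left)
    have onD: "pairing p u = c None * \<phi> u" if "u \<in> D" for u
    proof -
      have "u \<in> cspan A" using that D(3) by simp
      then have "u \<in> D \<and> pairing p u = c None * \<phi> u"
      proof (induction rule: cpoly.span_induct_alt)
        case base
        have "\<phi> 0 = 0" using lin(2)[of 0 0 0] cpoly.subspace_0[OF subD] by simp
        then show ?case using cpoly.subspace_0[OF subD] by simp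
      next
        case (step k x y)
        have x: "x \<in> D" "cscale k x \<in> D"
          using step(1) A_D cpoly.subspace_scale[OF subD] by blast+
        show ?case
          using step x onA[OF step(1)] lin(1)[OF x(2), of y] lin(2)[OF x(1) x(1)] cpoly.subspace_add[OF subD x(2)]
          by (simp add: pairing_add_right pairing_scale_right algebra_simps)
      qed
      then show ?thesis by blast
    qed
    have "c None \<noteq> 0"
    proof
      assume "c None = 0"
      then have "p = 0" using zero[OF pP] onD by simp
      moreover have "\<exists>q\<in>Q. c (Some q) \<noteq> 0" using c(1) \<open>c None = 0\<close> by auto
      ultimately show False
        using independent_nonzero_combination[OF P(2,1), of "\<lambda>q. c (Some q)"] by (simp add: p_def)
    qed
    have "\<phi> = restrict (pairing (cscale (inverse (c None)) p)) D"
    proof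
      fix u
      show "\<phi> u = restrict (pairing (cscale (inverse (c None)) p)) D u"
        using \<phi> onD[of u] \<open>c None \<noteq> 0\<close>
        by (cases "u \<in> D") (auto simp: pairing_scale_left dual_space_def extensional_def)
    qed
    then show ?thesis using cpoly.subspace_scale[OF subP pP] by blast
  qed
  show ?thesis
    unfolding bij_betw_def
    using inj surj pairing_in_dual[OF subD] by blast
qed

theorem theorem3p5:
  fixes X :: "'e \<Rightarrow> real^'n" and E I :: "'e set" and r :: "'e rel" and lam :: "'e \<Rightarrow> real"
  assumes "finite E"
    and "\<forall>e\<in>E. X e \<noteq> 0"
    and "span (X ` E) = UNIV"
    and "I \<in> indep_subsets X E"
    and "strict_linear_order_on E r"
    and "\<forall>x\<in>E - I. \<forall>y\<in>I. (x, y) \<in> r"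
    and "simple_arrangement X E lam"
  shows
    "(D_minus X E r I = least_space (V_minus X E r lam I)
      \<and> (\<exists>S. finite S \<and> cspan S = D_minus X E r I)
      \<and> cdim (D_minus X E r I) = card (internal_bases X E r I))
   \<and>
     ({j + p |j p. j \<in> J_minus X E r I \<and> p \<in> P_minus X E I} = UNIV
      \<and> J_minus X E r I \<inter> P_minus X E I = {0})
   \<and>
     (bij_betw (\<lambda>p. restrict (pairing p) (D_minus X E r I))
        (P_minus X E I) (dual_space (D_minus X E r I))
      \<and> (\<forall>p\<in>P_minus X E I. \<forall>q\<in>P_minus X E I. \<forall>u\<in>D_minus X E r I.
           pairing (p + q) u = pairing p u + pairing q u)
      \<and> (\<forall>c. \<forall>p\<in>P_minus X E I. \<forall>u\<in>D_minus X E r I.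
           pairing (cscale c p) u = c * pairing p u))"
proof -
  interpret arrangement X E r lam using assms by unfold_locales
  let ?B = "internal_bases X E r I" and ?J = "J_minus X E r I" and ?P = "P_minus X E I" and ?D = "D_minus X E r I"
  let ?L = "least_space (V_minus X E r lam I)" and ?n = "card (internal_bases X E r I)"
  have IE: "I \<subseteq> E" using assms(4) by (simp add: indep_subsets_def)
  have J: "?J = hitting_ideal X {} E ?B"
    by (simp add: J_minus_def long_subsets_def hitting_ideal_def)
  have subJ: "cpoly.subspace ?J" unfolding J by (rule hitting_ideal_subspace)
  have codim: "codim_le ?J ?n" unfolding J by (rule codim_internal) simp
  have kernel: "?P = power_kernel X I E {}" by (rule P_minus_eq_kernel[OF order_refl IE])
  have subP: "cpoly.subspace ?P" unfolding kernel by (rule power_kernel_subspace)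
  have PJ: "?P \<inter> ?J \<subseteq> {0}" unfolding kernel J using kernel_inter_hitting_ideal[OF order_refl] by blast
  have dimP: "dim_at_least ?P ?n" using P_minus_dim_at_least[OF IE assms(6)] .
  have dec: "\<exists>j p. v = j + p \<and> j \<in> ?J \<and> p \<in> ?P" for v
    by (rule ideal_complement[OF subJ codim subP PJ dimP])
  have subD: "cpoly.subspace ?D" unfolding D_minus_def by (rule ker_ideal_subspace)
  have dimD: "dim_at_most ?D ?n"
    unfolding D_minus_def dim_at_most_def using ker_ideal_dim_le[OF codim] by blast
  have bE: "?B \<subseteq> bases X E" by (rule internal_bases_subset) simp
  have LD: "?L \<subseteq> ?D"
    unfolding V_minus_def D_minus_def J by (rule least_space_hitting_ideal[OF assms(1) bE order_refl])
  have fB: "finite ?B"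
    by (rule finite_subset[of _ "Pow E"]) (auto simp: internal_bases_def bases_def indep_subsets_def assms(1))
  have cV: "card (V_minus X E r lam I) = ?n"
    unfolding V_minus_def using inj_on_vertex[OF assms(1,7)] bE by (intro card_image) (rule inj_on_subset)
  have "finite (V_minus X E r lam I)" using fB by (simp add: V_minus_def)
  from least_space_dim[OF this] have dimL: "dim_at_least ?L ?n"
    unfolding cV dim_at_least_def by force
  have subL: "cpoly.subspace ?L" unfolding least_space_def by (rule cpoly.subspace_span)
  obtain A where A: "finite A" "card A = ?n" "cpoly.independent A" "cspan A = ?L" "?L = ?D"
    by (rule basis_of_full_dim[OF dimL dimD LD subL])
  have dimP': "dim_at_most ?P ?n" using dim_at_most_codim[OF subJ codim subP PJ] .
  obtain Q where Q: "finite Q" "card Q = ?n" "cpoly.independent Q" "cspan Q = ?P"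
    by (rule basis_of_full_dim[OF dimP dimP' order_refl subP])
  have nondeg: "u = 0" if u: "u \<in> ?D" "\<And>p. p \<in> ?P \<Longrightarrow> pairing p u = 0" for u
  proof (rule pairing_nondegenerate)
    fix v
    obtain j p where "v = j + p" "j \<in> ?J" "p \<in> ?P" using dec by blast
    then show "pairing v u = 0"
      using u pairing_ker_ideal[of j ?J u] by (simp add: D_minus_def pairing_add_left)
  qed
  have "cdim ?D = ?n"
    using cpoly.dim_span_eq_card_independent[OF A(3)] A(2,4,5) by simp
  moreover have "\<exists>S. finite S \<and> cspan S = ?D" using A by blast
  moreover have "{j + p |j p. j \<in> ?J \<and> p \<in> ?P} = UNIV" using dec by blast
  moreover have "?J \<inter> ?P = {0}"
    using PJ cpoly.subspace_0[OF subJ] cpoly.subspace_0[OF subP] by blast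
  moreover have "bij_betw (\<lambda>p. restrict (pairing p) ?D) ?P (dual_space ?D)"
  proof (rule pairing_bij_dual[OF Q(1,3,4,2) A(1,3) _ A(2) nondeg])
    show "cspan A = ?D" using A(4,5) by simp
  qed
  ultimately show ?thesis
    using A(5) by (simp add: pairing_add_left pairing_scale_left)
qed

end
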